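(* For $u\in\mathbb{R}$ let $S^u:=T_{\mathcal{S}^u}:\mathcal{U}\to\mathcal{U}$ be the ($\mathcal{W}_{H^U}$-almost surely unique) transformation associated with the orthogonal transformation $\mathcal{S}^u$ of $H^U$ given by $\widehat{\mathcal{S}^u h}(\lambda)=e^{-2iu\arctan(2\lambda)}\,\widehat h(\lambda)$. Then $\{(S^u(\omega))(t):(u,t)\in\mathbb{R}^2\}$ is, under $\mathcal{W}_{H^U}$, a Gaussian family in $L^2(\mathcal{W}_{H^U})$ with, for all $u,v,s,t\in\mathbb{R}$, $$\mathbb{E}_{\mathcal{W}_{H^U}}\bigl[(S^u(\omega))(s)\,(S^v(\omega))(t)\bigr]=\frac{2}{\pi}\int_{-\infty}^{\infty}\frac{e^{i[(t-s)\lambda+2(u-v)\arctan(2\lambda)]}}{1+4\lambda^2}\,d\lambda .$$ In particular its distribution is stationary in $(u,t)\in\mathbb{R}^2$. Moreover, the family admits a modification which is jointly continuous in $(u,t)\in\mathbb{R}^2$, and for each fixed $u\in\mathbb{R}$ the process $t\mapsto (S^u(\omega))(t)$ is a standard stationary Ornstein--Uhlenbeck process, i.e. has law $\mathcal{W}_{H^U}$.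
   Context: Abstract Wiener space: a triple $(H,E,\mathcal{W})$ with $H$ a separable real Hilbert space continuously embedded as a dense subspace of a separable real Banach space $E$, and $\mathcal{W}$ a Borel probability measure on $E$ such that for each $x^*\in E^*$ the map $x\mapsto\langle x,x^*\rangle$ is, under $\mathcal{W}$, a centered Gaussian variable with variance $\|h_{x^*}\|_H^2$, where $h_{x^*}\in H$ is determined by $(h,h_{x^*})_H=\langle h,x^*\rangle$ for all $h\in H$. The Paley--Wiener map $\mathcal{I}:H\to L^2(\mathcal{W})$ is the unique isometry with $\mathcal{I}(h_{x^*})=\langle\cdot,x^*\rangle$ for all $x^*\in E^*$. For an orthogonal transformation $\mathcal{Q}$ of $H$, $T_{\mathcal{Q}}:E\to E$ denotes the $\mathcal{W}$-almost surely unique measurable map such that, for each $h\in H$, $\mathcal{I}(h)\circ T_{\mathcal{Q}}=\mathcal{I}(\mathcal{Q}^\top h)$ $\mathcal{W}$-almost surely. $H^U$ is the Hilbert space of absolutely continuous $h:\mathbb{R}\to\mathbb{R}$ with $\|h\|_{H^U}^2=\int_{\mathbb{R}}(\tfrac14 h(t)^2+\dot h(t)^2)\,dt<\infty$. $\mathcal{U}$ is the Banach space of continuous $\omega:\mathbb{R}\to\mathbb{R}$ with $\lim_{|t|\to\infty}|\omega(t)|/\log|t|=0$ and norm $\|\omega\|_{\mathcal{U}}=\sup_{t\in\mathbb{R}}|\omega(t)|/\log(e+|t|)$. $\mathcal{W}_{H^U}$ is the law on $\mathcal{U}$ of the standard reversible Ornstein--Uhlenbeck process, i.e. the law of $t\mapsto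 e^{-t/2}B(e^t)$ where $B$ is a standard real Brownian motion; $(H^U,\mathcal{U},\mathcal{W}_{H^U})$ is an abstract Wiener space. Fourier transform convention: $\widehat h(\lambda)=\int_{\mathbb{R}}e^{-i\lambda x}h(x)\,dx$ (extended to $L^2(\mathbb{R})$). With this convention $\|h\|_{H^U}^2=\frac{1}{8\pi}\int_{\mathbb{R}}|\widehat h(\lambda)|^2(1+4\lambda^2)\,d\lambda$, so $\mathcal{S}^u$ is an orthogonal transformation of $H^U$. A modification of the family is a family $\{X(u,t):(u,t)\in\mathbb{R}^2\}$ of random variables on $(\mathcal{U},\mathcal{W}_{H^U})$ with $X(u,t)=(S^u(\omega))(t)$ $\mathcal{W}_{H^U}$-almost surely for each $(u,t)$. *)

theory Defs
  imports "HOL-Probability.Probability"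
begin

typedef upath = "{\<omega> :: real \<Rightarrow> real. continuous_on UNIV \<omega> \<and>
    ((\<lambda>t. \<bar>\<omega> t\<bar> / ln \<bar>t\<bar>) \<longlongrightarrow> 0) at_infinity}"
  morphisms upath_apply Upath
  by (rule exI[of _ "\<lambda>_. 0"]) auto

setup_lifting type_definition_upath

lemma upath_eqI: "(\<And>t. upath_apply x t = upath_apply y t) \<Longrightarrow> x = y"
  by (metis ext upath_apply_inject)

instantiation upath :: real_vector
begin

lift_definition zero_upath :: upath is "\<lambda>_. 0" by auto

lift_definition uminus_upath :: "upath \<Rightarrow> upath" is "\<lambda>f t. - f t"
  by (auto intro: continuous_intros)

lift_definition plus_upath :: "upath \<Rightarrow> upath \<Rightarrow> upath" is "\<lambda>f g t. f t + g t"
proof -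
  fix f g :: "real \<Rightarrow> real"
  assume f: "continuous_on UNIV f \<and> ((\<lambda>t. \<bar>f t\<bar> / ln \<bar>t\<bar>) \<longlongrightarrow> 0) at_infinity"
    and g: "continuous_on UNIV g \<and> ((\<lambda>t. \<bar>g t\<bar> / ln \<bar>t\<bar>) \<longlongrightarrow> 0) at_infinity"
  have "((\<lambda>t. \<bar>f t\<bar> / ln \<bar>t\<bar> + \<bar>g t\<bar> / ln \<bar>t\<bar>) \<longlongrightarrow> 0 + 0) at_infinity"
    using f g by (intro tendsto_add) blast+
  hence lim: "((\<lambda>t. \<bar>f t\<bar> / ln \<bar>t\<bar> + \<bar>g t\<bar> / ln \<bar>t\<bar>) \<longlongrightarrow> 0) at_infinity"
    by simp
  have "\<forall>\<^sub>F t::real in at_infinity. norm (\<bar>f t + g t\<bar> / ln \<bar>t\<bar>) \<le> \<bar>f t\<bar> / ln \<bar>t\<bar> + \<bar>g t\<bar> / ln \<bar>t\<bar>"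
    unfolding eventually_at_infinity
  proof (intro exI[of _ 1] allI impI)
    fix t :: real assume "1 \<le> norm t"
    hence "0 \<le> ln \<bar>t\<bar>" by simp
    hence "\<bar>f t + g t\<bar> / ln \<bar>t\<bar> \<le> (\<bar>f t\<bar> + \<bar>g t\<bar>) / ln \<bar>t\<bar>"
      by (intro divide_right_mono) auto
    thus "norm (\<bar>f t + g t\<bar> / ln \<bar>t\<bar>) \<le> \<bar>f t\<bar> / ln \<bar>t\<bar> + \<bar>g t\<bar> / ln \<bar>t\<bar>"
      using \<open>0 \<le> ln \<bar>t\<bar>\<close> by (simp add: add_divide_distrib)
  qed
  from Lim_null_comparison[OF this lim] f g
  show "continuous_on UNIV (\<lambda>t. f t + g t) \<and> ((\<lambda>t. \<bar>f t + g t\<bar> / ln \<bar>t\<bar>) \<longlongrightarrow> 0) at_infinity"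
    by (auto intro: continuous_intros)
qed

lift_definition minus_upath :: "upath \<Rightarrow> upath \<Rightarrow> upath" is "\<lambda>f g t. f t - g t"
proof -
  fix f g :: "real \<Rightarrow> real"
  assume f: "continuous_on UNIV f \<and> ((\<lambda>t. \<bar>f t\<bar> / ln \<bar>t\<bar>) \<longlongrightarrow> 0) at_infinity"
    and g: "continuous_on UNIV g \<and> ((\<lambda>t. \<bar>g t\<bar> / ln \<bar>t\<bar>) \<longlongrightarrow> 0) at_infinity"
  have e: "upath_apply (Upath f + - Upath g) t = f t - g t" for t
    using f g by (simp add: plus_upath.rep_eq uminus_upath.rep_eq Upath_inverse)
  show "continuous_on UNIV (\<lambda>t. f t - g t) \<and> ((\<lambda>t. \<bar>f t - g t\<bar> / ln \<bar>t\<bar>) \<longlongrightarrow> 0) at_infinity"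
    using upath_apply[of "Upath f + - Upath g"] by (simp flip: e)
qed

lift_definition scaleR_upath :: "real \<Rightarrow> upath \<Rightarrow> upath" is "\<lambda>c f t. c * f t"
proof -
  fix c :: real and f :: "real \<Rightarrow> real"
  assume f: "continuous_on UNIV f \<and> ((\<lambda>t. \<bar>f t\<bar> / ln \<bar>t\<bar>) \<longlongrightarrow> 0) at_infinity"
  have "((\<lambda>t. \<bar>c\<bar> * (\<bar>f t\<bar> / ln \<bar>t\<bar>)) \<longlongrightarrow> \<bar>c\<bar> * 0) at_infinity"
    by (intro tendsto_mult) (use f in auto)
  thus "continuous_on UNIV (\<lambda>t. c * f t) \<and> ((\<lambda>t. \<bar>c * f t\<bar> / ln \<bar>t\<bar>) \<longlongrightarrow> 0) at_infinity"
    using f by (auto intro: continuous_intros simp: abs_mult)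
qed

instance
  by standard (rule upath_eqI, simp add: plus_upath.rep_eq zero_upath.rep_eq uminus_upath.rep_eq
      minus_upath.rep_eq scaleR_upath.rep_eq algebra_simps)+

end

lemmas upath_rep_simps = plus_upath.rep_eq zero_upath.rep_eq uminus_upath.rep_eq
  minus_upath.rep_eq scaleR_upath.rep_eq

abbreviation logw :: "real \<Rightarrow> real" where
  "logw t \<equiv> ln (exp 1 + \<bar>t\<bar>)"

lemma logw_ge_1: "1 \<le> logw t"
proof -
  have "ln (exp 1) \<le> logw t" by (subst ln_le_cancel_iff) (auto simp: add_pos_nonneg)
  thus ?thesis by simp
qed

lemma logw_pos: "0 < logw t" using logw_ge_1[of t] by linarith

lemma continuous_on_logw: "continuous_on UNIV logw"
proof (intro continuous_intros ballI)
  fix t :: real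
  have "0 < exp 1 + \<bar>t\<bar>" by (intro add_pos_nonneg) auto
  thus "exp 1 + \<bar>t\<bar> \<noteq> 0" by simp
qed

lemma logw_le_ln: "exp 1 \<le> \<bar>t\<bar> \<Longrightarrow> ln \<bar>t\<bar> \<le> logw t \<and> logw t \<le> 2 * ln \<bar>t\<bar> \<and> 1 \<le> ln \<bar>t\<bar>"
proof -
  assume t: "exp 1 \<le> \<bar>t\<bar>"
  have e: "2 \<le> exp (1::real)" using exp_ge_add_one_self[of "1::real"] by simp
  have p: "0 < \<bar>t\<bar>" using t e by linarith
  have "ln (exp 1) \<le> ln \<bar>t\<bar>" using t p by (subst ln_le_cancel_iff) auto
  hence 1: "1 \<le> ln \<bar>t\<bar>" by simp
  have 2: "ln \<bar>t\<bar> \<le> logw t" using p by (subst ln_le_cancel_iff) (auto simp: add_pos_nonneg)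
  have "2 * \<bar>t\<bar> \<le> \<bar>t\<bar> * \<bar>t\<bar>" using t e by (intro mult_right_mono) auto
  hence "exp 1 + \<bar>t\<bar> \<le> \<bar>t\<bar> * \<bar>t\<bar>" using t by linarith
  hence "logw t \<le> ln (\<bar>t\<bar> * \<bar>t\<bar>)"
    using mult_pos_pos[OF p p] by (subst ln_le_cancel_iff) (auto simp: add_pos_nonneg)
  also have "\<dots> = 2 * ln \<bar>t\<bar>" using p by (subst ln_mult) auto
  finally show ?thesis using 1 2 by blast
qed

lemma lim_logw_iff:
  "((\<lambda>t. \<bar>f t\<bar> / ln \<bar>t\<bar>) \<longlongrightarrow> 0) at_infinity \<longleftrightarrow> ((\<lambda>t. f t / logw t) \<longlongrightarrow> (0::real)) at_infinity"
proof
  assume l: "((\<lambda>t. \<bar>f t\<bar> / ln \<bar>t\<bar>) \<longlongrightarrow> 0) at_infinity"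
  have "\<forall>\<^sub>F t in at_infinity. norm (f t / logw t) \<le> \<bar>f t\<bar> / ln \<bar>t\<bar>"
    unfolding eventually_at_infinity
    by (intro exI[of _ "exp 1"] allI impI)
       (use logw_le_ln logw_pos in \<open>fastforce simp: abs_divide abs_of_pos intro: frac_le\<close>)
  from Lim_null_comparison[OF this l] show "((\<lambda>t. f t / logw t) \<longlongrightarrow> 0) at_infinity" .
next
  assume l: "((\<lambda>t. f t / logw t) \<longlongrightarrow> 0) at_infinity"
  have l': "((\<lambda>t. 2 * \<bar>f t / logw t\<bar>) \<longlongrightarrow> 0) at_infinity"
    using tendsto_mult[OF tendsto_const[of 2] tendsto_rabs[OF l]] by simp
  have "\<forall>\<^sub>F t in at_infinity. norm (\<bar>f t\<bar> / ln \<bar>t\<bar>) \<le> 2 * \<bar>f t / logw t\<bar>"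
    unfolding eventually_at_infinity
  proof (intro exI[of _ "exp 1"] allI impI)
    fix t :: real assume "exp 1 \<le> norm t"
    hence *: "ln \<bar>t\<bar> \<le> logw t" "logw t \<le> 2 * ln \<bar>t\<bar>" "1 \<le> ln \<bar>t\<bar>"
      using logw_le_ln by auto
    have "\<bar>f t\<bar> / ln \<bar>t\<bar> = 2 * (\<bar>f t\<bar> / (2 * ln \<bar>t\<bar>))" by simp
    also have "\<dots> \<le> 2 * (\<bar>f t\<bar> / logw t)"
      using * logw_pos[of t] by (intro mult_left_mono divide_left_mono) auto
    finally show "norm (\<bar>f t\<bar> / ln \<bar>t\<bar>) \<le> 2 * \<bar>f t / logw t\<bar>"
      using * logw_pos[of t] by (simp add: abs_divide abs_of_pos)
  qed
  from Lim_null_comparison[OF this l'] show "((\<lambda>t. \<bar>f t\<bar> / ln \<bar>t\<bar>) \<longlongrightarrow> 0) at_infinity" .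
qed

lemma bcontfun_of_lim:
  fixes f :: "real \<Rightarrow> real"
  assumes c: "continuous_on UNIV f" and l: "(f \<longlongrightarrow> 0) at_infinity"
  shows "f \<in> bcontfun"
proof -
  have "\<forall>\<^sub>F t in at_infinity. norm (f t) < 1"
    using tendstoD[OF l, of 1] by simp
  then obtain b where b: "\<And>t. b \<le> norm t \<Longrightarrow> norm (f t) < 1"
    unfolding eventually_at_infinity by auto
  have "bounded (f ` {-\<bar>b\<bar>..\<bar>b\<bar>})"
    by (intro compact_imp_bounded compact_continuous_image continuous_on_subset[OF c]) auto
  then obtain M where M: "\<And>t. t \<in> {-\<bar>b\<bar>..\<bar>b\<bar>} \<Longrightarrow> norm (f t) \<le> M"
    unfolding bounded_iff by blast
  have "norm (f t) \<le> max M 1" for t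
  proof (cases "t \<in> {-\<bar>b\<bar>..\<bar>b\<bar>}")
    case True thus ?thesis using M by fastforce
  next
    case False
    hence "b \<le> norm t" by auto
    thus ?thesis using b[of t] by auto
  qed
  hence "bounded (range f)" by (auto simp: bounded_iff)
  thus ?thesis using c by (auto simp: bcontfun_def)
qed

text \<open>The norm of \<open>U\<close> is transported from the bounded continuous functions along this injection.\<close>

definition upath_bc :: "upath \<Rightarrow> real \<Rightarrow>\<^sub>C real" where
  "upath_bc \<omega> = Bcontfun (\<lambda>t. upath_apply \<omega> t / logw t)"

lemma upath_bc_apply: "apply_bcontfun (upath_bc \<omega>) = (\<lambda>t. upath_apply \<omega> t / logw t)"
proof -
  have "logw t \<noteq> 0" for t using logw_pos[of t] by simp
  hence "continuous_on UNIV (\<lambda>t. upath_apply \<omega> t / logw t)"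
    using upath_apply[of \<omega>] by (intro continuous_on_divide continuous_on_logw) auto
  moreover have "((\<lambda>t. upath_apply \<omega> t / logw t) \<longlongrightarrow> 0) at_infinity"
    using upath_apply[of \<omega>] by (simp add: lim_logw_iff)
  ultimately show ?thesis
    unfolding upath_bc_def by (intro Bcontfun_inverse bcontfun_of_lim)
qed

lemma upath_bc_simps:
  "upath_bc (x + y) = upath_bc x + upath_bc y" "upath_bc (x - y) = upath_bc x - upath_bc y"
  "upath_bc (c *\<^sub>R x) = c *\<^sub>R upath_bc x" "upath_bc 0 = 0"
  by (rule bcontfun_eqI,
      simp add: upath_bc_apply upath_rep_simps add_divide_distrib diff_divide_distrib)+

lemma upath_bc_inj: "upath_bc x = upath_bc y \<longleftrightarrow> x = y"
proof
  assume e: "upath_bc x = upath_bc y"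
  have "upath_apply x t / logw t = upath_apply y t / logw t" for t
    using e by (metis upath_bc_apply)
  thus "x = y"
    by (intro upath_eqI) (metis logw_pos divide_cancel_right less_numeral_extra(3))
qed simp

instantiation upath :: real_normed_vector
begin

definition norm_upath :: "upath \<Rightarrow> real" where
  "norm_upath \<omega> = (SUP t. \<bar>upath_apply \<omega> t\<bar> / ln (exp 1 + \<bar>t\<bar>))"

definition dist_upath :: "upath \<Rightarrow> upath \<Rightarrow> real" where
  "dist_upath x y = norm (x - y)"

definition sgn_upath :: "upath \<Rightarrow> upath" where
  "sgn_upath x = x /\<^sub>R norm x"

definition uniformity_upath :: "(upath \<times> upath) filter" where
  "uniformity_upath = (INF e\<in>{0 <..}. principal {(x, y). dist x y < e})"

definition open_upath :: "upath set \<Rightarrow> bool" where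
  "open_upath U = (\<forall>x\<in>U. eventually (\<lambda>(x', y). x' = x \<longrightarrow> y \<in> U) uniformity)"

lemma norm_upath_bc: "norm (x :: upath) = norm (upath_bc x)"
proof -
  have "norm (upath_bc x) = (SUP t. norm (upath_bc x t))"
    unfolding norm_bcontfun_def dist_bcontfun_def
    by (simp add: zero_bcontfun.rep_eq dist_norm)
  thus ?thesis
    by (simp add: norm_upath_def upath_bc_apply abs_divide abs_of_pos[OF logw_pos])
qed

instance
proof
  fix x y :: upath and a :: real
  show "dist x y = norm (x - y)" by (rule dist_upath_def)
  show "sgn x = x /\<^sub>R norm x" by (rule sgn_upath_def)
  show "uniformity = (INF e\<in>{0 <..}. principal {(x :: upath, y). dist x y < e})"
    by (rule uniformity_upath_def)
  show "open U = (\<forall>x\<in>U. \<forall>\<^sub>F (x', y) in uniformity. x' = x \<longrightarrow> y \<in> U)" for U :: "upath set"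
    by (rule open_upath_def)
  show "norm x = 0 \<longleftrightarrow> x = 0"
    by (metis norm_upath_bc norm_eq_zero upath_bc_inj upath_bc_simps(4))
  show "norm (x + y) \<le> norm x + norm y"
    by (simp add: norm_upath_bc upath_bc_simps norm_triangle_ineq)
  show "norm (a *\<^sub>R x) = \<bar>a\<bar> * norm x"
    by (simp add: norm_upath_bc upath_bc_simps)
qed

end

instance upath :: banach
proof
  fix X :: "nat \<Rightarrow> upath" assume "Cauchy X"
  have d: "dist x y = dist (upath_bc x) (upath_bc y)" for x y
    by (simp add: dist_norm norm_upath_bc upath_bc_simps)
  have "Cauchy (\<lambda>n. upath_bc (X n))"
    using \<open>Cauchy X\<close> by (simp add: Cauchy_def d)
  then obtain f where f: "(\<lambda>n. upath_bc (X n)) \<longlonglongrightarrow> f"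
    by (auto simp: Cauchy_convergent_iff convergent_def)
  have f0: "(apply_bcontfun f \<longlongrightarrow> 0) at_infinity"
  proof (rule tendstoI)
    fix e :: real assume "0 < e"
    then obtain n where n: "dist (upath_bc (X n)) f < e / 2"
      using f unfolding lim_sequentially by (metis half_gt_zero order_refl)
    have "((\<lambda>t. upath_bc (X n) t) \<longlongrightarrow> 0) at_infinity"
      using upath_apply[of "X n"] by (simp add: upath_bc_apply lim_logw_iff)
    hence "\<forall>\<^sub>F t in at_infinity. dist (upath_bc (X n) t) 0 < e / 2"
      using \<open>0 < e\<close> by (intro tendstoD) auto
    thus "\<forall>\<^sub>F t in at_infinity. dist (f t) 0 < e"
    proof eventually_elim
      case (elim t)
      have "dist (f t) (upath_bc (X n) t) < e / 2"
        using dist_bounded[of f t "upath_bc (X n)"] n by (simp add: dist_commute)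
      thus ?case using elim dist_triangle[of "f t" 0 "upath_bc (X n) t"] by linarith
    qed
  qed
  define g where "g = (\<lambda>t. f t * logw t)"
  have gq: "g t / logw t = f t" for t using logw_pos[of t] by (simp add: g_def)
  have "continuous_on UNIV g" unfolding g_def
    by (intro continuous_on_mult continuous_on_logw) auto
  moreover have "((\<lambda>t. \<bar>g t\<bar> / ln \<bar>t\<bar>) \<longlongrightarrow> 0) at_infinity"
    unfolding lim_logw_iff gq by (rule f0)
  ultimately have "upath_apply (Upath g) = g" by (simp add: Upath_inverse)
  hence "upath_bc (Upath g) = f"
    by (intro bcontfun_eqI) (simp add: upath_bc_apply gq)
  hence "X \<longlonglongrightarrow> Upath g"
    using f by (simp add: lim_sequentially d)
  thus "convergent X" by (auto simp: convergent_def)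
qed


definition absolutely_continuous_interval :: "(real \<Rightarrow> real) \<Rightarrow> real \<Rightarrow> real \<Rightarrow> bool" where
  "absolutely_continuous_interval h a b \<longleftrightarrow>
    (\<forall>\<epsilon>>0. \<exists>\<delta>>0. \<forall>(n::nat) (x :: nat \<Rightarrow> real) y.
       (\<forall>i<n. a \<le> x i \<and> x i \<le> y i \<and> y i \<le> b) \<longrightarrow>
       (\<forall>i<n. \<forall>j<n. i \<noteq> j \<longrightarrow> {x i<..<y i} \<inter> {x j<..<y j} = {}) \<longrightarrow>
       (\<Sum>i<n. y i - x i) < \<delta> \<longrightarrow> (\<Sum>i<n. \<bar>h (y i) - h (x i)\<bar>) < \<epsilon>)"

text \<open>
  \<open>H\<^sup>U\<close> is realised as a subset of \<open>U\<close>, as an abstract Wiener space prescribes.  Nothing is lost: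
  if \<open>h\<close> is absolutely continuous with \<open>h\<close> and \<open>h'\<close> square integrable, then \<open>h\<close> vanishes at
  infinity.  Almost everywhere differentiability is automatic for absolutely continuous functions;
  it is listed so that \<open>deriv h\<close> is visibly the derivative almost everywhere.
\<close>

definition HU :: "upath set" where
  "HU = {h. (\<forall>a b. absolutely_continuous_interval (upath_apply h) a b) \<and>
            (AE t in lebesgue. upath_apply h differentiable (at t)) \<and>
            integrable lebesgue (\<lambda>t. 1/4 * (upath_apply h t)\<^sup>2 + (deriv (upath_apply h) t)\<^sup>2)}"

definition HU_inner :: "upath \<Rightarrow> upath \<Rightarrow> real" where
  "HU_inner h k = (LINT t|lebesgue. 1/4 * upath_apply h t * upath_apply k t
                     + deriv (upath_apply h) t * deriv (upath_apply k) t)"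


text \<open>
  Here \<open>H\<close> is a Hilbert space embedded in the Banach space \<open>'e\<close>, with inner product \<open>ip\<close>.
  Elements of \<open>L\<^sup>2(W)\<close> are represented by functions, determined up to \<open>W\<close>-null sets; the vector
  \<open>k\<close> in the last clause of \<open>paley_wiener_map\<close> is the representer \<open>h\<^bsub>x\<^esub>\<close> of the functional \<open>x\<close>.
\<close>

definition paley_wiener_map ::
  "'e::real_normed_vector set \<Rightarrow> ('e \<Rightarrow> 'e \<Rightarrow> real) \<Rightarrow> 'e measure \<Rightarrow> ('e \<Rightarrow> 'e \<Rightarrow> real) \<Rightarrow> bool" where
  "paley_wiener_map H ip W I \<longleftrightarrow>
    (\<forall>h\<in>H. I h \<in> borel_measurable W \<and> integrable W (\<lambda>\<omega>. (I h \<omega>)\<^sup>2)) \<and>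
    (\<forall>h\<in>H. \<forall>k\<in>H. \<forall>a b. AE \<omega> in W. I (a *\<^sub>R h + b *\<^sub>R k) \<omega> = a * I h \<omega> + b * I k \<omega>) \<and>
    (\<forall>h\<in>H. (LINT \<omega>|W. (I h \<omega>)\<^sup>2) = ip h h) \<and>
    (\<forall>x. bounded_linear x \<longrightarrow>
       (\<forall>k\<in>H. (\<forall>h\<in>H. ip h k = x h) \<longrightarrow> (AE \<omega> in W. I k \<omega> = x \<omega>)))"

definition orthogonal_transformation_on ::
  "'e::real_vector set \<Rightarrow> ('e \<Rightarrow> 'e \<Rightarrow> real) \<Rightarrow> ('e \<Rightarrow> 'e) \<Rightarrow> bool" where
  "orthogonal_transformation_on H ip Q \<longleftrightarrow>
    Q ` H = H \<and>
    (\<forall>h\<in>H. \<forall>k\<in>H. \<forall>a b. Q (a *\<^sub>R h + b *\<^sub>R k) = a *\<^sub>R Q h + b *\<^sub>R Q k) \<and>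
    (\<forall>h\<in>H. \<forall>k\<in>H. ip (Q h) (Q k) = ip h k)"

definition transpose_on ::
  "'e set \<Rightarrow> ('e \<Rightarrow> 'e \<Rightarrow> real) \<Rightarrow> ('e \<Rightarrow> 'e) \<Rightarrow> 'e \<Rightarrow> 'e" where
  "transpose_on H ip Q h = (THE k. k \<in> H \<and> (\<forall>x\<in>H. ip (Q x) h = ip x k))"

text \<open>
  \<open>wiener_transformation H ip W I Q T\<close> says that \<open>T\<close> is a version of \<open>T\<^bsub>Q\<^esub>\<close>.  As \<open>I h\<close> is only a
  class of almost surely equal functions, its composition with \<open>T\<close> is meaningful only if it does
  not depend on the representative; hence the quantification over all representatives \<open>X\<close>.
\<close>

definition wiener_transformation ::
  "'e::real_normed_vector set \<Rightarrow> ('e \<Rightarrow> 'e \<Rightarrow> real) \<Rightarrow> 'e measure \<Rightarrow> ('e \<Rightarrow> 'e \<Rightarrow> real) \<Rightarrow>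
   ('e \<Rightarrow> 'e) \<Rightarrow> ('e \<Rightarrow> 'e) \<Rightarrow> bool" where
  "wiener_transformation H ip W I Q T \<longleftrightarrow>
    T \<in> measurable W borel \<and>
    (\<forall>h\<in>H. \<forall>X\<in>borel_measurable W. (AE \<omega> in W. X \<omega> = I h \<omega>) \<longrightarrow>
       (AE \<omega> in W. X (T \<omega>) = I (transpose_on H ip Q h) \<omega>))"


definition standard_brownian_motion :: "'w measure \<Rightarrow> (real \<Rightarrow> 'w \<Rightarrow> real) \<Rightarrow> bool" where
  "standard_brownian_motion P B \<longleftrightarrow>
    prob_space P \<and>
    (\<forall>t\<ge>0. B t \<in> borel_measurable P) \<and>
    (AE \<omega> in P. B 0 \<omega> = 0) \<and>
    (\<forall>s t. 0 \<le> s \<longrightarrow> s < t \<longrightarrow>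
       distributed P lborel (\<lambda>\<omega>. B t \<omega> - B s \<omega>) (normal_density 0 (sqrt (t - s)))) \<and>
    (\<forall>(n::nat) \<tau>. 0 \<le> \<tau> 0 \<longrightarrow> (\<forall>i<n. \<tau> i < \<tau> (Suc i)) \<longrightarrow>
       prob_space.indep_vars P (\<lambda>_. borel) (\<lambda>i \<omega>. B (\<tau> (Suc i)) \<omega> - B (\<tau> i) \<omega>) {..<n}) \<and>
    (AE \<omega> in P. continuous_on {0..} (\<lambda>t. B t \<omega>))"

definition path_law :: "'w measure \<Rightarrow> (real \<Rightarrow> 'w \<Rightarrow> real) \<Rightarrow> upath measure \<Rightarrow> bool" where
  "path_law P X W \<longleftrightarrow>
    (\<exists>Y\<in>measurable P borel. (AE \<omega> in P. \<forall>t. upath_apply (Y \<omega>) t = X t \<omega>) \<and> W = distr P borel Y)"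

definition gaussian_rv :: "'w measure \<Rightarrow> ('w \<Rightarrow> real) \<Rightarrow> bool" where
  "gaussian_rv M X \<longleftrightarrow> X \<in> borel_measurable M \<and>
    (\<exists>\<mu>. (AE \<omega> in M. X \<omega> = \<mu>) \<or> (\<exists>\<sigma>>0. distributed M lborel X (normal_density \<mu> \<sigma>)))"

definition gaussian_family :: "'w measure \<Rightarrow> ('i \<Rightarrow> 'w \<Rightarrow> real) \<Rightarrow> bool" where
  "gaussian_family M X \<longleftrightarrow>
    (\<forall>F c. finite F \<longrightarrow> gaussian_rv M (\<lambda>\<omega>. \<Sum>i\<in>F. c i * X i \<omega>))"


definition fourier :: "(real \<Rightarrow> complex) \<Rightarrow> real \<Rightarrow> complex" where
  "fourier f l = (LINT x|lborel. exp (- \<i> * complex_of_real (l * x)) * f x)"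

definition square_integrable :: "(real \<Rightarrow> complex) \<Rightarrow> bool" where
  "square_integrable f \<longleftrightarrow>
    f \<in> borel_measurable lborel \<and> integrable lborel (\<lambda>x. (cmod (f x))\<^sup>2)"

text \<open>
  \<open>l2_fourier f g\<close>: the function \<open>g\<close> is a version of the Fourier transform of \<open>f\<close>, where \<open>fourier\<close>
  is extended by continuity from integrable, square integrable functions.
\<close>

definition l2_fourier :: "(real \<Rightarrow> complex) \<Rightarrow> (real \<Rightarrow> complex) \<Rightarrow> bool" where
  "l2_fourier f g \<longleftrightarrow> square_integrable f \<and> square_integrable g \<and>
    (\<exists>\<phi> :: nat \<Rightarrow> real \<Rightarrow> complex.
       (\<forall>n. integrable lborel (\<phi> n) \<and> square_integrable (\<phi> n)) \<and>
       (\<lambda>n. \<integral>\<^sup>+ x. ennreal ((cmod (\<phi> n x - f x))\<^sup>2) \<partial>lborel) \<longlonglongrightarrow> 0 \<and>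
       (\<lambda>n. \<integral>\<^sup>+ l. ennreal ((cmod (fourier (\<phi> n) l - g l))\<^sup>2) \<partial>lborel) \<longlonglongrightarrow> 0)"

end

theory Submission
  imports Defs "HOL-Real_Asymp.Real_Asymp"
begin

text \<open>
  Put \<open>h\<^sub>t(s) = exp (- |s - t| / 2)\<close>.  Integration by parts, valid for absolutely continuous functions,
  shows that \<open>h\<^sub>t\<close> represents evaluation at \<open>t\<close> in \<open>H\<^sup>U\<close> (\<open>HU_inner_ou_kernel\<close>), so the value at \<open>t\<close> of the
  Wiener path is the Paley--Wiener image of \<open>h\<^sub>t\<close>.  By the defining property of \<open>S u\<close>, its value at \<open>t\<close> is
  almost surely the Paley--Wiener image of the vector \<open>k\<close> with \<open>Q u k = h\<^sub>t\<close>.  The family is thus the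
  image under an isometry of an explicit family of vectors.

  Covariances are therefore inner products of these vectors.  If \<open>Q u k = h\<^sub>s\<close> and \<open>Q v k' = h\<^sub>t\<close>, then the
  inner product of \<open>k\<close> and \<open>k'\<close> is that of \<open>Q v k\<close> and \<open>h\<^sub>t\<close>, which is the value of \<open>Q v k\<close> at \<open>t\<close>.  The Fourier
  transform of \<open>h\<^sub>s\<close> being \<open>4 exp (- \<i> l s) / (1 + 4 l\<^sup>2)\<close>, that of \<open>Q v k\<close> differs from it by the phase
  \<open>exp (2 \<i> (u - v) arctan (2 l))\<close>, and Fourier inversion yields the formula (\<open>phase_shift_ou_kernel\<close>).

  In other words, the closed span of the family is isometric to a space of functions that are square
  integrable for the Cauchy type measure \<open>2 / (pi (1 + 4 l\<^sup>2)) dl\<close>, where \<open>(u, t)\<close> corresponds to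
  \<open>exp (\<i> (2 u arctan (2 l) - l t))\<close>.  This is a bounded continuous function of \<open>l\<close>, hence a limit of
  trigonometric polynomials (\<open>trig_polynomials_dense\<close>), and these correspond to combinations of values
  of the Ornstein--Uhlenbeck path, which are Gaussian because Brownian increments are independent and
  Gaussian.  So all linear combinations of the family are \<open>L\<^sup>2\<close> limits of centred Gaussian variables and
  thereby Gaussian (\<open>\<xi>_combination_gauss\<close>).

  The law of a family is determined by the characteristic functions of its linear combinations
  (\<open>joint_cf_determines_law\<close>), here by the covariances.  Since these depend on differences of the
  indices only, the law is stationary; and as the Borel sets of the path space are generated by the
  evaluations (\<open>borel_upath_eval\<close>), each \<open>S u\<close> preserves the Wiener measure.  Finally, the variance of an
  increment is bounded by a multiple of the distance of the indices, so its sixth moment is bounded by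
  a multiple of the third power, and Kolmogorov's criterion in the plane gives the continuous
  modification (\<open>kolmogorov_continuous_modification\<close>).
\<close>

section \<open>The fundamental theorem of calculus for absolutely continuous functions\<close>

text \<open>
  The definition speaks of intervals numbered by an initial segment of the natural numbers; a tagged
  division is indexed by its own elements.
\<close>

lemma ac_interval_finite_family:
  assumes "absolutely_continuous_interval h a b" "0 < e"
  shows "\<exists>d>0. \<forall>(P :: 'i set) x y. finite P \<longrightarrow> (\<forall>i\<in>P. a \<le> x i \<and> x i \<le> y i \<and> y i \<le> b) \<longrightarrow>
       (\<forall>i\<in>P. \<forall>j\<in>P. i \<noteq> j \<longrightarrow> {x i<..<y i} \<inter> {x j<..<y j} = {}) \<longrightarrow>
       (\<Sum>i\<in>P. y i - x i) < d \<longrightarrow> (\<Sum>i\<in>P. \<bar>h (y i) - h (x i)\<bar>) < e"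
proof -
  obtain d where "0 < d" and d: "\<And>(n::nat) (x :: nat \<Rightarrow> real) y.
       (\<forall>i<n. a \<le> x i \<and> x i \<le> y i \<and> y i \<le> b) \<Longrightarrow>
       (\<forall>i<n. \<forall>j<n. i \<noteq> j \<longrightarrow> {x i<..<y i} \<inter> {x j<..<y j} = {}) \<Longrightarrow>
       (\<Sum>i<n. y i - x i) < d \<Longrightarrow> (\<Sum>i<n. \<bar>h (y i) - h (x i)\<bar>) < e"
    using assms unfolding absolutely_continuous_interval_def by blast
  show ?thesis
  proof (intro exI[of _ d] conjI allI impI \<open>0 < d\<close>)
    fix P :: "'i set" and x y
    assume P: "finite P" "\<forall>i\<in>P. a \<le> x i \<and> x i \<le> y i \<and> y i \<le> b"
       "\<forall>i\<in>P. \<forall>j\<in>P. i \<noteq> j \<longrightarrow> {x i<..<y i} \<inter> {x j<..<y j} = {}"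
       "(\<Sum>i\<in>P. y i - x i) < d"
    obtain f where f: "bij_betw f {..<card P} P"
      using ex_bij_betw_nat_finite[OF P(1)] by (auto simp: atLeast0LessThan)
    have s: "(\<Sum>i<card P. g (f i)) = (\<Sum>i\<in>P. g i)" for g :: "'i \<Rightarrow> real"
      using sum.reindex_bij_betw[OF f] .
    have fP: "f i \<in> P" if "i < card P" for i using f that by (auto simp: bij_betw_def)
    have "(\<Sum>i<card P. \<bar>h (y (f i)) - h (x (f i))\<bar>) < e"
    proof (rule d)
      show "\<forall>i<card P. a \<le> x (f i) \<and> x (f i) \<le> y (f i) \<and> y (f i) \<le> b" using P(2) fP by blast
      show "\<forall>i<card P. \<forall>j<card P. i \<noteq> j \<longrightarrow> {x (f i)<..<y (f i)} \<inter> {x (f j)<..<y (f j)} = {}"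
      proof (intro allI impI)
        fix i j assume "i < card P" "j < card P" "i \<noteq> j"
        moreover from this have "f i \<noteq> f j"
          using bij_betw_imp_inj_on[OF f] by (auto dest: inj_onD)
        ultimately show "{x (f i)<..<y (f i)} \<inter> {x (f j)<..<y (f j)} = {}" using P(3) fP by blast
      qed
      show "(\<Sum>i<card P. y (f i) - x (f i)) < d" using P(4) s[of "\<lambda>i. y i - x i"] by simp
    qed
    thus "(\<Sum>i\<in>P. \<bar>h (y i) - h (x i)\<bar>) < e" using s[of "\<lambda>i. \<bar>h (y i) - h (x i)\<bar>"] by simp
  qed
qed

text \<open>
  The Kurzweil--Henstock integral makes this elementary: at a point where \<open>h\<close> is differentiable the
  gauge is the one of the straddle lemma, and around the points of the exceptional set it is an
  open set of small measure, on which the increments of \<open>h\<close> are small by absolute continuity.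
\<close>

lemma absolutely_continuous_FTC:
  fixes h :: "real \<Rightarrow> real"
  assumes ac: "absolutely_continuous_interval h a b" and ab: "a \<le> b" and N: "negligible N"
    and der: "\<And>x. x \<in> {a..b} - N \<Longrightarrow> (h has_real_derivative f x) (at x)"
  shows "(f has_integral (h b - h a)) {a..b}"
proof -
  define g where "g = (\<lambda>x. if x \<in> N then 0 else f x)"
  have "(g has_integral (h b - h a)) (cbox a b)"
    unfolding has_integral
  proof (intro allI impI)
    fix e :: real assume "0 < e"
    \<comment> \<open>the \<open>+ 1\<close> keeps the constant meaningful when \<open>a = b\<close>\<close>
    define c where "c = e / (2 * (b - a + 1))"
    have c: "0 < c" "c * (b - a) < e / 2" 
      using \<open>0 < e\<close> ab unfolding c_def by (auto simp: field_simps)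
    obtain d where "0 < d" and d: "\<forall>(P :: (real \<times> real set) set) x y. finite P \<longrightarrow>
       (\<forall>i\<in>P. a \<le> x i \<and> x i \<le> y i \<and> y i \<le> b) \<longrightarrow>
       (\<forall>i\<in>P. \<forall>j\<in>P. i \<noteq> j \<longrightarrow> {x i<..<y i} \<inter> {x j<..<y j} = {}) \<longrightarrow>
       (\<Sum>i\<in>P. y i - x i) < d \<longrightarrow> (\<Sum>i\<in>P. \<bar>h (y i) - h (x i)\<bar>) < e / 2"
      using ac_interval_finite_family[OF ac half_gt_zero[OF \<open>0 < e\<close>]] by blast
    obtain T where T: "open T" "N \<subseteq> T" "T \<in> lmeasurable" "measure lebesgue T < d"
    proof -
      have Nl: "N \<in> null_sets lebesgue" using N by (simp add: negligible_iff_null_sets)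
      hence "N \<in> sets lebesgue" by auto
      then obtain T where T: "open T" "N \<subseteq> T" "T - N \<in> lmeasurable" "emeasure lebesgue (T - N) < ennreal d"
        using sets_lebesgue_outer_open \<open>0 < d\<close> by blast
      have "emeasure lebesgue T = emeasure lebesgue (T - N)"
        using emeasure_Diff_null_set[OF Nl, of T] T(1) by auto
      with T have "emeasure lebesgue T < ennreal d" by simp
      moreover from this have "T \<in> lmeasurable" using T(1) 
        by (intro fmeasurableI) (auto simp: less_top[symmetric] dest: order_less_le_trans)
      ultimately show thesis using T that
        by (metis \<open>0 < d\<close> emeasure_eq_measure2 ennreal_less_iff measure_nonneg)
    qed
    have "\<exists>r>0. \<forall>y. \<bar>y - x\<bar> < r \<longrightarrow> \<bar>h y - h x - f x * (y - x)\<bar> \<le> c * \<bar>y - x\<bar>"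
      if "x \<in> {a..b} - N" for x
    proof -
      have "(h has_derivative (*) (f x)) (at x)"
        using der[OF that] by (simp add: has_field_derivative_def)
      thus ?thesis using c(1) unfolding has_derivative_at_alt by auto
    qed
    then obtain r where r: "\<And>x. x \<in> {a..b} - N \<Longrightarrow> 0 < r x"
      "\<And>x y. x \<in> {a..b} - N \<Longrightarrow> \<bar>y - x\<bar> < r x \<Longrightarrow> \<bar>h y - h x - f x * (y - x)\<bar> \<le> c * \<bar>y - x\<bar>"
      by metis
    define G where "G = (\<lambda>x. if x \<in> N then T else if x \<in> {a..b} then ball x (r x) else UNIV)"
    have gG: "gauge G" unfolding gauge_def G_def using T r by auto
    show "\<exists>\<gamma>. gauge \<gamma> \<and> (\<forall>p. p tagged_division_of cbox a b \<and> \<gamma> fine p \<longrightarrow>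
            norm ((\<Sum>(x, k)\<in>p. measure lborel k *\<^sub>R g x) - (h b - h a)) < e)"
    proof (intro exI[of _ G] conjI gG allI impI)
      fix p assume p: "p tagged_division_of cbox a b \<and> G fine p"
      hence pd: "p tagged_division_of cbox a b" and fin: "finite p" by auto
      have box: "\<exists>u v. K = {u..v} \<and> a \<le> u \<and> u \<le> x \<and> x \<le> v \<and> v \<le> b" if xK: "(x, K) \<in> p" for x K
      proof -
        obtain u v where "K = cbox u v" using tagged_division_ofD(4)[OF pd xK] by blast
        moreover have "x \<in> K" "K \<subseteq> cbox a b"
          using tagged_division_ofD(2,3)[OF pd xK] by auto
        ultimately show ?thesis by fastforce
      qed
      have K: "K = {Inf K..Sup K} \<and> a \<le> Inf K \<and> Inf K \<le> x \<and> x \<le> Sup K \<and> Sup K \<le> b \<and>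
          measure lborel K = Sup K - Inf K" if "(x, K) \<in> p" for x K
        using box[OF that] by auto
      define p1 where "p1 = {i \<in> p. fst i \<in> N}"
      define p2 where "p2 = {i \<in> p. fst i \<notin> N}"
      have p12: "p = p1 \<union> p2" "p1 \<inter> p2 = {}" "finite p1" "finite p2"
        using fin by (auto simp: p1_def p2_def)
      have disj: "{Inf (snd i)<..<Sup (snd i)} \<inter> {Inf (snd j)<..<Sup (snd j)} = {}"
        if "i \<in> p" "j \<in> p" "i \<noteq> j" for i j
      proof -
        obtain x K y L where ij: "i = (x, K)" "j = (y, L)" by fastforce
        have "interior K \<inter> interior L = {}"
          using tagged_division_ofD(5)[OF pd, of x K y L] that unfolding ij by blast
        moreover have "interior K = {Inf K<..<Sup K}" "interior L = {Inf L<..<Sup L}"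
          using K[of x K] K[of y L] that unfolding ij by (metis interior_atLeastAtMost_real)+
        ultimately show ?thesis unfolding ij by simp
      qed
      have S1: "(\<Sum>i\<in>p1. \<bar>h (Sup (snd i)) - h (Inf (snd i))\<bar>) < e / 2"
      proof (rule d[rule_format, OF p12(3)])
        fix i assume "i \<in> p1"
        thus "a \<le> Inf (snd i) \<and> Inf (snd i) \<le> Sup (snd i) \<and> Sup (snd i) \<le> b"
          using K[of "fst i" "snd i"] by (auto simp: p1_def)
      next
        fix i j assume "i \<in> p1" "j \<in> p1" "i \<noteq> j"
        thus "{Inf (snd i)<..<Sup (snd i)} \<inter> {Inf (snd j)<..<Sup (snd j)} = {}"
          using disj by (auto simp: p1_def)
      next
        have eq: "(\<Sum>i\<in>p1. Sup (snd i) - Inf (snd i)) =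
              (\<Sum>i\<in>p1. measure lebesgue {Inf (snd i)<..<Sup (snd i)})"
          using K by (intro sum.cong refl) (fastforce simp: p1_def)
        have fm: "emeasure lebesgue {u<..<v :: real} \<noteq> \<infinity>" for u v
          by (cases "u \<le> v") auto
        have "(\<Sum>i\<in>p1. measure lebesgue {Inf (snd i)<..<Sup (snd i)}) = measure lebesgue (\<Union>i\<in>p1. {Inf (snd i)<..<Sup (snd i)})"
          using p12(3) disj fm
          by (intro measure_finite_Union[symmetric])
             (auto simp: disjoint_family_on_def p1_def simp del: emeasure_lborel_Ioo)
        also have "\<dots> \<le> measure lebesgue T"
        proof (rule measure_mono_fmeasurable)
          show "(\<Union>i\<in>p1. {Inf (snd i)<..<Sup (snd i)}) \<subseteq> T"
          proof
            fix z assume "z \<in> (\<Union>i\<in>p1. {Inf (snd i)<..<Sup (snd i)})"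
            then obtain x L where L: "(x, L) \<in> p" "x \<in> N" "z \<in> {Inf L<..<Sup L}" 
              by (auto simp: p1_def)
            hence "z \<in> L" using K[OF L(1)] by (metis atLeastAtMost_iff greaterThanLessThan_iff less_imp_le)
            moreover have "L \<subseteq> G x" using p L(1) by (auto simp: fine_def)
            ultimately show "z \<in> T" using L(2) by (auto simp: G_def)
          qed
        qed (use T p12(3) in \<open>auto intro!: sets.finite_UN\<close>)
        finally show "(\<Sum>i\<in>p1. Sup (snd i) - Inf (snd i)) < d" using T(4) eq by linarith
      qed
      have S2: "(\<Sum>i\<in>p2. \<bar>measure lborel (snd i) * g (fst i) - (h (Sup (snd i)) - h (Inf (snd i)))\<bar>)
          \<le> (\<Sum>i\<in>p2. c * measure lborel (snd i))"
      proof (rule sum_mono)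
        fix i assume "i \<in> p2"
        then obtain x L where i: "i = (x, L)" "(x, L) \<in> p" "x \<notin> N" by (cases i) (auto simp: p2_def)
        note KL = K[OF i(2)]
        have x: "x \<in> {a..b} - N" using KL i(3) by auto
        have "L \<subseteq> G x" using p i(2) by (auto simp: fine_def)
        hence LB: "L \<subseteq> ball x (r x)" using x by (auto simp: G_def)
        have "Sup L \<in> L" "Inf L \<in> L" using KL by (metis atLeastAtMost_iff order_refl order_trans)+
        hence "\<bar>Sup L - x\<bar> < r x" "\<bar>Inf L - x\<bar> < r x" using LB by (auto simp: dist_real_def)
        from r(2)[OF x this(1)] r(2)[OF x this(2)]
        have "\<bar>(h (Inf L) - h x - f x * (Inf L - x)) - (h (Sup L) - h x - f x * (Sup L - x))\<bar>
           \<le> c * \<bar>Sup L - x\<bar> + c * \<bar>Inf L - x\<bar>" by linarith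
        also have "\<dots> = c * (Sup L - Inf L)" using KL by (simp add: algebra_simps)
        also have "(h (Inf L) - h x - f x * (Inf L - x)) - (h (Sup L) - h x - f x * (Sup L - x))
          = measure lborel L * g x - (h (Sup L) - h (Inf L))"
        proof -
          have "measure lborel L = Sup L - Inf L" using KL by blast
          thus ?thesis using i(3) by (simp only: g_def if_False) (simp add: algebra_simps)
        qed
        finally show "\<bar>measure lborel (snd i) * g (fst i) - (h (Sup (snd i)) - h (Inf (snd i)))\<bar>
            \<le> c * measure lborel (snd i)" using KL by (simp add: i)
      qed
      have "(\<Sum>i\<in>p2. measure lborel (snd i)) \<le> (\<Sum>i\<in>p. measure lborel (snd i))"
        using fin p12 by (intro sum_mono2) auto
      also have "\<dots> = b - a"
        using additive_content_tagged_division[of p a b] p ab by (simp add: case_prod_unfold)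
      finally have S3: "(\<Sum>i\<in>p2. c * measure lborel (snd i)) \<le> c * (b - a)"
        using c(1) by (simp add: sum_distrib_left[symmetric])
      have "(\<Sum>(x, k)\<in>p. measure lborel k *\<^sub>R g x) - (h b - h a) =
          (\<Sum>i\<in>p. measure lborel (snd i) * g (fst i) - (h (Sup (snd i)) - h (Inf (snd i))))"
        using additive_tagged_division_1[OF ab, of p h] p
        by (simp add: case_prod_unfold sum_subtractf)
      also have "\<bar>\<dots>\<bar> \<le> (\<Sum>i\<in>p. \<bar>measure lborel (snd i) * g (fst i) - (h (Sup (snd i)) - h (Inf (snd i)))\<bar>)"
        by (rule sum_abs)
      also have "\<dots> = (\<Sum>i\<in>p1. \<bar>measure lborel (snd i) * g (fst i) - (h (Sup (snd i)) - h (Inf (snd i)))\<bar>) +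
         (\<Sum>i\<in>p2. \<bar>measure lborel (snd i) * g (fst i) - (h (Sup (snd i)) - h (Inf (snd i)))\<bar>)"
        using p12 by (simp add: sum.union_disjoint)
      also have "(\<Sum>i\<in>p1. \<bar>measure lborel (snd i) * g (fst i) - (h (Sup (snd i)) - h (Inf (snd i)))\<bar>)
         = (\<Sum>i\<in>p1. \<bar>h (Sup (snd i)) - h (Inf (snd i))\<bar>)"
        by (intro sum.cong refl) (auto simp: p1_def g_def)
      finally show "norm ((\<Sum>(x, k)\<in>p. measure lborel k *\<^sub>R g x) - (h b - h a)) < e"
        using S1 S2 S3 c(2) by simp
    qed
  qed
  hence "(g has_integral (h b - h a)) {a..b}" by simp
  thus ?thesis
    using has_integral_spike_eq[OF N, of "{a..b}" f g] by (auto simp: g_def)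
qed

lemma continuous_bounded_on_interval:
  assumes "continuous_on UNIV (h::real \<Rightarrow> real)"
  obtains M where "0 < M" "\<And>x. x \<in> {a..b} \<Longrightarrow> \<bar>h x\<bar> \<le> M"
proof -
  have "bounded (h ` {a..b})"
    by (intro compact_imp_bounded compact_continuous_image continuous_on_subset[OF assms]) auto
  then obtain M where "0 < M" "\<And>x. x \<in> {a..b} \<Longrightarrow> norm (h x) \<le> M"
    unfolding bounded_pos by auto
  thus thesis using that by auto
qed

text \<open>
  Linear combinations and products with Lipschitz functions inherit absolute continuity because their
  increments are controlled by those of the ingredients.
\<close>

lemma ac_interval_dominated:
  fixes f h k :: "real \<Rightarrow> real"
  assumes h: "absolutely_continuous_interval h a b" and k: "absolutely_continuous_interval k a b"
    and le: "\<And>x y. \<lbrakk>a \<le> x; x \<le> y; y \<le> b\<rbrakk> \<Longrightarrow> \<bar>f y - f x\<bar> \<le> C * (\<bar>h y - h x\<bar> + \<bar>k y - k x\<bar>)"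
  shows "absolutely_continuous_interval f a b"
  unfolding absolutely_continuous_interval_def
proof (intro allI impI)
  fix e :: real assume "0 < e"
  define K where "K = \<bar>C\<bar> + 1"
  have K: "0 < K" "C \<le> K" by (auto simp: K_def)
  hence e: "0 < e / (2 * K)" using \<open>0 < e\<close> by simp
  obtain u where "0 < u"
    and u: "\<And>(n::nat) (x :: nat \<Rightarrow> real) y. (\<forall>i<n. a \<le> x i \<and> x i \<le> y i \<and> y i \<le> b) \<Longrightarrow>
       (\<forall>i<n. \<forall>j<n. i \<noteq> j \<longrightarrow> {x i<..<y i} \<inter> {x j<..<y j} = {}) \<Longrightarrow>
       (\<Sum>i<n. y i - x i) < u \<Longrightarrow> (\<Sum>i<n. \<bar>h (y i) - h (x i)\<bar>) < e / (2 * K)"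
    using h e unfolding absolutely_continuous_interval_def by blast
  obtain v where "0 < v"
    and v: "\<And>(n::nat) (x :: nat \<Rightarrow> real) y. (\<forall>i<n. a \<le> x i \<and> x i \<le> y i \<and> y i \<le> b) \<Longrightarrow>
       (\<forall>i<n. \<forall>j<n. i \<noteq> j \<longrightarrow> {x i<..<y i} \<inter> {x j<..<y j} = {}) \<Longrightarrow>
       (\<Sum>i<n. y i - x i) < v \<Longrightarrow> (\<Sum>i<n. \<bar>k (y i) - k (x i)\<bar>) < e / (2 * K)"
    using k e unfolding absolutely_continuous_interval_def by blast
  show "\<exists>\<delta>>0. \<forall>(n::nat) (x :: nat \<Rightarrow> real) y.
       (\<forall>i<n. a \<le> x i \<and> x i \<le> y i \<and> y i \<le> b) \<longrightarrow>
       (\<forall>i<n. \<forall>j<n. i \<noteq> j \<longrightarrow> {x i<..<y i} \<inter> {x j<..<y j} = {}) \<longrightarrow>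
       (\<Sum>i<n. y i - x i) < \<delta> \<longrightarrow> (\<Sum>i<n. \<bar>f (y i) - f (x i)\<bar>) < e"
  proof (intro exI[of _ "min u v"] conjI allI impI)
    show "0 < min u v" using \<open>0 < u\<close> \<open>0 < v\<close> by simp
    fix n :: nat and x y :: "nat \<Rightarrow> real"
    assume A: "\<forall>i<n. a \<le> x i \<and> x i \<le> y i \<and> y i \<le> b"
      "\<forall>i<n. \<forall>j<n. i \<noteq> j \<longrightarrow> {x i<..<y i} \<inter> {x j<..<y j} = {}"
      "(\<Sum>i<n. y i - x i) < min u v"
    define s where "s = (\<Sum>i<n. \<bar>h (y i) - h (x i)\<bar>) + (\<Sum>i<n. \<bar>k (y i) - k (x i)\<bar>)"
    have "(\<Sum>i<n. \<bar>f (y i) - f (x i)\<bar>) \<le> (\<Sum>i<n. C * (\<bar>h (y i) - h (x i)\<bar> + \<bar>k (y i) - k (x i)\<bar>))"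
      using A(1) by (intro sum_mono le) auto
    also have "\<dots> = C * s" by (simp only: s_def sum.distrib sum_distrib_left[symmetric])
    also have "\<dots> \<le> K * s"
      using K by (intro mult_right_mono) (auto simp: s_def intro!: add_nonneg_nonneg sum_nonneg)
    also have "\<dots> < K * (e / (2 * K) + e / (2 * K))"
      unfolding s_def using u[OF A(1,2)] v[OF A(1,2)] A(3) K
      by (intro mult_strict_left_mono add_strict_mono) auto
    also have "\<dots> = e" using K by (simp add: field_simps)
    finally show "(\<Sum>i<n. \<bar>f (y i) - f (x i)\<bar>) < e" .
  qed
qed

lemma ac_interval_ident: "absolutely_continuous_interval (\<lambda>x. x) a b"
  unfolding absolutely_continuous_interval_def
proof (intro allI impI)
  fix e :: real assume "0 < e"
  show "\<exists>\<delta>>0. \<forall>(n::nat) (x :: nat \<Rightarrow> real) y.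
       (\<forall>i<n. a \<le> x i \<and> x i \<le> y i \<and> y i \<le> b) \<longrightarrow>
       (\<forall>i<n. \<forall>j<n. i \<noteq> j \<longrightarrow> {x i<..<y i} \<inter> {x j<..<y j} = {}) \<longrightarrow>
       (\<Sum>i<n. y i - x i) < \<delta> \<longrightarrow> (\<Sum>i<n. \<bar>y i - x i\<bar>) < e"
  proof (intro exI[of _ e] conjI allI impI \<open>0 < e\<close>)
    fix n :: nat and x y :: "nat \<Rightarrow> real"
    assume A: "\<forall>i<n. a \<le> x i \<and> x i \<le> y i \<and> y i \<le> b" "(\<Sum>i<n. y i - x i) < e"
    have "(\<Sum>i<n. \<bar>y i - x i\<bar>) = (\<Sum>i<n. y i - x i)" using A(1) by (intro sum.cong) auto
    thus "(\<Sum>i<n. \<bar>y i - x i\<bar>) < e" using A(2) by simp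
  qed
qed

lemma lipschitz_ac_interval:
  assumes "\<And>x y. \<bar>h y - h x\<bar> \<le> \<bar>y - x :: real\<bar>"
  shows "absolutely_continuous_interval h a b"
proof (rule ac_interval_dominated[OF ac_interval_ident ac_interval_ident, where C = 1])
  show "\<bar>h y - h x\<bar> \<le> 1 * (\<bar>y - x\<bar> + \<bar>y - x\<bar>)" for x y
    by (rule order_trans[OF assms]) simp
qed

lemma ac_interval_linear_combination:
  assumes "absolutely_continuous_interval h a b" "absolutely_continuous_interval k a b"
  shows "absolutely_continuous_interval (\<lambda>x. c * h x + d * k x) a b"
proof (rule ac_interval_dominated[OF assms, where C = "\<bar>c\<bar> + \<bar>d\<bar>"])
  fix x y
  have "c * h y + d * k y - (c * h x + d * k x) = c * (h y - h x) + d * (k y - k x)"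
    by (simp add: algebra_simps)
  also have "\<bar>\<dots>\<bar> \<le> \<bar>c\<bar> * \<bar>h y - h x\<bar> + \<bar>d\<bar> * \<bar>k y - k x\<bar>"
    by (metis abs_mult abs_triangle_ineq)
  also have "\<dots> \<le> (\<bar>c\<bar> + \<bar>d\<bar>) * \<bar>h y - h x\<bar> + (\<bar>c\<bar> + \<bar>d\<bar>) * \<bar>k y - k x\<bar>"
    by (intro add_mono mult_right_mono) auto
  finally show "\<bar>c * h y + d * k y - (c * h x + d * k x)\<bar> \<le> (\<bar>c\<bar> + \<bar>d\<bar>) * (\<bar>h y - h x\<bar> + \<bar>k y - k x\<bar>)"
    by (simp only: distrib_left)
qed

lemma ac_interval_mult_lipschitz:
  assumes h: "absolutely_continuous_interval h a b" "continuous_on UNIV h"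
    and w: "continuous_on UNIV w" "\<And>x y. x \<in> {a..b} \<Longrightarrow> y \<in> {a..b} \<Longrightarrow> \<bar>w y - w x\<bar> \<le> L * \<bar>y - x\<bar>"
  shows "absolutely_continuous_interval (\<lambda>x. h x * w x) a b"
proof -
  obtain M where M: "0 < M" "\<And>x. x \<in> {a..b} \<Longrightarrow> \<bar>h x\<bar> \<le> M"
    using continuous_bounded_on_interval[OF h(2)] by metis
  obtain N where N: "0 < N" "\<And>x. x \<in> {a..b} \<Longrightarrow> \<bar>w x\<bar> \<le> N"
    using continuous_bounded_on_interval[OF w(1)] by metis
  show ?thesis
  proof (rule ac_interval_dominated[OF h(1) ac_interval_ident, where C = "N + M * \<bar>L\<bar>"])
    fix x y assume xy: "a \<le> x" "x \<le> y" "y \<le> b"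
    have "h y * w y - h x * w x = (h y - h x) * w y + h x * (w y - w x)"
      by (simp add: algebra_simps)
    also have "\<bar>\<dots>\<bar> \<le> \<bar>h y - h x\<bar> * \<bar>w y\<bar> + \<bar>h x\<bar> * \<bar>w y - w x\<bar>"
      by (metis abs_mult abs_triangle_ineq)
    also have "\<dots> \<le> \<bar>h y - h x\<bar> * N + M * (\<bar>L\<bar> * \<bar>y - x\<bar>)"
    proof (intro add_mono mult_mono mult_left_mono)
      have "\<bar>w y - w x\<bar> \<le> L * \<bar>y - x\<bar>" using xy by (intro w(2)) auto
      also have "\<dots> \<le> \<bar>L\<bar> * \<bar>y - x\<bar>" by (intro mult_right_mono) auto
      finally show "\<bar>w y - w x\<bar> \<le> \<bar>L\<bar> * \<bar>y - x\<bar>" .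
    qed (use xy M N in auto)
    also have "\<dots> \<le> (N + M * \<bar>L\<bar>) * \<bar>h y - h x\<bar> + (N + M * \<bar>L\<bar>) * \<bar>y - x\<bar>"
    proof -
      have "N * \<bar>h y - h x\<bar> \<le> (N + M * \<bar>L\<bar>) * \<bar>h y - h x\<bar>"
        "M * \<bar>L\<bar> * \<bar>y - x\<bar> \<le> (N + M * \<bar>L\<bar>) * \<bar>y - x\<bar>"
        using M(1) N(1) by (intro mult_right_mono; simp)+
      thus ?thesis unfolding mult.commute[of _ N] mult.assoc by (rule add_mono)
    qed
    finally show "\<bar>h y * w y - h x * w x\<bar> \<le> (N + M * \<bar>L\<bar>) * (\<bar>h y - h x\<bar> + \<bar>y - x\<bar>)"
      by (simp only: distrib_left)
  qed
qed

section \<open>The Hilbert space and its reproducing kernel\<close>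

lemma integrable_exp_abs:
  assumes "0 < (a::real)"
  shows "integrable lborel (\<lambda>x. exp (- a * \<bar>x - t\<bar>))"
proof -
  have "(\<lambda>x. exp (- a * x)) absolutely_integrable_on {0..}"
    using integrable_on_exp_minus_to_infinity[OF assms, of 0]
    by (intro nonnegative_absolutely_integrable_1) auto
  hence "integrable lebesgue (\<lambda>x. indicator {0..} x *\<^sub>R exp (- a * x))"
    by (simp add: set_integrable_def)
  hence "integrable lborel (\<lambda>x. indicator {0..} x *\<^sub>R exp (- a * x))"
    by (subst integrable_completion[symmetric]) auto
  hence I: "integrable lborel (\<lambda>x. indicator {0..} x *\<^sub>R exp (- a * \<bar>x\<bar>))"
    by (rule Bochner_Integration.integrable_cong[THEN iffD1, rotated -1])
       (auto split: split_indicator)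
  have "has_bochner_integral lborel (\<lambda>x. exp (- a * \<bar>x\<bar>)) (2 *\<^sub>R (\<integral>x. indicator {0..} x *\<^sub>R exp (- a * \<bar>x\<bar>) \<partial>lborel))"
    using I by (intro has_bochner_integral_even_function)
       (simp add: has_bochner_integral_iff, simp)
  hence "integrable lborel (\<lambda>x. exp (- a * \<bar>x\<bar>))" by (simp add: has_bochner_integral_iff)
  from lborel_integrable_real_affine[OF this, of 1 "-t"]
  show ?thesis by (simp add: algebra_simps)
qed

text \<open>
  The reproducing kernel of \<open>H\<^sup>U\<close>: evaluation at \<open>t\<close> is the inner product with \<open>ou_kernel t\<close>.  It is
  also the covariance function of the Ornstein--Uhlenbeck process.
\<close>

definition ou_kernel :: "real \<Rightarrow> upath" where
  "ou_kernel t = Upath (\<lambda>s. exp (- \<bar>s - t\<bar> / 2))"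

lemma ou_kernel_apply: "upath_apply (ou_kernel t) s = exp (- \<bar>s - t\<bar> / 2)"
proof -
  have "filterlim (\<lambda>s::real. ln (norm s)) at_top at_infinity"
    by (rule filterlim_compose[OF ln_at_top filterlim_norm_at_top])
  hence l: "((\<lambda>s::real. inverse (ln (norm s))) \<longlongrightarrow> 0) at_infinity"
    by (rule tendsto_inverse_0_at_top)
  have "\<forall>\<^sub>F s::real in at_infinity. norm (\<bar>exp (- \<bar>s - t\<bar> / 2)\<bar> / ln \<bar>s\<bar>) \<le> inverse (ln (norm s))"
    unfolding eventually_at_infinity
  proof (intro exI[of _ 1] allI impI)
    fix s :: real assume "1 \<le> norm s"
    hence "0 \<le> ln \<bar>s\<bar>" by simp
    thus "norm (\<bar>exp (- \<bar>s - t\<bar> / 2)\<bar> / ln \<bar>s\<bar>) \<le> inverse (ln (norm s))"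
    proof -
      have "exp (- \<bar>s - t\<bar> / 2) / ln \<bar>s\<bar> \<le> 1 / ln \<bar>s\<bar>"
        by (rule divide_right_mono[OF _ \<open>0 \<le> ln \<bar>s\<bar>\<close>]) simp
      thus ?thesis using \<open>0 \<le> ln \<bar>s\<bar>\<close> by (simp add: inverse_eq_divide)
    qed
  qed
  from Lim_null_comparison[OF this l]
  have "((\<lambda>s. \<bar>exp (- \<bar>s - t\<bar> / 2)\<bar> / ln \<bar>s\<bar>) \<longlongrightarrow> 0) at_infinity" .
  moreover have "continuous_on UNIV (\<lambda>s. exp (- \<bar>s - t\<bar> / 2))" by (intro continuous_intros) auto
  ultimately show ?thesis unfolding ou_kernel_def by (subst Upath_inverse) auto
qed

lemma ou_kernel_derivative:
  assumes "s \<noteq> t"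
  shows "(upath_apply (ou_kernel t) has_real_derivative
    (if t < s then - 1/2 else 1/2) * exp (- \<bar>s - t\<bar> / 2)) (at s)"
proof -
  have e: "upath_apply (ou_kernel t) = (\<lambda>s. exp (- \<bar>s - t\<bar> / 2))" by (rule ext) (rule ou_kernel_apply)
  show ?thesis
  proof (cases "t < s")
    case True
    have "((\<lambda>s. exp (- (s - t) / 2)) has_real_derivative - 1/2 * exp (- (s - t) / 2)) (at s)"
      by (auto intro!: derivative_eq_intros)
    hence "((\<lambda>s. exp (- \<bar>s - t\<bar> / 2)) has_real_derivative - 1/2 * exp (- (s - t) / 2)) (at s)"
      by (rule DERIV_cong_ev[THEN iffD1, rotated 3])
         (use True eventually_gt_at_top in \<open>auto intro!: eventually_mono[OF eventually_nhds_in_open[of "{t<..}"]]\<close>)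
    thus ?thesis using True by (simp add: e)
  next
    case False
    have "((\<lambda>s. exp ((s - t) / 2)) has_real_derivative 1/2 * exp ((s - t) / 2)) (at s)"
      by (auto intro!: derivative_eq_intros)
    hence "((\<lambda>s. exp (- \<bar>s - t\<bar> / 2)) has_real_derivative 1/2 * exp ((s - t) / 2)) (at s)"
      by (rule DERIV_cong_ev[THEN iffD1, rotated 3])
         (use False assms in \<open>auto intro!: eventually_mono[OF eventually_nhds_in_open[of "{..<t}"]]\<close>)
    thus ?thesis using False assms by (simp add: e)
  qed
qed

lemma upath_continuous: "continuous_on UNIV (upath_apply h)"
  using upath_apply[of h] by auto

lemma upath_lebesgue_measurable: "upath_apply h \<in> borel_measurable lebesgue"
  using borel_measurable_continuous_onI[OF upath_continuous[of h]] by (simp add: measurable_completion)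

text \<open>
  Almost everywhere the derivative is the limit of difference quotients along \<open>1 / (n + 1)\<close>; where
  it does not exist, \<open>deriv\<close> is arbitrary, and completeness of Lebesgue measure absorbs this.
\<close>

lemma deriv_lebesgue_measurable:
  assumes "continuous_on UNIV (h :: real \<Rightarrow> real)" "AE t in lebesgue. h differentiable (at t)"
  shows "deriv h \<in> borel_measurable lebesgue"
proof -
  define q where "q = (\<lambda>(n::nat) s. (h (s + inverse (Suc n)) - h s) / inverse (real (Suc n)))"
  have "q n \<in> borel_measurable lborel" for n
  proof -
    have "continuous_on UNIV (\<lambda>s. h (s + inverse (Suc n)))"
      by (rule continuous_on_compose2[OF assms(1)]) (auto intro: continuous_intros)
    hence "continuous_on UNIV (q n)" unfolding q_def
      by (intro continuous_on_divide continuous_on_diff assms(1) continuous_on_const) auto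
    thus ?thesis using borel_measurable_continuous_onI by auto
  qed
  hence "(\<lambda>s. lim (\<lambda>n. q n s)) \<in> borel_measurable lebesgue"
    by (intro measurable_completion borel_measurable_lim_metric)
  moreover have "AE s in lebesgue. lim (\<lambda>n. q n s) = deriv h s"
    using assms(2)
  proof eventually_elim
    case (elim s)
    hence "(h has_real_derivative deriv h s) (at s)"
      by (simp add: DERIV_deriv_iff_real_differentiable)
    hence "((\<lambda>z. (h (s + z) - h s) / z) \<longlongrightarrow> deriv h s) (at 0)" by (simp add: DERIV_def)
    moreover have "filterlim (\<lambda>n. inverse (real (Suc n))) (at 0) sequentially"
      using LIMSEQ_inverse_real_of_nat by (auto simp: filterlim_at)
    ultimately have "(\<lambda>n. q n s) \<longlonglongrightarrow> deriv h s"
      unfolding q_def by (rule filterlim_compose)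
    thus ?case by (rule limI)
  qed
  ultimately show ?thesis by (rule borel_measurable_AE)
qed

lemma HU_D:
  assumes "h \<in> HU"
  shows "absolutely_continuous_interval (upath_apply h) a b"
    "AE t in lebesgue. upath_apply h differentiable (at t)"
    "deriv (upath_apply h) \<in> borel_measurable lebesgue"
    "integrable lebesgue (\<lambda>t. (upath_apply h t)\<^sup>2)"
    "integrable lebesgue (\<lambda>t. (deriv (upath_apply h) t)\<^sup>2)"
proof -
  note m[measurable] = upath_lebesgue_measurable
  show "absolutely_continuous_interval (upath_apply h) a b" using assms by (simp add: HU_def)
  show d: "AE t in lebesgue. upath_apply h differentiable (at t)" using assms by (simp add: HU_def)
  show m'[measurable]: "deriv (upath_apply h) \<in> borel_measurable lebesgue"
    by (rule deriv_lebesgue_measurable[OF upath_continuous d])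
  have i: "integrable lebesgue (\<lambda>t. 1/4 * (upath_apply h t)\<^sup>2 + (deriv (upath_apply h) t)\<^sup>2)"
    using assms by (simp add: HU_def)
  have "integrable lebesgue (\<lambda>t. 4 * (1/4 * (upath_apply h t)\<^sup>2 + (deriv (upath_apply h) t)\<^sup>2))"
    using i by (intro integrable_mult_right) auto
  thus "integrable lebesgue (\<lambda>t. (upath_apply h t)\<^sup>2)"
    by (rule Bochner_Integration.integrable_bound) auto
  show "integrable lebesgue (\<lambda>t. (deriv (upath_apply h) t)\<^sup>2)"
    by (rule Bochner_Integration.integrable_bound[OF i]) auto
qed

lemma HU_I:
  assumes "\<And>a b. absolutely_continuous_interval (upath_apply h) a b"
    "AE t in lebesgue. (upath_apply h has_real_derivative d t) (at t)"
    "integrable lebesgue (\<lambda>t. (upath_apply h t)\<^sup>2)" "integrable lebesgue (\<lambda>t. (d t)\<^sup>2)"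
  shows "h \<in> HU"
proof -
  have df: "AE t in lebesgue. upath_apply h differentiable (at t)"
    using assms(2) by eventually_elim (auto simp: real_differentiable_def)
  note m[measurable] = deriv_lebesgue_measurable[OF upath_continuous df]
  have i: "integrable lebesgue (\<lambda>t. (deriv (upath_apply h) t)\<^sup>2)"
  proof (rule integrable_cong_AE_imp[OF assms(4)])
    show "AE t in lebesgue. (d t)\<^sup>2 = (deriv (upath_apply h) t)\<^sup>2"
      using assms(2) by eventually_elim (simp add: DERIV_imp_deriv)
  qed measurable
  have "integrable lebesgue (\<lambda>t. 1/4 * (upath_apply h t)\<^sup>2 + (deriv (upath_apply h) t)\<^sup>2)"
    by (intro Bochner_Integration.integrable_add integrable_mult_right i assms(3))
  with df show ?thesis using assms(1) by (auto simp: HU_def)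
qed

lemma integrable_mult_of_squares:
  fixes f g :: "'a \<Rightarrow> real"
  assumes "integrable M (\<lambda>x. (f x)\<^sup>2)" "integrable M (\<lambda>x. (g x)\<^sup>2)"
    "f \<in> borel_measurable M" "g \<in> borel_measurable M"
  shows "integrable M (\<lambda>x. f x * g x)"
proof (rule Bochner_Integration.integrable_bound)
  show "integrable M (\<lambda>x. (f x)\<^sup>2 + (g x)\<^sup>2)" using assms by auto
  show "(\<lambda>x. f x * g x) \<in> borel_measurable M" using assms by auto
  show "AE x in M. norm (f x * g x) \<le> norm ((f x)\<^sup>2 + (g x)\<^sup>2)"
  proof (intro AE_I2)
    fix x
    have "2 * (\<bar>f x\<bar> * \<bar>g x\<bar>) \<le> (f x)\<^sup>2 + (g x)\<^sup>2"
      using sum_squares_bound[of "\<bar>f x\<bar>" "\<bar>g x\<bar>"] by simp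
    moreover have "0 \<le> \<bar>f x\<bar> * \<bar>g x\<bar>" by (intro mult_nonneg_nonneg) auto
    ultimately have "\<bar>f x\<bar> * \<bar>g x\<bar> \<le> (f x)\<^sup>2 + (g x)\<^sup>2" by linarith
    thus "norm (f x * g x) \<le> norm ((f x)\<^sup>2 + (g x)\<^sup>2)"
      by (simp add: abs_mult)
  qed
qed

lemma upath_combination_apply:
  "upath_apply (a *\<^sub>R h + b *\<^sub>R k) = (\<lambda>t. a * upath_apply h t + b * upath_apply k t)"
  by (simp add: fun_eq_iff upath_rep_simps)

lemma HU_deriv_combination:
  assumes "h \<in> HU" "k \<in> HU"
  shows "AE t in lebesgue. (upath_apply (a *\<^sub>R h + b *\<^sub>R k) has_real_derivative
           a * deriv (upath_apply h) t + b * deriv (upath_apply k) t) (at t)"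
  using HU_D(2)[OF assms(1)] HU_D(2)[OF assms(2)]
proof eventually_elim
  case (elim t)
  hence "(upath_apply h has_real_derivative deriv (upath_apply h) t) (at t)"
     "(upath_apply k has_real_derivative deriv (upath_apply k) t) (at t)"
    by (simp_all add: DERIV_deriv_iff_real_differentiable)
  thus ?case unfolding upath_combination_apply
    by (intro DERIV_add DERIV_cmult)
qed

lemma HU_combination:
  assumes "h \<in> HU" "k \<in> HU"
  shows "a *\<^sub>R h + b *\<^sub>R k \<in> HU"
proof (rule HU_I[OF _ HU_deriv_combination[OF assms]])
  note h = HU_D[OF assms(1)] and k = HU_D[OF assms(2)]
  show "absolutely_continuous_interval (upath_apply (a *\<^sub>R h + b *\<^sub>R k)) x y" for x y
    unfolding upath_combination_apply by (intro ac_interval_linear_combination h k)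
  have e: "(a * p + b * q)\<^sup>2 = a\<^sup>2 * p\<^sup>2 + b\<^sup>2 * q\<^sup>2 + 2 * a * b * (p * q)" for p q :: real
    by (simp add: power2_eq_square algebra_simps)
  show "integrable lebesgue (\<lambda>t. (upath_apply (a *\<^sub>R h + b *\<^sub>R k) t)\<^sup>2)"
    unfolding upath_combination_apply e
    by (intro Bochner_Integration.integrable_add integrable_mult_right integrable_mult_of_squares
        h k upath_lebesgue_measurable)
  show "integrable lebesgue (\<lambda>t. (a * deriv (upath_apply h) t + b * deriv (upath_apply k) t)\<^sup>2)"
    unfolding e
    by (intro Bochner_Integration.integrable_add integrable_mult_right integrable_mult_of_squares h k)
qed

lemma HU_inner_integrable:
  assumes "h \<in> HU" "k \<in> HU"
  shows "integrable lebesgue (\<lambda>t. upath_apply h t * upath_apply k t)"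
    "integrable lebesgue (\<lambda>t. deriv (upath_apply h) t * deriv (upath_apply k) t)"
    "integrable lebesgue (\<lambda>t. 1/4 * upath_apply h t * upath_apply k t
                     + deriv (upath_apply h) t * deriv (upath_apply k) t)"
proof -
  note h = HU_D[OF assms(1)] and k = HU_D[OF assms(2)]
  show 1: "integrable lebesgue (\<lambda>t. upath_apply h t * upath_apply k t)"
    "integrable lebesgue (\<lambda>t. deriv (upath_apply h) t * deriv (upath_apply k) t)"
    using h k upath_lebesgue_measurable by (auto intro!: integrable_mult_of_squares)
  show "integrable lebesgue (\<lambda>t. 1/4 * upath_apply h t * upath_apply k t
                     + deriv (upath_apply h) t * deriv (upath_apply k) t)"
    using Bochner_Integration.integrable_add[OF integrable_mult_right[OF 1(1), of "1/4"] 1(2)]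
    by (simp add: mult.assoc)
qed

lemma HU_inner_commute: "HU_inner h k = HU_inner k h"
  by (simp add: HU_inner_def mult.commute mult.left_commute)

lemma HU_inner_combination:
  assumes "h \<in> HU" "k \<in> HU" "x \<in> HU"
  shows "HU_inner (a *\<^sub>R h + b *\<^sub>R k) x = a * HU_inner h x + b * HU_inner k x"
proof -
  have "HU_inner (a *\<^sub>R h + b *\<^sub>R k) x =
    (LINT t|lebesgue. a * (1/4 * upath_apply h t * upath_apply x t
                     + deriv (upath_apply h) t * deriv (upath_apply x) t) +
       b * (1/4 * upath_apply k t * upath_apply x t
                     + deriv (upath_apply k) t * deriv (upath_apply x) t))"
    unfolding HU_inner_def
  proof (rule integral_cong_AE)
    have "a *\<^sub>R h + b *\<^sub>R k \<in> HU" by (intro HU_combination assms)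
    note [measurable] = upath_lebesgue_measurable HU_D(3)[OF assms(1)] HU_D(3)[OF assms(2)]
      HU_D(3)[OF assms(3)] HU_D(3)[OF this]
    show "(\<lambda>t. 1 / 4 * upath_apply (a *\<^sub>R h + b *\<^sub>R k) t * upath_apply x t +
          deriv (upath_apply (a *\<^sub>R h + b *\<^sub>R k)) t * deriv (upath_apply x) t)
      \<in> borel_measurable lebesgue" by measurable
    show "(\<lambda>t. a * (1/4 * upath_apply h t * upath_apply x t
                     + deriv (upath_apply h) t * deriv (upath_apply x) t) +
       b * (1/4 * upath_apply k t * upath_apply x t
                     + deriv (upath_apply k) t * deriv (upath_apply x) t))
      \<in> borel_measurable lebesgue" by measurable
    show "AE t in lebesgue. 1 / 4 * upath_apply (a *\<^sub>R h + b *\<^sub>R k) t * upath_apply x t +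
          deriv (upath_apply (a *\<^sub>R h + b *\<^sub>R k)) t * deriv (upath_apply x) t =
          a * (1/4 * upath_apply h t * upath_apply x t
                     + deriv (upath_apply h) t * deriv (upath_apply x) t) +
       b * (1/4 * upath_apply k t * upath_apply x t
                     + deriv (upath_apply k) t * deriv (upath_apply x) t)"
      using HU_deriv_combination[OF assms(1,2), of a b]
    proof eventually_elim
      case (elim t)
      show ?case unfolding DERIV_imp_deriv[OF elim] 
        by (simp add: upath_combination_apply algebra_simps)
    qed
  qed
  also have "\<dots> = a * HU_inner h x + b * HU_inner k x"
    unfolding HU_inner_def using HU_inner_integrable(3)[OF assms(1,3)] HU_inner_integrable(3)[OF assms(2,3)]
    by (subst Bochner_Integration.integral_add) (auto intro!: integrable_mult_right)
  finally show ?thesis .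
qed

lemma abs_exp_minus_diff_le:
  assumes "0 \<le> p" "0 \<le> (q::real)"
  shows "\<bar>exp (- p) - exp (- q)\<bar> \<le> \<bar>p - q\<bar>"
proof -
  have *: "\<bar>exp (- p) - exp (- q)\<bar> \<le> \<bar>p - q\<bar>" if "p \<le> q" "0 \<le> p" for p q :: real
  proof -
    have "exp (- p) - exp (- q) = exp (- p) * (1 - exp (- (q - p)))"
      by (simp add: algebra_simps flip: exp_add)
    also have "\<dots> \<le> 1 * (q - p)"
    proof (intro mult_mono)
      show "1 - exp (- (q - p)) \<le> q - p" using exp_ge_add_one_self[of "- (q - p)"] by linarith
    qed (use that in auto)
    finally show ?thesis using that by simp
  qed
  show ?thesis using *[of p q] *[of q p] assms by (cases "p \<le> q") (auto simp: abs_minus_commute)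
qed

lemma ou_kernel_HU: "ou_kernel t \<in> HU"
proof (rule HU_I)
  show "absolutely_continuous_interval (upath_apply (ou_kernel t)) a b" for a b
  proof (rule lipschitz_ac_interval)
    fix x y
    have "\<bar>exp (- (\<bar>y - t\<bar> / 2)) - exp (- (\<bar>x - t\<bar> / 2))\<bar> \<le> \<bar>\<bar>y - t\<bar> / 2 - \<bar>x - t\<bar> / 2\<bar>"
      by (intro abs_exp_minus_diff_le) auto
    also have "\<dots> = \<bar>\<bar>y - t\<bar> - \<bar>x - t\<bar>\<bar> / 2" by (simp flip: diff_divide_distrib)
    also have "\<dots> \<le> \<bar>\<bar>y - t\<bar> - \<bar>x - t\<bar>\<bar>" by simp
    also have "\<dots> \<le> \<bar>y - x\<bar>" using abs_triangle_ineq3[of "y - t" "x - t"] by simp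
    finally show "\<bar>upath_apply (ou_kernel t) y - upath_apply (ou_kernel t) x\<bar> \<le> \<bar>y - x\<bar>"
      by (simp add: ou_kernel_apply)
  qed
  have "AE s in lebesgue. s \<noteq> t" by (intro AE_completion AE_lborel_singleton)
  thus "AE s in lebesgue. (upath_apply (ou_kernel t) has_real_derivative
      (if t < s then - 1/2 else 1/2) * exp (- \<bar>s - t\<bar> / 2)) (at s)"
    by eventually_elim (rule ou_kernel_derivative)
  have e: "integrable lebesgue (\<lambda>s. exp (- \<bar>s - t\<bar>))"
    using integrable_exp_abs[of 1 t] by (simp add: integrable_completion)
  have s: "(exp (- \<bar>s - t\<bar> / 2))\<^sup>2 = exp (- \<bar>s - t\<bar>)" for s
    by (simp add: power2_eq_square flip: exp_add)
  show "integrable lebesgue (\<lambda>s. (upath_apply (ou_kernel t) s)\<^sup>2)"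
    unfolding ou_kernel_apply s by (rule e)
  have d: "((if t < s then - 1/2 else 1/2) * exp (- \<bar>s - t\<bar> / 2))\<^sup>2 = 1/4 * exp (- \<bar>s - t\<bar>)" for s
    unfolding power_mult_distrib s by (simp add: power_divide)
  show "integrable lebesgue (\<lambda>s. ((if t < s then - 1/2 else 1/2) * exp (- \<bar>s - t\<bar> / 2))\<^sup>2)"
    unfolding d by (intro integrable_mult_right e)
qed

text \<open>
  On either side of \<open>t\<close> the integrand of \<open>HU_inner h (ou_kernel t)\<close> is the derivative of a multiple
  of \<open>h\<close> times the kernel.
\<close>

lemma HU_exp_FTC:
  assumes "h \<in> HU" "a \<le> b"
  shows "((\<lambda>s. (deriv (upath_apply h) s + c * upath_apply h s) * exp (c * (s - t))) has_integral
     (upath_apply h b * exp (c * (b - t)) - upath_apply h a * exp (c * (a - t)))) {a..b}"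
proof -
  obtain N where N0: "N \<in> null_sets lebesgue" and N1: "{s. \<not> upath_apply h differentiable (at s)} \<subseteq> N"
    using HU_D(2)[OF assms(1)] unfolding eventually_ae_filter by auto
  hence N: "negligible N" by (simp add: negligible_iff_null_sets)
  define w where "w = (\<lambda>s::real. exp (c * (s - t)))"
  have wd: "(w has_real_derivative c * w s) (at s)" for s
    unfolding w_def by (auto intro!: derivative_eq_intros)
  have wc: "continuous_on UNIV w" unfolding w_def by (intro continuous_intros)
  obtain M where M: "0 < M" "\<And>x. x \<in> {a..b} \<Longrightarrow> \<bar>w x\<bar> \<le> M"
    using continuous_bounded_on_interval[OF wc] by metis
  have wl: "\<bar>w y - w x\<bar> \<le> (\<bar>c\<bar> * M) * \<bar>y - x\<bar>" if "x \<in> {a..b}" "y \<in> {a..b}" for x y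
  proof -
    have "norm (w y - w x) \<le> (\<bar>c\<bar> * M) * norm (y - x)"
    proof (rule field_differentiable_bound[of "{a..b}" w "\<lambda>s. c * w s"])
      show "(w has_field_derivative c * w z) (at z within {a..b})" for z
        using wd by (rule has_field_derivative_at_within)
    qed (use that M in \<open>auto simp: abs_mult intro!: mult_left_mono\<close>)
    thus ?thesis by simp
  qed
  have "((\<lambda>s. (deriv (upath_apply h) s + c * upath_apply h s) * w s) has_integral
     (upath_apply h b * w b - upath_apply h a * w a)) {a..b}"
  proof (rule absolutely_continuous_FTC[OF _ assms(2) N])
    show "absolutely_continuous_interval (\<lambda>x. upath_apply h x * w x) a b"
      by (rule ac_interval_mult_lipschitz[OF HU_D(1)[OF assms(1)] upath_continuous wc wl])
    fix s assume "s \<in> {a..b} - N"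
    hence "(upath_apply h has_real_derivative deriv (upath_apply h) s) (at s)"
      using N1 by (auto simp: DERIV_deriv_iff_real_differentiable)
    from DERIV_mult[OF this wd]
    show "((\<lambda>x. upath_apply h x * w x) has_real_derivative
           (deriv (upath_apply h) s + c * upath_apply h s) * w s) (at s)"
      by (rule DERIV_cong) (simp add: algebra_simps)
  qed
  thus ?thesis by (simp add: w_def)
qed

lemma upath_log_bound: "\<bar>upath_apply h s\<bar> \<le> norm h * logw s"
proof -
  have "norm (upath_bc h s) \<le> norm (upath_bc h)" by (rule norm_bounded)
  thus ?thesis using logw_pos[of s]
    by (simp add: upath_bc_apply norm_upath_bc[symmetric] abs_divide abs_of_pos field_simps)
qed

text \<open>
  A cruder bound, convenient for integration against exponential and Gaussian weights.
\<close>

lemma upath_linear_bound: "\<bar>upath_apply h s\<bar> \<le> norm h * (exp 1 + \<bar>s\<bar>)"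
proof -
  have "logw s \<le> exp 1 + \<bar>s\<bar>" using ln_bound[of "exp 1 + \<bar>s\<bar>"] by (simp add: add_pos_nonneg)
  thus ?thesis using upath_log_bound[of h s] by (meson mult_left_mono norm_ge_zero order_trans)
qed

text \<open>
  The primitives on the two sides of \<open>t\<close> meet there, each contributing \<open>h t / 2\<close>, while the
  boundary terms at \<open>t \<plusminus> n\<close> vanish as \<open>n\<close> grows, the kernel decaying exponentially.
\<close>

theorem HU_inner_ou_kernel:
  assumes "h \<in> HU"
  shows "HU_inner h (ou_kernel t) = upath_apply h t"
proof -
  define D where "D = deriv (upath_apply h)"
  define G where "G = (\<lambda>s. 1/4 * upath_apply h s * upath_apply (ou_kernel t) s
                     + D s * deriv (upath_apply (ou_kernel t)) s)"
  have iG: "integrable lebesgue G"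
    unfolding G_def D_def by (rule HU_inner_integrable(3)[OF assms ou_kernel_HU])
  have dk: "deriv (upath_apply (ou_kernel t)) s = (if t < s then - 1/2 else 1/2) * exp (- \<bar>s - t\<bar> / 2)"
    if "s \<noteq> t" for s by (rule DERIV_imp_deriv[OF ou_kernel_derivative[OF that]])
  let ?H = "upath_apply h"
  have side: "(G has_integral (c * (?H b * exp (c * (b - t)) - ?H a * exp (c * (a - t))))) {a..b}"
    if ab: "a \<le> b" and c: "c = 1/2 \<and> b = t \<or> c = - 1/2 \<and> a = t" for a b c :: real
  proof (rule has_integral_spike[OF negligible_sing[of t]])
    show "((\<lambda>s. c * ((D s + c * ?H s) * exp (c * (s - t)))) has_integral
      (c * (?H b * exp (c * (b - t)) - ?H a * exp (c * (a - t))))) {a..b}"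
      unfolding D_def by (intro has_integral_mult_right HU_exp_FTC[OF assms ab])
    fix s assume s: "s \<in> {a..b} - {t}"
    define E where "E = exp (- \<bar>s - t\<bar> / 2)"
    have "c * (s - t) = - \<bar>s - t\<bar> / 2"
    proof (cases "c = 1/2")
      case True
      hence "\<bar>s - t\<bar> = t - s" using s c by auto
      thus ?thesis unfolding True by (simp add: field_simps)
    next
      case False
      hence c': "c = - 1/2" "a = t" using c by auto
      hence "\<bar>s - t\<bar> = s - t" using s by auto
      thus ?thesis unfolding c'(1) by (simp add: field_simps)
    qed
    hence E: "exp (c * (s - t)) = E" unfolding E_def by (rule arg_cong)
    have "G s = 1/4 * ?H s * E + D s * (c * E)"
      using s c dk[of s] unfolding G_def ou_kernel_apply E_def by auto
    also have "1/4 = c * c"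
    proof -
      have "c = 1/2 \<or> c = - 1/2" using c by blast
      thus ?thesis by (elim disjE ssubst) simp_all
    qed
    also have "c * c * ?H s * E + D s * (c * E) = c * ((D s + c * ?H s) * E)" by (simp add: algebra_simps)
    finally show "G s = c * ((D s + c * ?H s) * exp (c * (s - t)))" unfolding E .
  qed
  have RL: "(LINT s|lebesgue. indicator {t - real n..t + real n} s * G s) =
     ?H t - (?H (t + n) + ?H (t - n)) / 2 * exp (- real n / 2)" for n :: nat
  proof -
    have "(G has_integral (1/2 * (?H t - ?H (t - n) * exp (- real n/2)) +
        - 1/2 * (?H (t + n) * exp (- real n/2) - ?H t))) {t - real n..t + real n}"
    proof (rule has_integral_combine)
      show "(G has_integral 1/2 * (?H t - ?H (t - n) * exp (- real n/2))) {t - real n..t}"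
        using side[of "t - real n" t "1/2"] by simp
      show "(G has_integral - 1/2 * (?H (t + n) * exp (- real n/2) - ?H t)) {t..t + real n}"
        using side[of t "t + real n" "- 1/2"] by simp
    qed auto
    moreover have "set_integrable lebesgue {t - real n..t + real n} G"
      unfolding set_integrable_def using iG
      by (intro integrable_mult_indicator) auto
    hence "(G has_integral (LINT s:{t - real n..t + real n}|lebesgue. G s)) {t - real n..t + real n}"
      by (rule has_integral_set_lebesgue)
    ultimately have "(LINT s:{t - real n..t + real n}|lebesgue. G s) =
       1/2 * (?H t - ?H (t - n) * exp (- real n/2)) +
        - 1/2 * (?H (t + n) * exp (- real n/2) - ?H t)"
      by (rule has_integral_unique[symmetric])
    thus ?thesis by (simp add: set_lebesgue_integral_def field_simps)
  qed
  have l1: "(\<lambda>n. LINT s|lebesgue. indicator {t - real n..t + real n} s * G s) \<longlonglongrightarrow> (LINT s|lebesgue. G s)"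
  proof (rule integral_dominated_convergence[where w = "\<lambda>s. \<bar>G s\<bar>"])
    show "AE s in lebesgue. (\<lambda>n. indicator {t - real n..t + real n} s * G s) \<longlonglongrightarrow> G s"
    proof (intro AE_I2)
      fix s
      obtain N :: nat where N: "\<bar>s - t\<bar> \<le> N" using real_arch_simple by blast
      show "(\<lambda>n. indicator {t - real n..t + real n} s * G s) \<longlonglongrightarrow> G s"
      proof (rule tendsto_eventually, unfold eventually_sequentially, intro exI[of _ N] allI impI)
        fix n assume "N \<le> n"
        hence "s \<in> {t - real n..t + real n}" using N by auto
        thus "indicator {t - real n..t + real n} s * G s = G s" by simp
      qed
    qed
    show "AE s in lebesgue. norm (indicator {t - real n..t + real n} s * G s) \<le> \<bar>G s\<bar>" for n
      by (auto simp: indicator_def)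
  qed (use iG in \<open>auto intro!: borel_measurable_times borel_measurable_indicator\<close>)
  have average: "\<bar>(p + q) / 2\<bar> \<le> C" if "\<bar>p\<bar> \<le> C" "\<bar>q\<bar> \<le> C" for p q C :: real
    using that by (auto simp: abs_le_iff)
  have "(\<lambda>n. ?H t - (?H (t + real n) + ?H (t - real n)) / 2 * exp (- real n / 2)) \<longlonglongrightarrow> ?H t - 0"
  proof (intro tendsto_diff tendsto_const, rule Lim_null_comparison)
    show "\<forall>\<^sub>F n in sequentially. norm ((?H (t + real n) + ?H (t - real n)) / 2 * exp (- real n / 2)) \<le>
       norm h * ((exp 1 + \<bar>t\<bar> + n) * exp (- real n / 2))"
    proof (intro always_eventually allI)
      fix n :: nat
      have "\<bar>?H (t + real n)\<bar> \<le> norm h * (exp 1 + \<bar>t + real n\<bar>)" "\<bar>?H (t - real n)\<bar> \<le> norm h * (exp 1 + \<bar>t - real n\<bar>)"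
        by (rule upath_linear_bound)+
      moreover have "norm h * (exp 1 + \<bar>t + real n\<bar>) \<le> norm h * (exp 1 + \<bar>t\<bar> + n)"
          "norm h * (exp 1 + \<bar>t - real n\<bar>) \<le> norm h * (exp 1 + \<bar>t\<bar> + n)"
        by (intro mult_left_mono; simp)+
      ultimately have "\<bar>?H (t + real n)\<bar> \<le> norm h * (exp 1 + \<bar>t\<bar> + n)"
          "\<bar>?H (t - real n)\<bar> \<le> norm h * (exp 1 + \<bar>t\<bar> + n)"
        by (meson order_trans)+
      hence "\<bar>(?H (t + real n) + ?H (t - real n)) / 2\<bar> \<le> norm h * (exp 1 + \<bar>t\<bar> + n)"
        by (rule average)
      thus "norm ((?H (t + real n) + ?H (t - real n)) / 2 * exp (- real n / 2)) \<le>
       norm h * ((exp 1 + \<bar>t\<bar> + n) * exp (- real n / 2))"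
        unfolding real_norm_def abs_mult[of _ "exp _"] abs_exp_cancel mult.assoc[symmetric] 
        by (rule mult_right_mono) simp
    qed
    have "(\<lambda>n. (exp 1 + \<bar>t\<bar> + real n) * exp (- real n / 2)) \<longlonglongrightarrow> 0" by real_asymp
    from tendsto_mult_left[OF this, of "norm h"]
    show "(\<lambda>n. norm h * ((exp 1 + \<bar>t\<bar> + real n) * exp (- real n / 2))) \<longlonglongrightarrow> 0" by simp
  qed
  with l1 have "(LINT s|lebesgue. G s) = ?H t" unfolding RL by (auto dest: LIMSEQ_unique)
  thus ?thesis unfolding HU_inner_def G_def D_def .
qed

text \<open>
  A vector is determined by its inner products, because its values are among them.
\<close>

lemma HU_eqI:
  assumes "h \<in> HU" "k \<in> HU" "\<And>x. x \<in> HU \<Longrightarrow> HU_inner x h = HU_inner x k"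
  shows "h = k"
  using assms by (intro upath_eqI) (metis HU_inner_commute HU_inner_ou_kernel ou_kernel_HU)

section \<open>Centred Gaussian variables and joint laws\<close>

lemma L2_Cauchy_Schwarz:
  fixes f g :: "'a \<Rightarrow> real"
  assumes "integrable M (\<lambda>x. (f x)\<^sup>2)" "integrable M (\<lambda>x. (g x)\<^sup>2)"
    and [measurable]: "f \<in> borel_measurable M" "g \<in> borel_measurable M"
  shows "(\<integral>x. f x * g x \<partial>M)\<^sup>2 \<le> (\<integral>x. (f x)\<^sup>2 \<partial>M) * (\<integral>x. (g x)\<^sup>2 \<partial>M)"
proof -
  have i: "integrable M (\<lambda>x. f x * g x)" by (rule integrable_mult_of_squares[OF assms])
  define A where "A = (\<integral>x. (f x)\<^sup>2 \<partial>M)"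
  define B where "B = (\<integral>x. (g x)\<^sup>2 \<partial>M)"
  define C where "C = (\<integral>x. f x * g x \<partial>M)"
  have quad: "0 \<le> s\<^sup>2 * A + t\<^sup>2 * B + 2 * s * t * C" for s t
  proof -
    have e: "(s * f x + t * g x)\<^sup>2 = s\<^sup>2 * (f x)\<^sup>2 + t\<^sup>2 * (g x)\<^sup>2 + 2 * s * t * (f x * g x)" for x
      by (simp add: power2_eq_square algebra_simps)
    have "0 \<le> (\<integral>x. (s * f x + t * g x)\<^sup>2 \<partial>M)" by simp
    also have "\<dots> = s\<^sup>2 * A + t\<^sup>2 * B + 2 * s * t * C"
      unfolding e A_def B_def C_def using assms i by simp
    finally show ?thesis .
  qed
  have "0 \<le> A" "0 \<le> B" by (simp_all add: A_def B_def)
  show ?thesis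
  proof (cases "B = 0")
    case True
    \<comment> \<open>this choice of \<open>t\<close> would make the quadratic form equal to \<open>- 1\<close>\<close>
    have "0 \<le> A - 2 * ((A + 1) / (2 * C)) * C" if "C \<noteq> 0"
      using quad[of 1 "- ((A + 1) / (2 * C))"] True by simp
    hence "C = 0" by (auto simp: field_simps)
    thus ?thesis using True by (simp add: A_def B_def C_def)
  next
    case False
    hence "0 < B" using \<open>0 \<le> B\<close> by simp
    have "0 \<le> B * (A * B - C\<^sup>2)"
      using quad[of B "- C"] by (simp add: power2_eq_square algebra_simps)
    hence "C\<^sup>2 \<le> A * B" using \<open>0 < B\<close> by (simp add: zero_le_mult_iff)
    thus ?thesis by (simp add: A_def B_def C_def)
  qed
qed

lemma cmod_iexp_diff_le: "cmod (iexp a - iexp b) \<le> \<bar>a - b\<bar>"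
proof -
  have "iexp a - iexp b = iexp b * (iexp (a - b) - 1)"
    by (simp add: algebra_simps flip: exp_add)
  thus ?thesis using iexp_approx1[of "a - b" 0] by (simp add: norm_mult)
qed

context prob_space
begin

text \<open>
  Centred Gaussian of variance \<open>v\<close>.  The characteristic function covers the degenerate case \<open>v = 0\<close>,
  which has no density, and passes to limits.
\<close>

definition gauss :: "('a \<Rightarrow> real) \<Rightarrow> real \<Rightarrow> bool" where
  "gauss X v \<longleftrightarrow> X \<in> borel_measurable M \<and> 0 \<le> v \<and>
     (\<forall>c. (CLINT x|M. iexp (c * X x)) = complex_of_real (exp (- (c\<^sup>2 * v) / 2)))"

lemma char_distr: "X \<in> borel_measurable M \<Longrightarrow> char (distr M borel X) c = (CLINT x|M. iexp (c * X x))"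
  unfolding char_def by (subst integral_distr) auto

lemma gauss_positive_iff_distributed:
  assumes "0 < v"
  shows "gauss X v \<longleftrightarrow> distributed M lborel X (normal_density 0 (sqrt v))"
proof -
  define s where "s = sqrt v"
  have s: "0 < s" "s\<^sup>2 = v" using assms by (auto simp: s_def)
  define Y where "Y = (\<lambda>x. (X x - 0) / s)"
  have "gauss X v \<longleftrightarrow> distributed M lborel Y std_normal_density"
  proof
    assume g: "gauss X v"
    hence [measurable]: "X \<in> borel_measurable M" by (simp add: gauss_def)
    have [measurable]: "Y \<in> borel_measurable M" unfolding Y_def by measurable
    have "distr M borel Y = std_normal_distribution"
    proof (rule Levy_uniqueness)
      show "real_distribution (distr M borel Y)" by simp
      show "real_distribution std_normal_distribution" by (rule real_dist_normal_dist)
      show "char (distr M borel Y) = char std_normal_distribution"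
      proof
        fix c
        have "char (distr M borel Y) c = (CLINT x|M. iexp ((c / s) * X x))"
          by (subst char_distr) (simp_all add: Y_def)
        also have "\<dots> = complex_of_real (exp (- ((c / s)\<^sup>2 * v) / 2))" using g unfolding gauss_def by blast
        also have "(c / s)\<^sup>2 * v = c\<^sup>2" using s by (simp add: power_divide field_simps flip: s(2))
        finally show "char (distr M borel Y) c = char std_normal_distribution c"
          by (simp add: char_std_normal_distribution)
      qed
    qed
    moreover have "distr M lborel Y = distr M borel Y" by (rule distr_cong) auto
    ultimately show "distributed M lborel Y std_normal_density"
      by (auto simp: distributed_def)
  next
    assume d: "distributed M lborel Y std_normal_density"
    have [measurable]: "Y \<in> borel_measurable M" using distributed_measurable[OF d] by simp
    have X: "X = (\<lambda>x. s * Y x)" using s by (auto simp: Y_def)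
    have "(CLINT x|M. iexp (c * X x)) = complex_of_real (exp (- (c\<^sup>2 * v) / 2))" for c
    proof -
      have "(CLINT x|M. iexp (c * X x)) = char (distr M borel Y) (c * s)"
        by (simp add: char_distr X mult.assoc)
      also have "distr M borel Y = distr M lborel Y" by (rule distr_cong) auto
      also have "\<dots> = std_normal_distribution" using d by (simp add: distributed_def)
      also have "char \<dots> (c * s) = complex_of_real (exp (- (c\<^sup>2 * v) / 2))"
        by (simp add: char_std_normal_distribution power_mult_distrib s)
      finally show ?thesis .
    qed
    moreover have "X \<in> borel_measurable M" unfolding X by measurable
    ultimately show "gauss X v" using assms by (auto simp: gauss_def)
  qed
  also have "\<dots> \<longleftrightarrow> distributed M lborel X (normal_density 0 s)"
    using normal_standard_normal_convert[OF s(1), of X 0] by (simp add: Y_def)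
  finally show ?thesis unfolding s_def .
qed

lemma gauss_zero_AE:
  assumes "gauss X 0"
  shows "AE x in M. X x = 0"
proof -
  have [measurable]: "X \<in> borel_measurable M" using assms by (simp add: gauss_def)
  have "distr M borel X = distr M borel (\<lambda>_. 0)"
  proof (rule Levy_uniqueness)
    show "char (distr M borel X) = char (distr M borel (\<lambda>_. 0))"
      using assms by (simp add: fun_eq_iff char_distr gauss_def prob_space del: distr_const)
    show "real_distribution (distr M borel X)" "real_distribution (distr M borel (\<lambda>_. 0))"
      by (rule real_distribution_distr, simp)+
  qed
  moreover have "AE y in distr M borel (\<lambda>_. 0 :: real). y = 0"
    by (subst AE_distr_iff) auto
  ultimately have "AE y in distr M borel X. y = 0" by (simp only:)
  thus ?thesis by (subst (asm) AE_distr_iff) auto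
qed

lemma gauss_moments:
  assumes "gauss X v"
  shows "expectation X = 0" "integrable M (\<lambda>x. (X x)\<^sup>2)" "expectation (\<lambda>x. (X x)\<^sup>2) = v"
    "integrable M (\<lambda>x. (X x) ^ 6)" "expectation (\<lambda>x. (X x) ^ 6) = 15 * v ^ 3"
proof -
  have X: "X \<in> borel_measurable M" "0 \<le> v" using assms by (auto simp: gauss_def)
  have "expectation X = 0 \<and> integrable M (\<lambda>x. (X x)\<^sup>2) \<and> expectation (\<lambda>x. (X x)\<^sup>2) = v \<and>
    integrable M (\<lambda>x. (X x) ^ 6) \<and> expectation (\<lambda>x. (X x) ^ 6) = 15 * v ^ 3"
  proof (cases "v = 0")
    case True
    hence ae: "AE x in M. X x = 0" using gauss_zero_AE assms by simp
    have "expectation X = expectation (\<lambda>_. 0)"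
      using ae X by (intro integral_cong_AE) auto
    moreover have "AE x in M. (X x) ^ n = 0" if "n > 0" for n
      using ae by eventually_elim (use that in auto)
    hence "integrable M (\<lambda>x. (X x) ^ n) \<and> expectation (\<lambda>x. (X x) ^ n) = 0" if "n > 0" for n
      using that X integrable_cong_AE[of "\<lambda>x. X x ^ n" M "\<lambda>_. 0"]
        integral_cong_AE[of "\<lambda>x. X x ^ n" M "\<lambda>_. 0"] by auto
    ultimately show ?thesis using True by simp
  next
    case False
    hence v: "0 < v" using X by simp
    hence d: "distributed M lborel X (normal_density 0 (sqrt v))"
      using gauss_positive_iff_distributed assms by simp
    have s: "0 < sqrt v" using v by simp
    have I: "integrable M (\<lambda>x. (X x) ^ n)" for n
      using distributed_integrable[OF d, of "\<lambda>x. x ^ n"] integrable_normal_moment[OF s, of 0 n]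
      by (simp add: normal_density_nonneg)
    have E: "expectation (\<lambda>x. (X x) ^ n) = (\<integral>x. normal_density 0 (sqrt v) x * (x - 0) ^ n \<partial>lborel)" for n
      using distributed_integral[OF d, of "\<lambda>x. x ^ n"] by (simp add: normal_density_nonneg)
    have "expectation X = 0"
      using E[of 1] integral_normal_moment_odd[OF s, of 0 0] by simp
    moreover have "expectation (\<lambda>x. (X x)\<^sup>2) = v"
      using E[of 2] integral_normal_moment_even[OF s, of 0 1] v by simp
    moreover have "expectation (\<lambda>x. (X x) ^ 6) = 15 * v ^ 3"
      using E[of 6] integral_normal_moment_even[OF s, of 0 3] v
      by (simp add: fact_numeral power_divide field_simps)
    ultimately show ?thesis using I by blast
  qed
  thus "expectation X = 0" "integrable M (\<lambda>x. (X x)\<^sup>2)" "expectation (\<lambda>x. (X x)\<^sup>2) = v"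
    "integrable M (\<lambda>x. (X x) ^ 6)" "expectation (\<lambda>x. (X x) ^ 6) = 15 * v ^ 3" by auto
qed

lemma gauss_cong_AE:
  assumes "gauss X v" "AE x in M. X x = Y x" "Y \<in> borel_measurable M"
  shows "gauss Y v"
proof -
  have [measurable]: "X \<in> borel_measurable M" "Y \<in> borel_measurable M"
    using assms by (auto simp: gauss_def)
  have "(CLINT x|M. iexp (c * Y x)) = (CLINT x|M. iexp (c * X x))" for c
    using assms(2) by (intro integral_cong_AE) auto
  thus ?thesis using assms unfolding gauss_def by auto
qed

lemma gauss_indep_sum:
  assumes "indep_vars (\<lambda>_. borel) X J" "finite J" "\<And>i. i \<in> J \<Longrightarrow> gauss (X i) (v i)"
  shows "gauss (\<lambda>x. \<Sum>i\<in>J. X i x) (\<Sum>i\<in>J. v i)"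
proof -
  have m: "(\<lambda>x. \<Sum>i\<in>J. X i x) \<in> borel_measurable M"
    using assms(3) by (intro borel_measurable_sum) (auto simp: gauss_def)
  have "(CLINT x|M. iexp (c * (\<Sum>i\<in>J. X i x))) = complex_of_real (exp (- (c\<^sup>2 * (\<Sum>i\<in>J. v i)) / 2))" for c
  proof -
    have "(CLINT x|M. iexp (c * (\<Sum>i\<in>J. X i x))) = (\<Prod>i\<in>J. char (distr M borel (X i)) c)"
      using char_distr_sum[OF assms(1), of c] char_distr[OF m, of c] by simp
    also have "\<dots> = (\<Prod>i\<in>J. complex_of_real (exp (- (c\<^sup>2 * v i) / 2)))"
    proof (rule prod.cong[OF refl])
      fix i assume "i \<in> J"
      thus "char (distr M borel (X i)) c = complex_of_real (exp (- (c\<^sup>2 * v i) / 2))"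
        using assms(3)[of i] by (subst char_distr) (auto simp: gauss_def)
    qed
    also have "\<dots> = complex_of_real (exp (\<Sum>i\<in>J. - (c\<^sup>2 * v i) / 2))"
      by (simp add: exp_sum[OF assms(2)])
    also have "(\<Sum>i\<in>J. - (c\<^sup>2 * v i) / 2) = - (c\<^sup>2 * (\<Sum>i\<in>J. v i)) / 2"
      by (simp add: sum_distrib_left sum_negf flip: sum_divide_distrib)
    finally show ?thesis .
  qed
  moreover have "0 \<le> (\<Sum>i\<in>J. v i)" using assms(3) by (intro sum_nonneg) (auto simp: gauss_def)
  ultimately show ?thesis using m by (simp add: gauss_def)
qed

lemma gauss_cmult:
  assumes "gauss X v"
  shows "gauss (\<lambda>x. a * X x) (a\<^sup>2 * v)"
proof -
  have "(CLINT x|M. iexp (c * (a * X x))) = complex_of_real (exp (- (c\<^sup>2 * (a\<^sup>2 * v)) / 2))" for c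
  proof -
    have "(CLINT x|M. iexp ((c * a) * X x)) = complex_of_real (exp (- ((c * a)\<^sup>2 * v) / 2))"
      using assms unfolding gauss_def by blast
    thus ?thesis by (simp add: power_mult_distrib mult.assoc)
  qed
  thus ?thesis using assms unfolding gauss_def by auto
qed

lemma gauss_rv:
  assumes "gauss X v"
  shows "X \<in> borel_measurable M \<and>
    (\<exists>\<mu>. (AE \<omega> in M. X \<omega> = \<mu>) \<or> (\<exists>\<sigma>>0. distributed M lborel X (normal_density \<mu> \<sigma>)))"
proof (cases "v = 0")
  case True
  thus ?thesis using gauss_zero_AE assms by (auto simp: gauss_def intro!: exI[of _ 0])
next
  case False
  hence "0 < v" using assms by (simp add: gauss_def)
  hence "distributed M lborel X (normal_density 0 (sqrt v))" "0 < sqrt v"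
    using gauss_positive_iff_distributed assms by auto
  thus ?thesis using assms unfolding gauss_def by blast
qed

text \<open>
  Convergence in \<open>L\<^sup>2\<close> makes both sides of the defining equation converge: the variances, and by the
  Lipschitz bound for \<open>iexp\<close> the characteristic functions.
\<close>

lemma gauss_L2_limit:
  assumes approx: "\<And>e. 0 < e \<Longrightarrow> \<exists>X v. gauss X v \<and> expectation (\<lambda>x. (X x - Y x)\<^sup>2) < e"
    and [measurable]: "Y \<in> borel_measurable M" and Y2: "integrable M (\<lambda>x. (Y x)\<^sup>2)"
  shows "gauss Y (expectation (\<lambda>x. (Y x)\<^sup>2))"
proof -
  have "\<exists>X v. gauss X v \<and> expectation (\<lambda>x. (X x - Y x)\<^sup>2) < inverse (Suc n)" for n :: nat
    using approx[of "inverse (Suc n)"] by simp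
  then obtain X v where X: "\<And>n. gauss (X n) (v n)"
    "\<And>n::nat. expectation (\<lambda>x. (X n x - Y x)\<^sup>2) < inverse (Suc n)" by metis
  have [measurable]: "X n \<in> borel_measurable M" for n using X(1)[of n] by (simp add: gauss_def)
  define d where "d = (\<lambda>n. expectation (\<lambda>x. (X n x - Y x)\<^sup>2))"
  have d0: "d \<longlonglongrightarrow> 0"
  proof (rule tendsto_sandwich[OF _ _ tendsto_const LIMSEQ_inverse_real_of_nat])
    show "\<forall>\<^sub>F n in sequentially. d n \<le> inverse (real (Suc n))"
      using X(2) by (intro always_eventually allI) (simp add: d_def less_imp_le)
  qed (simp add: d_def)
  have sd0: "(\<lambda>n. sqrt (d n)) \<longlonglongrightarrow> 0" using tendsto_real_sqrt[OF d0] by simp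
  have X2: "integrable M (\<lambda>x. (X n x)\<^sup>2)" for n using gauss_moments(2)[OF X(1)] .
  have D2: "integrable M (\<lambda>x. (X n x - Y x)\<^sup>2)" for n
  proof (rule Bochner_Integration.integrable_bound)
    show "integrable M (\<lambda>x. 2 * (X n x)\<^sup>2 + 2 * (Y x)\<^sup>2)" using X2 Y2 by auto
    have "(X n x - Y x)\<^sup>2 \<le> 2 * (X n x)\<^sup>2 + 2 * (Y x)\<^sup>2" for x
      using zero_le_power2[of "X n x + Y x"] by (simp add: power2_eq_square algebra_simps)
    thus "AE x in M. norm ((X n x - Y x)\<^sup>2) \<le> norm (2 * (X n x)\<^sup>2 + 2 * (Y x)\<^sup>2)"
      by (intro AE_I2) (simp add: order_trans[OF _ abs_ge_self])
  qed measurable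
  define V where "V = expectation (\<lambda>x. (Y x)\<^sup>2)"
  have "(\<lambda>n. v n - V) \<longlonglongrightarrow> 0"
  proof (rule Lim_null_comparison)
    have "\<bar>v n - V\<bar> \<le> d n + 2 * (sqrt (d n) * sqrt V)" for n
    proof -
      have prod: "integrable M (\<lambda>x. (X n x - Y x) * Y x)"
      proof (rule Bochner_Integration.integrable_bound)
        show "integrable M (\<lambda>x. (X n x - Y x)\<^sup>2 + (Y x)\<^sup>2)" using D2 Y2 by auto
        have "\<bar>(X n x - Y x) * Y x\<bar> \<le> (X n x - Y x)\<^sup>2 + (Y x)\<^sup>2" for x
          using sum_squares_bound[of "\<bar>X n x - Y x\<bar>" "\<bar>Y x\<bar>"] zero_le_power2[of "X n x - Y x"]
            zero_le_power2[of "Y x"]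
          unfolding power2_abs abs_mult mult.assoc by linarith
        thus "AE x in M. norm ((X n x - Y x) * Y x) \<le> norm ((X n x - Y x)\<^sup>2 + (Y x)\<^sup>2)"
          by (intro AE_I2) (simp add: order_trans[OF _ abs_ge_self])
      qed measurable
      have e: "(X n x)\<^sup>2 = (X n x - Y x)\<^sup>2 + 2 * ((X n x - Y x) * Y x) + (Y x)\<^sup>2" for x
        by (simp add: power2_eq_square algebra_simps)
      have "v n = expectation (\<lambda>x. (X n x)\<^sup>2)" using gauss_moments(3)[OF X(1)] by simp
      also have "\<dots> = d n + 2 * expectation (\<lambda>x. (X n x - Y x) * Y x) + V"
        unfolding d_def V_def using D2 Y2 prod by (subst e) simp
      finally have "v n = d n + 2 * expectation (\<lambda>x. (X n x - Y x) * Y x) + V" .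
      moreover have "0 \<le> d n" by (simp add: d_def)
      ultimately have "\<bar>v n - V\<bar> \<le> d n + 2 * \<bar>expectation (\<lambda>x. (X n x - Y x) * Y x)\<bar>"
        by linarith
      also have "\<bar>expectation (\<lambda>x. (X n x - Y x) * Y x)\<bar> \<le> sqrt (d n * V)"
        unfolding d_def V_def
        by (rule real_le_rsqrt) (use L2_Cauchy_Schwarz[OF D2 Y2] in simp)
      finally show ?thesis by (simp add: real_sqrt_mult)
    qed
    thus "\<forall>\<^sub>F n in sequentially. norm (v n - V) \<le> d n + 2 * (sqrt (d n) * sqrt V)" by simp
    show "(\<lambda>n. d n + 2 * (sqrt (d n) * sqrt V)) \<longlonglongrightarrow> 0"
      using d0 sd0 by (auto intro!: tendsto_eq_intros)
  qed
  hence vV: "v \<longlonglongrightarrow> V" by (rule LIM_zero_cancel)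
  have "(CLINT x|M. iexp (c * Y x)) = complex_of_real (exp (- (c\<^sup>2 * V) / 2))" for c
  proof (rule LIMSEQ_unique)
    show "(\<lambda>n. complex_of_real (exp (- (c\<^sup>2 * v n) / 2))) \<longlonglongrightarrow> complex_of_real (exp (- (c\<^sup>2 * V) / 2))"
      using vV by (intro tendsto_intros) auto
    have "(\<lambda>n. (CLINT x|M. iexp (c * X n x)) - (CLINT x|M. iexp (c * Y x))) \<longlonglongrightarrow> 0"
    proof (rule Lim_null_comparison)
      have "cmod ((CLINT x|M. iexp (c * X n x)) - (CLINT x|M. iexp (c * Y x))) \<le> \<bar>c\<bar> * sqrt (d n)" for n
      proof -
        have i: "integrable M (\<lambda>x. iexp (c * Z x))" if [measurable]: "Z \<in> borel_measurable M" for Z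
          by (intro integrable_const_bound[of _ 1]) auto
        have iD: "integrable M (\<lambda>x. \<bar>X n x - Y x\<bar>)"
          using integrable_abs[OF square_integrable_imp_integrable[OF _ D2[of n]]] by simp
        have "cmod ((CLINT x|M. iexp (c * X n x)) - (CLINT x|M. iexp (c * Y x))) =
          cmod (CLINT x|M. iexp (c * X n x) - iexp (c * Y x))"
          by (subst Bochner_Integration.integral_diff) (rule i, measurable)+
        also have "\<dots> \<le> (LINT x|M. cmod (iexp (c * X n x) - iexp (c * Y x)))"
          by (rule integral_norm_bound)
        also have "\<dots> \<le> (LINT x|M. \<bar>c\<bar> * \<bar>X n x - Y x\<bar>)"
        proof (rule integral_mono)
          show "integrable M (\<lambda>x. cmod (iexp (c * X n x) - iexp (c * Y x)))"
            by (intro integrable_norm Bochner_Integration.integrable_diff i) auto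
          show "cmod (iexp (c * X n x) - iexp (c * Y x)) \<le> \<bar>c\<bar> * \<bar>X n x - Y x\<bar>" for x
            using cmod_iexp_diff_le[of "c * X n x" "c * Y x"] by (simp add: abs_mult flip: right_diff_distrib)
        qed (use iD in auto)
        also have "\<dots> = \<bar>c\<bar> * (LINT x|M. \<bar>X n x - Y x\<bar>)" by simp
        also have "(LINT x|M. \<bar>X n x - Y x\<bar>) \<le> sqrt (d n)"
          by (rule real_le_rsqrt)
             (use L2_Cauchy_Schwarz[of M "\<lambda>x. \<bar>X n x - Y x\<bar>" "\<lambda>_. 1"] D2 in \<open>simp add: d_def prob_space\<close>)
        finally show ?thesis by (simp add: mult_left_mono)
      qed
      thus "\<forall>\<^sub>F n in sequentially. norm ((CLINT x|M. iexp (c * X n x)) - (CLINT x|M. iexp (c * Y x)))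
          \<le> \<bar>c\<bar> * sqrt (d n)" by (intro always_eventually allI)
      show "(\<lambda>n. \<bar>c\<bar> * sqrt (d n)) \<longlonglongrightarrow> 0" using tendsto_mult_left[OF sd0, of "\<bar>c\<bar>"] by simp
    qed
    hence "(\<lambda>n. CLINT x|M. iexp (c * X n x)) \<longlonglongrightarrow> (CLINT x|M. iexp (c * Y x))" by (rule LIM_zero_cancel)
    moreover have "(CLINT x|M. iexp (c * X n x)) = complex_of_real (exp (- (c\<^sup>2 * v n) / 2))" for n
      using X(1)[of n] unfolding gauss_def by blast
    ultimately show "(\<lambda>n. complex_of_real (exp (- (c\<^sup>2 * v n) / 2))) \<longlonglongrightarrow> (CLINT x|M. iexp (c * Y x))" by simp
  qed
  thus ?thesis by (simp add: gauss_def V_def)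
qed

text \<open>
  Weighting a law by \<open>2 + Re V\<close>, which is positive, turns a statement about the complex measure
  \<open>V dM\<close> into one about probability measures.
\<close>

lemma weighted_law:
  fixes V :: "'a \<Rightarrow> complex"
  assumes [measurable]: "X \<in> borel_measurable M" "V \<in> borel_measurable M"
    and V: "\<And>x. cmod (V x) \<le> 1"
  defines "m \<equiv> expectation (\<lambda>x. 2 + Re (V x))"
  defines "\<mu> \<equiv> distr (density M (\<lambda>x. ennreal ((2 + Re (V x)) / m))) borel X"
  shows "1 \<le> m" "m = 2 + Re (CLINT x|M. V x)" "real_distribution \<mu>"
    "char \<mu> c = (2 * (CLINT x|M. iexp (c * X x)) + ((CLINT x|M. V x * iexp (c * X x)) +
       cnj (CLINT x|M. V x * iexp (- c * X x))) / 2) / complex_of_real m"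
    "A \<in> sets borel \<Longrightarrow> measure \<mu> A =
       (2 * measure (distr M borel X) A + (LINT x|M. Re (V x) * indicator A (X x))) / m"
proof -
  have R: "1 \<le> 2 + Re (V x)" "\<bar>Re (V x)\<bar> \<le> 1" for x
    using V[of x] abs_Re_le_cmod[of "V x"] by linarith+
  have iV: "integrable M (\<lambda>x. V x * g x)" if [measurable]: "g \<in> borel_measurable M" and "\<And>x. cmod (g x) \<le> 1" for g
    by (rule integrable_const_bound[of _ 1]) (use V that in \<open>auto simp: norm_mult intro!: mult_le_one\<close>)
  have iRe: "integrable M (\<lambda>x. Re (V x) * g x)" if [measurable]: "g \<in> borel_measurable M" and "\<And>x. \<bar>g x\<bar> \<le> 1" for g
    by (rule integrable_const_bound[of _ 1]) (use R that in \<open>auto simp: abs_mult intro!: mult_le_one\<close>)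
  have iR: "integrable M (\<lambda>x. Re (V x))" using iRe[of "\<lambda>_. 1"] by simp
  have "expectation (\<lambda>_. 1) \<le> m" unfolding m_def using iR R(1) by (intro integral_mono) auto
  thus m: "1 \<le> m" by (simp add: prob_space)
  show "m = 2 + Re (CLINT x|M. V x)" unfolding m_def using iR iV[of "\<lambda>_. 1"]
    by (simp add: prob_space)
  have nn: "0 \<le> (2 + Re (V x)) / m" for x using R(1)[of x] m by auto
  have I: "(\<integral>y. g y \<partial>\<mu>) = expectation (\<lambda>x. ((2 + Re (V x)) / m) *\<^sub>R g (X x))"
    if [measurable]: "g \<in> borel_measurable borel" for g :: "real \<Rightarrow> 'b :: {banach, second_countable_topology}"
    unfolding \<mu>_def using nn by (subst integral_distr) (auto simp: integral_density)
  have "prob_space (density M (\<lambda>x. ennreal ((2 + Re (V x)) / m)))"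
  proof
    have "(\<integral>\<^sup>+ x. ennreal ((2 + Re (V x)) / m) \<partial>M) = ennreal (expectation (\<lambda>x. (2 + Re (V x)) / m))"
      using iR nn by (intro nn_integral_eq_integral) auto
    also have "expectation (\<lambda>x. (2 + Re (V x)) / m) = 1" using m by (simp flip: m_def)
    finally show "emeasure (density M (\<lambda>x. ennreal ((2 + Re (V x)) / m)))
        (space (density M (\<lambda>x. ennreal ((2 + Re (V x)) / m)))) = 1"
      by (simp add: emeasure_density cong: nn_integral_cong)
  qed
  then interpret D: prob_space "density M (\<lambda>x. ennreal ((2 + Re (V x)) / m))" .
  show rd: "real_distribution \<mu>" unfolding \<mu>_def by (rule D.real_distribution_distr) simp
  then interpret \<mu>: real_distribution \<mu> .
  have "char \<mu> c = (CLINT x|M. ((2 + Re (V x)) / m) *\<^sub>R iexp (c * X x))"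
    unfolding char_def by (rule I) simp
  also have "\<dots> = (CLINT x|M. (2 * iexp (c * X x) + (V x * iexp (c * X x) +
     cnj (V x * iexp (- c * X x))) / 2) / complex_of_real m)"
  proof (rule Bochner_Integration.integral_cong[OF refl])
    fix x
    have 1: "cnj (V x * iexp (- c * X x)) = cnj (V x) * iexp (c * X x)"
      by (simp add: exp_cnj)
    have "V x + cnj (V x) = 2 * complex_of_real (Re (V x))"
      by (simp add: complex_eq_iff)
    hence 2: "V x * iexp (c * X x) + cnj (V x) * iexp (c * X x) = 2 * complex_of_real (Re (V x)) * iexp (c * X x)"
      by (simp flip: distrib_right)
    show "((2 + Re (V x)) / m) *\<^sub>R iexp (c * X x) = (2 * iexp (c * X x) + (V x * iexp (c * X x) +
     cnj (V x * iexp (- c * X x))) / 2) / complex_of_real m"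
      unfolding 1 2 by (simp add: scaleR_conv_of_real add_divide_distrib distrib_right)
  qed
  also have "\<dots> = (2 * (CLINT x|M. iexp (c * X x)) + ((CLINT x|M. V x * iexp (c * X x)) +
       (CLINT x|M. cnj (V x * iexp (- c * X x)))) / 2) / complex_of_real m"
  proof -
    have 1: "integrable M (\<lambda>x. iexp (c * X x))" by (intro integrable_const_bound[of _ 1]) auto
    have 2: "integrable M (\<lambda>x. V x * iexp (c * X x))" for c by (rule iV) auto
    have 3: "integrable M (\<lambda>x. cnj (V x * iexp (- c * X x)))" by (simp only: complex_integrable_cnj 2)
    have "(CLINT x|M. (2 * iexp (c * X x) + (V x * iexp (c * X x) +
         cnj (V x * iexp (- c * X x))) / 2) / complex_of_real m) =
       (CLINT x|M. 2 * iexp (c * X x) + (V x * iexp (c * X x) +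
         cnj (V x * iexp (- c * X x))) / 2) / complex_of_real m" by (rule integral_divide_zero)
    also have "(CLINT x|M. 2 * iexp (c * X x) + (V x * iexp (c * X x) +
         cnj (V x * iexp (- c * X x))) / 2) = (CLINT x|M. 2 * iexp (c * X x)) +
         (CLINT x|M. (V x * iexp (c * X x) + cnj (V x * iexp (- c * X x))) / 2)"
      by (intro Bochner_Integration.integral_add integrable_mult_right integrable_divide_zero
         Bochner_Integration.integrable_add 1 2 3)
    also have "(CLINT x|M. (V x * iexp (c * X x) + cnj (V x * iexp (- c * X x))) / 2) =
        (CLINT x|M. V x * iexp (c * X x) + cnj (V x * iexp (- c * X x))) / 2" by (rule integral_divide_zero)
    also have "(CLINT x|M. V x * iexp (c * X x) + cnj (V x * iexp (- c * X x))) =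
       (CLINT x|M. V x * iexp (c * X x)) + (CLINT x|M. cnj (V x * iexp (- c * X x)))"
      by (intro Bochner_Integration.integral_add 2 3)
    also have "(CLINT x|M. 2 * iexp (c * X x)) = 2 * (CLINT x|M. iexp (c * X x))" by simp
    finally show ?thesis .
  qed
  also have "(CLINT x|M. cnj (V x * iexp (- c * X x))) = cnj (CLINT x|M. V x * iexp (- c * X x))"
    by (rule Bochner_Integration.integral_cnj)
  finally show "char \<mu> c = (2 * (CLINT x|M. iexp (c * X x)) + ((CLINT x|M. V x * iexp (c * X x)) +
       cnj (CLINT x|M. V x * iexp (- c * X x))) / 2) / complex_of_real m" .
  assume [measurable]: "A \<in> sets borel"
  have "measure \<mu> A = (\<integral>y. indicator A y \<partial>\<mu>)" by (simp add: \<mu>.events_eq_borel)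
  also have "\<dots> = expectation (\<lambda>x. ((2 + Re (V x)) / m) *\<^sub>R indicator A (X x))" by (rule I) simp
  also have "\<dots> = expectation (\<lambda>x. (2 * indicator A (X x) + Re (V x) * indicator A (X x)) / m)"
    by (intro Bochner_Integration.integral_cong refl) (simp add: distrib_right add_divide_distrib)
  also have "\<dots> = (2 * expectation (\<lambda>x. indicator A (X x)) + expectation (\<lambda>x. Re (V x) * indicator A (X x))) / m"
  proof -
    have "integrable M (\<lambda>x. indicator A (X x) :: real)" by (intro integrable_const_bound[of _ 1]) auto
    moreover have "integrable M (\<lambda>x. Re (V x) * indicator A (X x))" by (rule iRe) (auto simp: indicator_def)
    ultimately show ?thesis by simp
  qed
  also have "expectation (\<lambda>x. indicator A (X x)) = measure (distr M borel X) A"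
    by (subst integral_distr[symmetric, of X M borel]) auto
  finally show "measure \<mu> A =
       (2 * measure (distr M borel X) A + (LINT x|M. Re (V x) * indicator A (X x))) / m" .
qed

end

lemma weighted_law_unique_Re:
  fixes X :: "'a \<Rightarrow> real" and Y :: "'b \<Rightarrow> real"
  assumes "prob_space M" "prob_space N"
    and "X \<in> borel_measurable M" "Y \<in> borel_measurable N"
    and "V \<in> borel_measurable M" "V' \<in> borel_measurable N" "\<And>x. cmod (V x) \<le> 1" "\<And>x. cmod (V' x) \<le> 1"
    and eq0: "\<And>c. (CLINT x|M. iexp (c * X x)) = (CLINT x|N. iexp (c * Y x))"
    and eq1: "\<And>c. (CLINT x|M. V x * iexp (c * X x)) = (CLINT x|N. V' x * iexp (c * Y x))"
    and A: "A \<in> sets borel"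
  shows "(LINT x|M. Re (V x) * indicator A (X x)) = (LINT x|N. Re (V' x) * indicator A (Y x))"
proof -
  interpret M: prob_space M by fact
  interpret N: prob_space N by fact
  note m = M.weighted_law[OF assms(3,5,7)] and n = N.weighted_law[OF assms(4,6,8)]
  let ?m = "M.expectation (\<lambda>x. 2 + Re (V x))" and ?n = "N.expectation (\<lambda>x. 2 + Re (V' x))"
  have mn: "?m = ?n" unfolding m(2) n(2) using eq1[of 0] by simp
  have "distr (density M (\<lambda>x. ennreal ((2 + Re (V x)) / ?m))) borel X =
     distr (density N (\<lambda>x. ennreal ((2 + Re (V' x)) / ?n))) borel Y"
  proof (rule Levy_uniqueness[OF m(3) n(3)], rule ext)
    fix c
    show "char (distr (density M (\<lambda>x. ennreal ((2 + Re (V x)) / ?m))) borel X) c =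
     char (distr (density N (\<lambda>x. ennreal ((2 + Re (V' x)) / ?n))) borel Y) c"
      unfolding m(4) n(4) unfolding eq0 eq1 mn ..
  qed
  moreover have "distr M borel X = distr N borel Y"
    by (rule Levy_uniqueness) (simp_all add: fun_eq_iff M.char_distr N.char_distr assms eq0 del: of_real_mult)
  ultimately show ?thesis using m(5)[OF A] n(5)[OF A] m(1) mn by simp
qed

text \<open>
  For real and imaginary part separately, the latter being the real part of \<open>- \<i> * V\<close>.
\<close>

lemma weighted_law_unique:
  fixes X :: "'a \<Rightarrow> real" and Y :: "'b \<Rightarrow> real"
  assumes MN: "prob_space M" "prob_space N"
    and [measurable]: "X \<in> borel_measurable M" "Y \<in> borel_measurable N"
      "V \<in> borel_measurable M" "V' \<in> borel_measurable N"
    and V: "\<And>x. cmod (V x) \<le> 1" "\<And>x. cmod (V' x) \<le> 1"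
    and eq0: "\<And>c. (CLINT x|M. iexp (c * X x)) = (CLINT x|N. iexp (c * Y x))"
    and eq1: "\<And>c. (CLINT x|M. V x * iexp (c * X x)) = (CLINT x|N. V' x * iexp (c * Y x))"
    and [measurable]: "A \<in> sets borel"
  shows "(CLINT x|M. V x * complex_of_real (indicator A (X x))) =
         (CLINT x|N. V' x * complex_of_real (indicator A (Y x)))"
proof -
  interpret M: prob_space M by fact
  interpret N: prob_space N by fact
  have iM: "integrable M (\<lambda>x. V x * complex_of_real (indicator A (X x)))"
    by (rule M.integrable_const_bound[of _ 1]) (use V in \<open>auto simp: norm_mult indicator_def\<close>)
  have iN: "integrable N (\<lambda>x. V' x * complex_of_real (indicator A (Y x)))"
    by (rule N.integrable_const_bound[of _ 1]) (use V in \<open>auto simp: norm_mult indicator_def\<close>)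
  have re: "(LINT x|M. Re (V x) * indicator A (X x)) = (LINT x|N. Re (V' x) * indicator A (Y x))"
    by (rule weighted_law_unique_Re[OF MN]) (use V eq0 eq1 in auto)
  have im: "(LINT x|M. Re (- \<i> * V x) * indicator A (X x)) = (LINT x|N. Re (- \<i> * V' x) * indicator A (Y x))"
  proof (rule weighted_law_unique_Re[OF MN])
    show "(CLINT x|M. - \<i> * V x * iexp (c * X x)) = (CLINT x|N. - \<i> * V' x * iexp (c * Y x))" for c
      using eq1[of c] by (simp add: mult.assoc)
  qed (use V eq0 in \<open>auto simp: norm_mult\<close>)
  show ?thesis
  proof (rule complex_eqI)
    show "Re (CLINT x|M. V x * complex_of_real (indicator A (X x))) =
         Re (CLINT x|N. V' x * complex_of_real (indicator A (Y x)))"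
      using re by (simp add: integral_Re[OF iM, symmetric] integral_Re[OF iN, symmetric])
    show "Im (CLINT x|M. V x * complex_of_real (indicator A (X x))) =
         Im (CLINT x|N. V' x * complex_of_real (indicator A (Y x)))"
      using im by (simp add: integral_Im[OF iM, symmetric] integral_Im[OF iN, symmetric])
  qed
qed

text \<open>
  The exponentials are replaced by indicators one coordinate at a time; at each step the other
  factors form the weight in \<open>weighted_law_unique\<close>.  This reduces the Cramer--Wold theorem to the
  uniqueness theorem on the line.
\<close>

lemma joint_cf_determines_rectangles_aux:
  fixes X :: "'i \<Rightarrow> 'a \<Rightarrow> real" and Y :: "'i \<Rightarrow> 'b \<Rightarrow> real"
  assumes MN: "prob_space M" "prob_space N"
    and [measurable]: "\<And>i. X i \<in> borel_measurable M" "\<And>i. Y i \<in> borel_measurable N"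
    and cf: "\<And>F c. finite F \<Longrightarrow>
      (CLINT x|M. iexp (\<Sum>i\<in>F. c i * X i x)) = (CLINT x|N. iexp (\<Sum>i\<in>F. c i * Y i x))"
    and K: "finite K"
  shows "\<lbrakk>finite F; F \<inter> K = {}; \<And>k. k \<in> K \<Longrightarrow> A k \<in> sets borel\<rbrakk> \<Longrightarrow>
    (CLINT x|M. iexp (\<Sum>i\<in>F. c i * X i x) * (\<Prod>k\<in>K. complex_of_real (indicator (A k) (X k x)))) =
    (CLINT x|N. iexp (\<Sum>i\<in>F. c i * Y i x) * (\<Prod>k\<in>K. complex_of_real (indicator (A k) (Y k x))))"
  using K
proof (induction K arbitrary: F c rule: finite_induct)
  case empty
  thus ?case using cf[of F c] by simp
next
  case (insert k K)
  have [measurable]: "A j \<in> sets borel" if "j \<in> insert k K" for j using insert.prems that by blast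
  have [measurable]: "A k \<in> sets borel" by simp
  define V where "V = (\<lambda>x. iexp (\<Sum>i\<in>F. c i * X i x) * (\<Prod>j\<in>K. complex_of_real (indicator (A j) (X j x))))"
  define V' where "V' = (\<lambda>x. iexp (\<Sum>i\<in>F. c i * Y i x) * (\<Prod>j\<in>K. complex_of_real (indicator (A j) (Y j x))))"
  have ind: "cmod (\<Prod>j\<in>K. complex_of_real (indicator (A j) (g j))) \<le> 1" for g :: "'i \<Rightarrow> real"
    unfolding prod_norm[symmetric] by (intro prod_le_1) (auto simp: indicator_def)
  have "(CLINT x|M. V x * complex_of_real (indicator (A k) (X k x))) =
         (CLINT x|N. V' x * complex_of_real (indicator (A k) (Y k x)))"
  proof (rule weighted_law_unique[OF MN])
    show "V \<in> borel_measurable M" "V' \<in> borel_measurable N"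
      unfolding V_def V'_def by measurable
    show "cmod (V x) \<le> 1" for x using ind unfolding V_def by (simp add: norm_mult)
    show "cmod (V' x) \<le> 1" for x using ind unfolding V'_def by (simp add: norm_mult)
    show "(CLINT x|M. iexp (d * X k x)) = (CLINT x|N. iexp (d * Y k x))" for d
      using cf[of "{k}" "\<lambda>_. d"] by simp
    fix d
    have k: "k \<notin> F" using insert.prems by auto
    have s: "(\<Sum>i\<in>insert k F. (c(k := d)) i * g i) = d * g k + (\<Sum>i\<in>F. c i * g i)" for g :: "'i \<Rightarrow> real"
    proof -
      have "(\<Sum>i\<in>F. (c(k := d)) i * g i) = (\<Sum>i\<in>F. c i * g i)"
        using k by (intro sum.cong) auto
      thus ?thesis using k insert.prems(1) by simp
    qed
    have e: "iexp (d * p + q) = iexp q * iexp (d * p)" for p q :: real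
      by (simp add: distrib_left exp_add mult.commute)
    have "(CLINT x|M. iexp (\<Sum>i\<in>insert k F. (c(k := d)) i * X i x) * (\<Prod>j\<in>K. complex_of_real (indicator (A j) (X j x)))) =
        (CLINT x|N. iexp (\<Sum>i\<in>insert k F. (c(k := d)) i * Y i x) * (\<Prod>j\<in>K. complex_of_real (indicator (A j) (Y j x))))"
      using insert.prems insert.hyps by (intro insert.IH) auto
    thus "(CLINT x|M. V x * iexp (d * X k x)) = (CLINT x|N. V' x * iexp (d * Y k x))"
      unfolding s e V_def V'_def by (simp only: mult.assoc mult.commute mult.left_commute)
  qed simp_all
  thus ?case unfolding V_def V'_def using insert.hyps
    by (simp add: mult.assoc mult.commute mult.left_commute)
qed

text \<open>
  Cramer--Wold for arbitrary families: rectangles over finitely many coordinates generate the product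
  sigma-algebra.
\<close>

lemma joint_cf_determines_law:
  fixes X :: "'i \<Rightarrow> 'a \<Rightarrow> real" and Y :: "'i \<Rightarrow> 'b \<Rightarrow> real"
  assumes MN: "prob_space M" "prob_space N"
    and [measurable]: "\<And>i. X i \<in> borel_measurable M" "\<And>i. Y i \<in> borel_measurable N"
    and cf: "\<And>F c. finite F \<Longrightarrow>
      (CLINT x|M. iexp (\<Sum>i\<in>F. c i * X i x)) = (CLINT x|N. iexp (\<Sum>i\<in>F. c i * Y i x))"
  shows "distr M (PiM UNIV (\<lambda>_. borel)) (\<lambda>x i. X i x) = distr N (PiM UNIV (\<lambda>_. borel)) (\<lambda>x i. Y i x)"
proof (rule measure_eqI_PiM_infinite)
  interpret M: prob_space M by fact
  interpret N: prob_space N by fact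
  have mX[measurable]: "(\<lambda>x i. X i x) \<in> measurable M (PiM UNIV (\<lambda>_. borel))"
    by (rule measurable_PiM_single') auto
  have mY[measurable]: "(\<lambda>x i. Y i x) \<in> measurable N (PiM UNIV (\<lambda>_. borel))"
    by (rule measurable_PiM_single') auto
  show "finite_measure (distr M (PiM UNIV (\<lambda>_. borel)) (\<lambda>x i. X i x))"
    using M.prob_space_distr[OF mX] by (simp add: prob_space.finite_measure)
  fix A :: "'i \<Rightarrow> real set" and J :: "'i set"
  assume J: "finite J" and A: "\<And>i. i \<in> J \<Longrightarrow> A i \<in> sets borel"
  let ?E = "prod_emb UNIV (\<lambda>_. borel) J (Pi\<^sub>E J A) :: ('i \<Rightarrow> real) set"
  have E: "?E \<in> sets (PiM UNIV (\<lambda>_. borel))" using A J by (intro sets_PiM_I) auto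
  have mem: "f \<in> ?E \<longleftrightarrow> (\<forall>i\<in>J. f i \<in> A i)" for f
    by (auto simp: prod_emb_def PiE_iff)
  have ind: "(\<Prod>k\<in>J. complex_of_real (indicator (A k) (f k))) = complex_of_real (indicator ?E f)" for f
    using J by (auto simp: indicator_def mem prod_zero_iff intro!: prod.neutral)
  have m: "measure (distr R (PiM UNIV (\<lambda>_. borel)) (\<lambda>x i. Z i x)) ?E =
      (LINT x|R. indicator ?E (\<lambda>i. Z i x))"
    if "(\<lambda>x i. Z i x) \<in> measurable R (PiM UNIV (\<lambda>_. borel))" for R and Z :: "'i \<Rightarrow> 'c \<Rightarrow> real"
    using integral_distr[OF that, of "indicator ?E :: _ \<Rightarrow> real"] E by simp
  have "(CLINT x|M. complex_of_real (indicator ?E (\<lambda>i. X i x))) =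
        (CLINT x|N. complex_of_real (indicator ?E (\<lambda>i. Y i x)))"
    using joint_cf_determines_rectangles_aux[OF MN assms(3,4) cf J, of "{}" A "\<lambda>_. 0"] A
    by (simp add: ind)
  hence "(LINT x|M. indicator ?E (\<lambda>i. X i x) :: real) = (LINT x|N. indicator ?E (\<lambda>i. Y i x))"
    by simp
  hence "measure (distr M (PiM UNIV (\<lambda>_. borel)) (\<lambda>x i. X i x)) ?E =
        measure (distr N (PiM UNIV (\<lambda>_. borel)) (\<lambda>x i. Y i x)) ?E"
    using m[OF mX] m[OF mY] by simp
  thus "emeasure (distr M (PiM UNIV (\<lambda>_. borel)) (\<lambda>x i. X i x)) ?E =
        emeasure (distr N (PiM UNIV (\<lambda>_. borel)) (\<lambda>x i. Y i x)) ?E"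
    using M.prob_space_distr[OF mX] N.prob_space_distr[OF mY]
    by (simp add: finite_measure.emeasure_eq_measure prob_space.finite_measure)
qed simp_all

section \<open>The Fourier transform on square integrable functions: uniqueness\<close>

lemma fourier_borel_measurable [measurable]:
  assumes [measurable]: "f \<in> borel_measurable borel"
  shows "fourier f \<in> borel_measurable borel"
  unfolding fourier_def by measurable

lemma cmod_exp_i [simp]: "cmod (exp (- \<i> * complex_of_real r)) = 1" "cmod (exp (\<i> * complex_of_real r)) = 1"
  by (simp_all add: norm_exp_eq_Re)

lemma cmod_fourier_le:
  assumes "integrable lborel f"
  shows "cmod (fourier f l) \<le> (LINT x|lborel. cmod (f x))"
proof -
  have "cmod (fourier f l) \<le> (LINT x|lborel. cmod (exp (- \<i> * complex_of_real (l * x)) * f x))"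
    unfolding fourier_def by (rule integral_norm_bound)
  thus ?thesis by (simp add: norm_mult del: of_real_mult)
qed

lemma integrable_bounded_mult:
  fixes f g :: "'a \<Rightarrow> complex"
  assumes "integrable M f" "g \<in> borel_measurable M" "\<And>x. cmod (g x) \<le> C"
  shows "integrable M (\<lambda>x. g x * f x)"
proof (rule Bochner_Integration.integrable_bound)
  show "integrable M (\<lambda>x. C * cmod (f x))" using assms(1) by auto
  show "(\<lambda>x. g x * f x) \<in> borel_measurable M" using assms by auto
  have "cmod (g x) * cmod (f x) \<le> C * cmod (f x)" for x
    using assms(3) by (intro mult_right_mono) auto
  thus "AE x in M. norm (g x * f x) \<le> norm (C * cmod (f x))"
    by (intro AE_I2) (simp add: norm_mult order_trans[OF _ abs_ge_self])
qed

lemma fourier_duality: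
  assumes f: "integrable lborel f" and g: "integrable lborel g"
  shows "(LINT l|lborel. fourier f l * g l) = (LINT x|lborel. f x * fourier g x)"
proof -
  have [measurable]: "f \<in> borel_measurable borel" "g \<in> borel_measurable borel"
    using f g borel_measurable_integrable by fastforce+
  define k where "k = (\<lambda>x l. exp (- \<i> * complex_of_real (l * x)) * f x * g l)"
  have "integrable (lborel \<Otimes>\<^sub>M lborel) (\<lambda>(x, l). k x l)"
  proof (rule lborel_pair.Fubini_integrable)
    show "(\<lambda>(x, l). k x l) \<in> borel_measurable (lborel \<Otimes>\<^sub>M lborel)"
      unfolding k_def by measurable
    have "(\<lambda>x. LINT y|lborel. norm (case (x, y) of (x, l) \<Rightarrow> k x l)) =
      (\<lambda>x. cmod (f x) * (LINT y|lborel. cmod (g y)))"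
      by (simp add: k_def norm_mult del: of_real_mult)
    thus "integrable lborel (\<lambda>x. LINT y|lborel. norm (case (x, y) of (x, l) \<Rightarrow> k x l))"
      using f by auto
    have "integrable lborel (\<lambda>l. (exp (- \<i> * complex_of_real (l * x)) * f x) * g l)" for x
      by (rule integrable_bounded_mult[OF g, of _ "cmod (f x)"]) (auto simp: norm_mult simp del: of_real_mult)
    thus "AE x in lborel. integrable lborel (\<lambda>y. case (x, y) of (x, l) \<Rightarrow> k x l)"
      by (simp add: k_def)
  qed
  from lborel_pair.Fubini_integral[OF this]
  have "(LINT l|lborel. LINT x|lborel. k x l) = (LINT x|lborel. LINT l|lborel. k x l)" .
  moreover have "(LINT x|lborel. k x l) = fourier f l * g l" for l
    unfolding k_def fourier_def by simp
  moreover have "(LINT l|lborel. k x l) = f x * fourier g x" for x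
  proof -
    have "(LINT l|lborel. k x l) = (LINT l|lborel. f x * (exp (- \<i> * complex_of_real (x * l)) * g l))"
      unfolding k_def by (intro Bochner_Integration.integral_cong refl) (simp add: ac_simps)
    thus ?thesis by (simp add: fourier_def)
  qed
  ultimately show ?thesis by simp
qed

lemma square_integrable_mult_integrable:
  assumes "square_integrable f" "square_integrable g"
  shows "integrable lborel (\<lambda>x. f x * g x)"
proof -
  have [measurable]: "f \<in> borel_measurable borel" "g \<in> borel_measurable borel"
    using assms by (auto simp: square_integrable_def)
  have "integrable lborel (\<lambda>x. cmod (f x) * cmod (g x))"
    by (rule integrable_mult_of_squares) (use assms in \<open>auto simp: square_integrable_def\<close>)
  thus ?thesis by (rule Bochner_Integration.integrable_bound) (auto simp: norm_mult)
qed

lemma square_integrable_mono: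
  assumes "integrable lborel (b :: real \<Rightarrow> real)" "f \<in> borel_measurable borel" "\<And>x. (cmod (f x))\<^sup>2 \<le> b x"
  shows "square_integrable f"
  unfolding square_integrable_def
proof
  show "f \<in> borel_measurable lborel" using assms(2) by simp
  show "integrable lborel (\<lambda>x. (cmod (f x))\<^sup>2)"
    by (rule Bochner_Integration.integrable_bound[OF assms(1)])
       (use assms(2,3) in \<open>auto intro: order_trans[OF _ abs_ge_self]\<close>)
qed

lemma square_integrable_diff:
  assumes "square_integrable f" "square_integrable g"
  shows "square_integrable (\<lambda>x. f x - g x)"
proof (rule square_integrable_mono)
  show "integrable lborel (\<lambda>x. 2 * (cmod (f x))\<^sup>2 + 2 * (cmod (g x))\<^sup>2)"
    using assms by (auto simp: square_integrable_def)
  show "(\<lambda>x. f x - g x) \<in> borel_measurable borel" using assms by (auto simp: square_integrable_def)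
  show "(cmod (f x - g x))\<^sup>2 \<le> 2 * (cmod (f x))\<^sup>2 + 2 * (cmod (g x))\<^sup>2" for x
  proof -
    have "(cmod (f x - g x))\<^sup>2 \<le> (cmod (f x) + cmod (g x))\<^sup>2"
      by (intro power_mono norm_triangle_ineq4) auto
    also have "\<dots> \<le> 2 * (cmod (f x))\<^sup>2 + 2 * (cmod (g x))\<^sup>2"
      using sum_squares_bound[of "cmod (f x)" "cmod (g x)"] by (simp add: power2_sum)
    finally show ?thesis .
  qed
qed

lemma integral_L2_null_sequence:
  assumes [measurable]: "\<And>n. u n \<in> borel_measurable lborel" and w: "square_integrable w"
    and lim: "(\<lambda>n. \<integral>\<^sup>+ x. ennreal ((cmod (u n x))\<^sup>2) \<partial>lborel) \<longlonglongrightarrow> 0"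
  shows "(\<lambda>n::nat. LINT x|lborel. u n x * w x) \<longlonglongrightarrow> 0"
proof -
  have [measurable]: "w \<in> borel_measurable borel" using w by (auto simp: square_integrable_def)
  define C where "C = (\<integral>\<^sup>+ x. ennreal ((cmod (w x))\<^sup>2) \<partial>lborel)"
  have C: "C < top" using w unfolding C_def square_integrable_def
    by (subst nn_integral_eq_integral) auto
  have bound: "ennreal ((cmod (LINT x|lborel. u n x * w x))\<^sup>2) \<le>
     (\<integral>\<^sup>+ x. ennreal ((cmod (u n x))\<^sup>2) \<partial>lborel) * C" for n
  proof -
    have "ennreal (cmod (LINT x|lborel. u n x * w x)) \<le> (\<integral>\<^sup>+ x. ennreal (cmod (u n x)) * ennreal (cmod (w x)) \<partial>lborel)"
    proof (cases "integrable lborel (\<lambda>x. u n x * w x)")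
      case True
      from integral_norm_bound_ennreal[OF this] show ?thesis
        by (simp add: norm_mult ennreal_mult)
    qed (simp add: not_integrable_integral_eq)
    hence "(ennreal (cmod (LINT x|lborel. u n x * w x)))\<^sup>2 \<le>
      (\<integral>\<^sup>+ x. ennreal (cmod (u n x)) * ennreal (cmod (w x)) \<partial>lborel)\<^sup>2"
      by (intro power_mono) auto
    also have "\<dots> \<le> (\<integral>\<^sup>+ x. (ennreal (cmod (u n x)))\<^sup>2 \<partial>lborel) * (\<integral>\<^sup>+ x. (ennreal (cmod (w x)))\<^sup>2 \<partial>lborel)"
      by (rule Cauchy_Schwarz_nn_integral) measurable
    finally show ?thesis by (simp add: ennreal_power C_def)
  qed
  have L: "(\<lambda>n. (\<integral>\<^sup>+ x. ennreal ((cmod (u n x))\<^sup>2) \<partial>lborel) * C) \<longlonglongrightarrow> 0 * C"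
    using ennreal_tendsto_cmult[OF C lim] by (simp add: mult.commute)
  have "(\<lambda>n. ennreal ((cmod (LINT x|lborel. u n x * w x))\<^sup>2)) \<longlonglongrightarrow> 0"
  proof (rule tendsto_sandwich[where f = "\<lambda>_. 0" and h = "\<lambda>n. (\<integral>\<^sup>+ x. ennreal ((cmod (u n x))\<^sup>2) \<partial>lborel) * C"])
    show "(\<lambda>n. (\<integral>\<^sup>+ x. ennreal ((cmod (u n x))\<^sup>2) \<partial>lborel) * C) \<longlonglongrightarrow> 0" using L by simp
    show "\<forall>\<^sub>F n in sequentially. 0 \<le> ennreal ((cmod (LINT x|lborel. u n x * w x))\<^sup>2)" by simp
    show "\<forall>\<^sub>F n in sequentially. ennreal ((cmod (LINT x|lborel. u n x * w x))\<^sup>2) \<le>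
        (\<integral>\<^sup>+ x. ennreal ((cmod (u n x))\<^sup>2) \<partial>lborel) * C"
      using bound by (intro always_eventually allI)
  qed simp
  hence "(\<lambda>n. ennreal ((cmod (LINT x|lborel. u n x * w x))\<^sup>2)) \<longlonglongrightarrow> ennreal 0" by simp
  hence "(\<lambda>n. (cmod (LINT x|lborel. u n x * w x))\<^sup>2) \<longlonglongrightarrow> 0"
    by (subst (asm) tendsto_ennreal_iff) auto
  hence "(\<lambda>n. cmod (LINT x|lborel. u n x * w x)) \<longlonglongrightarrow> 0"
    using tendsto_real_sqrt by fastforce
  thus ?thesis by (rule tendsto_norm_zero_cancel)
qed

text \<open>
  Fubini gives the identity for integrable functions, and both sides are continuous in \<open>L\<^sup>2\<close>.  Every
  property of the extended transform used below comes from a choice of the test function \<open>w\<close>.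
\<close>

lemma l2_fourier_duality:
  assumes fg: "l2_fourier f g" and w: "integrable lborel w" "square_integrable w" "square_integrable (fourier w)"
  shows "(LINT l|lborel. g l * w l) = (LINT x|lborel. f x * fourier w x)"
proof -
  have f: "square_integrable f" and g: "square_integrable g" using fg by (auto simp: l2_fourier_def)
  obtain \<phi> where \<phi>: "\<And>n::nat. integrable lborel (\<phi> n)" "\<And>n. square_integrable (\<phi> n)"
     "(\<lambda>n. \<integral>\<^sup>+ x. ennreal ((cmod (\<phi> n x - f x))\<^sup>2) \<partial>lborel) \<longlonglongrightarrow> 0"
     "(\<lambda>n. \<integral>\<^sup>+ l. ennreal ((cmod (fourier (\<phi> n) l - g l))\<^sup>2) \<partial>lborel) \<longlonglongrightarrow> 0"
    using fg unfolding l2_fourier_def by blast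
  have [measurable]: "f \<in> borel_measurable borel" "g \<in> borel_measurable borel" "w \<in> borel_measurable borel"
     "\<And>n. \<phi> n \<in> borel_measurable borel"
    using f g w \<phi>(2) by (auto simp: square_integrable_def)
  have "(\<lambda>n. (LINT l|lborel. fourier (\<phi> n) l * w l) - (LINT l|lborel. g l * w l)) \<longlonglongrightarrow> 0"
  proof -
    have "integrable lborel (\<lambda>l. fourier (\<phi> n) l * w l)" for n
      by (rule integrable_bounded_mult[OF w(1) _ cmod_fourier_le[OF \<phi>(1)]]) simp
    hence "(LINT l|lborel. fourier (\<phi> n) l * w l) - (LINT l|lborel. g l * w l) =
       (LINT l|lborel. (fourier (\<phi> n) l - g l) * w l)" for n
      using square_integrable_mult_integrable[OF g w(2)]
      by (subst Bochner_Integration.integral_diff[symmetric]) (auto simp: left_diff_distrib)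
    moreover have "(\<lambda>n. (LINT l|lborel. (fourier (\<phi> n) l - g l) * w l)) \<longlonglongrightarrow> 0"
      by (rule integral_L2_null_sequence[OF _ w(2) \<phi>(4)]) measurable
    ultimately show ?thesis by simp
  qed
  moreover have "(\<lambda>n. (LINT x|lborel. \<phi> n x * fourier w x) - (LINT x|lborel. f x * fourier w x)) \<longlonglongrightarrow> 0"
  proof -
    have "(LINT x|lborel. \<phi> n x * fourier w x) - (LINT x|lborel. f x * fourier w x) =
       (LINT x|lborel. (\<phi> n x - f x) * fourier w x)" for n
      using square_integrable_mult_integrable[OF f w(3)] square_integrable_mult_integrable[OF \<phi>(2) w(3)]
      by (subst Bochner_Integration.integral_diff[symmetric]) (auto simp: left_diff_distrib)
    moreover have "(\<lambda>n. (LINT x|lborel. (\<phi> n x - f x) * fourier w x)) \<longlonglongrightarrow> 0"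
      by (rule integral_L2_null_sequence[OF _ w(3) \<phi>(3)]) measurable
    ultimately show ?thesis by simp
  qed
  moreover have "(LINT l|lborel. fourier (\<phi> n) l * w l) = (LINT x|lborel. \<phi> n x * fourier w x)" for n
    by (rule fourier_duality[OF \<phi>(1) w(1)])
  ultimately have "(\<lambda>n. LINT x|lborel. \<phi> n x * fourier w x) \<longlonglongrightarrow> (LINT l|lborel. g l * w l)"
    "(\<lambda>n. LINT x|lborel. \<phi> n x * fourier w x) \<longlonglongrightarrow> (LINT x|lborel. f x * fourier w x)"
    by (auto dest: LIM_zero_cancel)
  thus ?thesis by (rule LIMSEQ_unique)
qed

lemma integrable_inverse_one_plus_square: "integrable lborel (\<lambda>x::real. inverse (1 + x\<^sup>2))"
  using integrable_inverse_1_plus_square by (simp add: set_integrable_def)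

text \<open>
  The transform of an indicator is bounded, and by integrating the exponential it is also bounded by
  \<open>2 / |x|\<close>.
\<close>

lemma square_integrable_fourier_indicator:
  fixes a b :: real
  assumes "a \<le> b"
  shows "square_integrable (fourier (\<lambda>x. complex_of_real (indicator {a..b} x)))"
proof -
  let ?w = "\<lambda>x. complex_of_real (indicator {a..b} x)"
  have w: "integrable lborel ?w" by (rule integrable_of_real, rule integrable_real_indicator) (auto simp: emeasure_lborel_Icc_eq)
  have b1: "cmod (fourier ?w x) \<le> b - a" for x
    using cmod_fourier_le[OF w, of x] assms by simp
  have b2: "\<bar>x\<bar> * cmod (fourier ?w x) \<le> 2" for x
  proof -
    have "(LINT l|lborel. indicator {a..b} l *\<^sub>R ((- \<i> * complex_of_real x) * exp (- \<i> * complex_of_real (x * l)))) =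
        exp (- \<i> * complex_of_real (x * b)) - exp (- \<i> * complex_of_real (x * a))"
    proof (rule integral_FTC_atLeastAtMost[OF assms])
      fix l
      have "((\<lambda>l. exp (- \<i> * complex_of_real x * l)) has_field_derivative
         (- \<i> * complex_of_real x) * exp (- \<i> * complex_of_real x * complex_of_real l)) (at (complex_of_real l))"
        by (auto intro!: derivative_eq_intros)
      from has_vector_derivative_real_field[OF this]
      show "((\<lambda>l. exp (- \<i> * complex_of_real (x * l))) has_vector_derivative
         - \<i> * complex_of_real x * exp (- \<i> * complex_of_real (x * l))) (at l within {a..b})"
        by (simp add: mult.assoc)
    qed (intro continuous_intros)
    moreover have "(LINT l|lborel. indicator {a..b} l *\<^sub>R ((- \<i> * complex_of_real x) * exp (- \<i> * complex_of_real (x * l))))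
       = (- \<i> * complex_of_real x) * fourier ?w x"
      unfolding fourier_def integral_mult_right_zero[symmetric]
      by (intro Bochner_Integration.integral_cong refl) (simp add: scaleR_conv_of_real ac_simps)
    ultimately have "cmod ((- \<i> * complex_of_real x) * fourier ?w x) \<le> 1 + 1"
      by (metis cmod_exp_i(1) norm_triangle_ineq4)
    thus ?thesis by (simp add: norm_mult)
  qed
  show ?thesis
  proof (rule square_integrable_mono)
    show "integrable lborel (\<lambda>x. ((b - a)\<^sup>2 + 4) * inverse (1 + x\<^sup>2))"
      by (intro integrable_mult_right integrable_inverse_one_plus_square)
    show "fourier ?w \<in> borel_measurable borel" by measurable
    fix x :: real
    have "(cmod (fourier ?w x))\<^sup>2 * (1 + x\<^sup>2) = (cmod (fourier ?w x))\<^sup>2 + (\<bar>x\<bar> * cmod (fourier ?w x))\<^sup>2"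
      by (simp add: power_mult_distrib algebra_simps)
    also have "\<dots> \<le> (b - a)\<^sup>2 + 2\<^sup>2" using b1[of x] b2[of x] by (intro add_mono power_mono) auto
    finally have "(cmod (fourier ?w x))\<^sup>2 * (1 + x\<^sup>2) \<le> (b - a)\<^sup>2 + 4" by simp
    moreover have "0 < 1 + x\<^sup>2" by (simp add: add_pos_nonneg)
    ultimately show "(cmod (fourier ?w x))\<^sup>2 \<le> ((b - a)\<^sup>2 + 4) * inverse (1 + x\<^sup>2)"
      by (simp add: divide_inverse[symmetric] pos_le_divide_eq)
  qed
qed

lemma AE_zero_if_half_line_integrals_zero:
  fixes f :: "real \<Rightarrow> real"
  assumes i: "integrable lborel f" and z: "\<And>x. (LINT l|lborel. indicator {x<..} l * f l) = 0"
  shows "AE l in lborel. f l = 0"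
proof -
  have [measurable]: "f \<in> borel_measurable borel" using i by auto
  define p where "p = (\<lambda>l. max (f l) 0)"
  define m where "m = (\<lambda>l. max (- f l) 0)"
  have ip: "integrable lborel p" and im: "integrable lborel m"
    unfolding p_def m_def using i by auto
  have [measurable]: "p \<in> borel_measurable borel" "m \<in> borel_measurable borel"
    unfolding p_def m_def by measurable
  have pos: "0 \<le> p l" "0 \<le> m l" for l by (auto simp: p_def m_def)
  have ind: "integrable lborel (\<lambda>l. indicator {x<..} l * p l)" "integrable lborel (\<lambda>l. indicator {x<..} l * m l)" for x
    using integrable_real_mult_indicator[OF _ ip, of "{x<..}"] integrable_real_mult_indicator[OF _ im, of "{x<..}"]
    by (simp_all add: mult.commute borel_open[OF open_greaterThan])
  have e: "emeasure (density lborel (\<lambda>l. ennreal (q l))) {x<..} = ennreal (LINT l|lborel. indicator {x<..} l * q l)"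
    if [measurable]: "q \<in> borel_measurable borel" and "integrable lborel (\<lambda>l. indicator {x<..} l * q l)" "\<And>l. 0 \<le> q l" for q :: "real \<Rightarrow> real" and x
  proof -
    have "emeasure (density lborel (\<lambda>l. ennreal (q l))) {x<..} = (\<integral>\<^sup>+ l. ennreal (indicator {x<..} l * q l) \<partial>lborel)"
      by (subst emeasure_density) (auto intro!: nn_integral_cong simp: indicator_def)
    also have "\<dots> = ennreal (LINT l|lborel. indicator {x<..} l * q l)"
      using that by (intro nn_integral_eq_integral) auto
    finally show ?thesis .
  qed
  have "density lborel (\<lambda>l. ennreal (p l)) = density lborel (\<lambda>l. ennreal (m l))"
  proof (rule measure_eqI_lessThan)
    fix x
    show "emeasure (density lborel (\<lambda>l. ennreal (p l))) {x<..} < \<infinity>"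
      using e[of p x] ind pos by simp
    have "f = (\<lambda>l. p l - m l)" by (auto simp: p_def m_def)
    hence "(LINT l|lborel. indicator {x<..} l * p l) - (LINT l|lborel. indicator {x<..} l * m l) = 0"
      using z[of x] ind[of x] by (simp add: right_diff_distrib)
    thus "emeasure (density lborel (\<lambda>l. ennreal (p l))) {x<..} = emeasure (density lborel (\<lambda>l. ennreal (m l))) {x<..}"
      using e[of p x] e[of m x] ind pos by simp
  qed auto
  moreover have "(\<integral>\<^sup>+ l. ennreal (p l) \<partial>lborel) \<noteq> \<infinity>"
    using ip pos by (subst nn_integral_eq_integral) auto
  ultimately have "AE l in lborel. ennreal (p l) = ennreal (m l)"
    by (subst (asm) finite_density_unique) auto
  thus ?thesis by eventually_elim (use pos in \<open>auto simp: p_def m_def max_def split: if_splits\<close>)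
qed

text \<open>
  Testing with indicators of intervals shows that the difference of two versions has integral zero
  over every bounded interval.
\<close>

theorem l2_fourier_unique:
  assumes "l2_fourier f g" "l2_fourier f g'"
  shows "AE l in lborel. g l = g' l"
proof -
  have sq: "square_integrable g" "square_integrable g'" using assms by (auto simp: l2_fourier_def)
  define d where "d = (\<lambda>l. g l - g' l)"
  have sd: "square_integrable d" unfolding d_def by (rule square_integrable_diff[OF sq])
  have [measurable]: "g \<in> borel_measurable borel" "g' \<in> borel_measurable borel" "d \<in> borel_measurable borel"
    using sq sd by (auto simp: square_integrable_def)
  have si: "square_integrable (\<lambda>x. complex_of_real (indicator {a..b} x))" for a b :: real
  proof -
    have "(\<lambda>x. (cmod (complex_of_real (indicator {a..b} x)))\<^sup>2) = indicator {a..b}"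
      by (auto simp: indicator_def)
    thus ?thesis unfolding square_integrable_def
      by (auto intro!: integrable_real_indicator simp: emeasure_lborel_Icc_eq)
  qed
  have id: "integrable lborel (\<lambda>l. d l * complex_of_real (indicator {a..b} l))" for a b
    by (rule square_integrable_mult_integrable[OF sd si])
  have Z: "(LINT l|lborel. d l * complex_of_real (indicator {a..b} l)) = 0" for a b
  proof (cases "a \<le> b")
    case True
    have i: "integrable lborel (\<lambda>x. complex_of_real (indicator {a..b} x))" by (rule integrable_of_real, rule integrable_real_indicator) (auto simp: emeasure_lborel_Icc_eq)
    have "(LINT l|lborel. g l * complex_of_real (indicator {a..b} l)) = (LINT l|lborel. g' l * complex_of_real (indicator {a..b} l))"
      using l2_fourier_duality[OF assms(1) i si square_integrable_fourier_indicator[OF True]]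
        l2_fourier_duality[OF assms(2) i si square_integrable_fourier_indicator[OF True]] by simp
    thus ?thesis unfolding d_def left_diff_distrib
      using square_integrable_mult_integrable[OF sq(1) si] square_integrable_mult_integrable[OF sq(2) si]
      by (subst Bochner_Integration.integral_diff) auto
  qed simp
  have main: "AE l in lborel. c (d l) * indicator {- real N..real N} l = 0"
    if c: "bounded_linear c" for c :: "complex \<Rightarrow> real" and N :: nat
  proof (rule AE_zero_if_half_line_integrals_zero)
    interpret bounded_linear c by fact
    have cz: "c (z * complex_of_real r) = c z * r" for z r
      by (metis mult.commute scaleR real_scaleR_def scaleR_conv_of_real)
    have I: "integrable lborel (\<lambda>l. c (d l) * indicator {a..b} l)" "(LINT l|lborel. c (d l) * indicator {a..b} l) = 0" for a b
      using integrable_bounded_linear[OF c id[of a b]] integral_bounded_linear[OF c id[of a b]] Z[of a b]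
      by (simp_all add: cz zero)
    show "integrable lborel (\<lambda>l. c (d l) * indicator {- real N..real N} l)" by (rule I)
    fix x :: real
    have "AE l in lborel. l \<noteq> x" by (rule AE_lborel_singleton)
    hence "AE l in lborel. indicator {x<..} l * (c (d l) * indicator {- real N..real N} l) =
        c (d l) * indicator {max x (- real N)..real N} l"
      by eventually_elim (auto simp: indicator_def)
    moreover have "c \<in> borel_measurable borel"
      by (intro borel_measurable_continuous_onI continuous_on continuous_on_id)
    note [measurable] = measurable_compose[OF _ this]
    ultimately have "(LINT l|lborel. indicator {x<..} l * (c (d l) * indicator {- real N..real N} l)) =
        (LINT l|lborel. c (d l) * indicator {max x (- real N)..real N} l)"
      by (intro integral_cong_AE) auto
    thus "(LINT l|lborel. indicator {x<..} l * (c (d l) * indicator {- real N..real N} l)) = 0"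
      using I(2) by simp
  qed
  have "AE l in lborel. \<forall>N::nat. Re (d l) * indicator {- real N..real N} l = 0 \<and>
      Im (d l) * indicator {- real N..real N} l = 0"
    using main[OF bounded_linear_Re] main[OF bounded_linear_Im] by (simp add: AE_all_countable)
  thus ?thesis
  proof eventually_elim
    case (elim l)
    obtain N :: nat where "\<bar>l\<bar> \<le> N" using real_arch_simple by blast
    hence "indicator {- real N..real N} l = (1::real)" by (auto simp: indicator_def)
    hence "d l = 0" using elim[rule_format, of N] by (simp add: complex_eq_iff)
    thus ?case by (simp add: d_def)
  qed
qed

section \<open>Fourier inversion and the phase shifts of the kernel\<close>

lemma fourier_scaled_gaussian:
  assumes "0 < e"
  shows "fourier (\<lambda>l. exp (\<i> * complex_of_real (l * t)) * complex_of_real (std_normal_density (e * l) / sqrt (2 * pi))) x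
     = complex_of_real (std_normal_density ((x - t) / e) / e)"
proof -
  let ?n = std_normal_density
  have "fourier (\<lambda>l. exp (\<i> * complex_of_real (l * t)) * complex_of_real (?n (e * l) / sqrt (2 * pi))) x
     = (LINT l|lborel. exp (\<i> * complex_of_real (l * (t - x))) * complex_of_real (?n (e * l) / sqrt (2 * pi)))"
    unfolding fourier_def
  proof (intro Bochner_Integration.integral_cong refl)
    fix l
    have "exp (- \<i> * complex_of_real (x * l)) * exp (\<i> * complex_of_real (l * t)) = exp (\<i> * complex_of_real (l * (t - x)))"
      by (simp add: exp_add[symmetric] algebra_simps)
    thus "exp (- \<i> * complex_of_real (x * l)) * (exp (\<i> * complex_of_real (l * t)) * complex_of_real (?n (e * l) / sqrt (2 * pi)))
      = exp (\<i> * complex_of_real (l * (t - x))) * complex_of_real (?n (e * l) / sqrt (2 * pi))"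
      by (simp only: mult.assoc[symmetric])
  qed
  also have "\<dots> = \<bar>inverse e\<bar> *\<^sub>R (LINT y|lborel. exp (\<i> * complex_of_real ((0 + inverse e * y) * (t - x))) * complex_of_real (?n (e * (0 + inverse e * y)) / sqrt (2 * pi)))"
    using assms by (intro lborel_integral_real_affine) auto
  also have "(LINT y|lborel. exp (\<i> * complex_of_real ((0 + inverse e * y) * (t - x))) * complex_of_real (?n (e * (0 + inverse e * y)) / sqrt (2 * pi)))
     = (LINT y|lborel. ?n y *\<^sub>R iexp ((t - x) / e * y)) / complex_of_real (sqrt (2 * pi))"
    unfolding integral_divide_zero[symmetric]
    using assms by (intro Bochner_Integration.integral_cong refl) (simp add: scaleR_conv_of_real field_simps)
  also have "(LINT y|lborel. ?n y *\<^sub>R iexp ((t - x) / e * y)) = char std_normal_distribution ((t - x) / e)"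
    unfolding char_def by (subst integral_density) auto
  also have "\<dots> = complex_of_real (exp (- (((t - x) / e)\<^sup>2) / 2))" by (simp only: char_std_normal_distribution)
  also have "((t - x) / e)\<^sup>2 = ((x - t) / e)\<^sup>2" by (simp add: power_divide power2_commute)
  also have "\<bar>inverse e\<bar> *\<^sub>R (complex_of_real (exp (- (((x - t) / e)\<^sup>2) / 2)) / complex_of_real (sqrt (2 * pi)))
     = complex_of_real (?n ((x - t) / e) / e)"
    using assms by (simp add: normal_density_def scaleR_conv_of_real field_simps)
  finally show ?thesis .
qed

lemma integrable_std_normal_affine:
  assumes "e \<noteq> 0"
  shows "integrable lborel (\<lambda>x. std_normal_density (e * x + c))"
  using lborel_integrable_real_affine[OF integrable_std_normal_moment[of 0], of e c] assms
  by (simp add: add.commute)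

lemma std_normal_density_le_1: "std_normal_density x \<le> 1"
proof -
  have "1 \<le> sqrt (2 * pi)" using pi_gt3 by (intro real_le_rsqrt) simp
  moreover have "exp (- x\<^sup>2 / 2) \<le> 1" by simp
  ultimately have "exp (- x\<^sup>2 / 2) / sqrt (2 * pi) \<le> 1 / 1" by (intro frac_le) auto
  thus ?thesis by (simp add: normal_density_def)
qed

lemma std_normal_density_square_le: "(std_normal_density x)\<^sup>2 \<le> std_normal_density x"
  using std_normal_density_le_1[of x] normal_density_nonneg[of 0 1 x]
  by (simp add: power2_eq_square mult_left_le)

text \<open>
  Testing with \<open>exp (\<i> l t)\<close> times a Gaussian of width \<open>1 / e\<close> turns one side of the duality into an
  average of the path over a neighbourhood of \<open>t\<close> of size \<open>e\<close>, and the other into a regularised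
  inversion integral; then \<open>e\<close> tends to \<open>0\<close>.
\<close>

theorem l2_fourier_inversion:
  assumes fg: "l2_fourier (\<lambda>x. complex_of_real (upath_apply h x)) g" and g: "integrable lborel g"
  shows "complex_of_real (upath_apply h t) =
     (LINT l|lborel. g l * exp (\<i> * complex_of_real (l * t))) / complex_of_real (2 * pi)"
proof -
  let ?n = std_normal_density and ?h = "upath_apply h"
  define w where "w = (\<lambda>e l. exp (\<i> * complex_of_real (l * t)) * complex_of_real (?n (e * l) / sqrt (2 * pi)))"
  have [measurable]: "?h \<in> borel_measurable borel"
    by (rule borel_measurable_continuous_onI[OF upath_continuous])
  have [measurable]: "g \<in> borel_measurable borel" using g by auto
  have key: "(LINT l|lborel. g l * w e l) = complex_of_real (LINT y|lborel. ?h (t + e * y) * ?n y)"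
    if e: "0 < e" for e
  proof -
    have [measurable]: "w e \<in> borel_measurable borel" unfolding w_def by measurable
    have norm_w: "cmod (w e l) = ?n (e * l) / sqrt (2 * pi)" for l
      by (simp add: w_def norm_mult norm_divide del: of_real_mult of_real_divide)
    have i: "integrable lborel (\<lambda>l. ?n (e * l) / sqrt (2 * pi))"
      using integrable_std_normal_affine[of e 0] e by simp
    have "integrable lborel (w e)"
      by (rule Bochner_Integration.integrable_bound[OF i]) (auto simp: norm_w)
    moreover have "square_integrable (w e)"
    proof (rule square_integrable_mono)
      show "integrable lborel (\<lambda>l. ?n (e * l) / (2 * pi))"
        using integrable_std_normal_affine[of e 0] e by simp
      show "(cmod (w e l))\<^sup>2 \<le> ?n (e * l) / (2 * pi)" for l
        using std_normal_density_square_le[of "e * l"] by (simp add: norm_w power_divide divide_right_mono)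
    qed measurable
    moreover have F: "fourier (w e) x = complex_of_real (?n ((x - t) / e) / e)" for x
      unfolding w_def by (rule fourier_scaled_gaussian[OF e])
    have "square_integrable (fourier (w e))"
    proof (rule square_integrable_mono)
      have "(\<lambda>x. ?n (inverse e * x + (- t / e)) / e\<^sup>2) = (\<lambda>x. ?n ((x - t) / e) / e\<^sup>2)"
        using e by (intro ext) (simp add: field_simps)
      thus "integrable lborel (\<lambda>x. ?n ((x - t) / e) / e\<^sup>2)"
        using integrable_std_normal_affine[of "inverse e" "- t / e"] e by (metis inverse_nonzero_iff_nonzero integrable_divide_zero order_less_irrefl)
      show "(cmod (fourier (w e) x))\<^sup>2 \<le> ?n ((x - t) / e) / e\<^sup>2" for x
        using std_normal_density_square_le[of "(x - t) / e"] e
        by (simp add: F power_divide divide_right_mono del: of_real_divide)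
    qed measurable
    ultimately have "(LINT l|lborel. g l * w e l) = (LINT x|lborel. complex_of_real (?h x) * fourier (w e) x)"
      by (intro l2_fourier_duality[OF fg])
    also have "\<dots> = (LINT x|lborel. complex_of_real (?h x * ?n ((x - t) / e) / e))"
      by (simp add: F)
    also have "\<dots> = complex_of_real (LINT x|lborel. ?h x * ?n ((x - t) / e) / e)"
      by (rule integral_complex_of_real)
    also have "(LINT x|lborel. ?h x * ?n ((x - t) / e) / e) =
        \<bar>e\<bar> *\<^sub>R (LINT y|lborel. ?h (t + e * y) * ?n ((t + e * y - t) / e) / e)"
      using e by (intro lborel_integral_real_affine) auto
    also have "\<dots> = (LINT y|lborel. ?h (t + e * y) * ?n y)" using e by simp
    finally show ?thesis .
  qed
  define e where "e = (\<lambda>n. inverse (real (Suc n)))"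
  have e0: "e \<longlonglongrightarrow> 0" unfolding e_def by (rule LIMSEQ_inverse_real_of_nat)
  have epos: "0 < e n" "e n \<le> 1" for n by (auto simp: e_def inverse_le_1_iff)
  have nc: "continuous_on UNIV ?n" unfolding normal_density_def by (intro continuous_intros) auto
  have "(\<lambda>n. LINT l|lborel. g l * w (e n) l) \<longlonglongrightarrow> (LINT l|lborel. g l * w 0 l)"
  proof (rule integral_dominated_convergence[where w = "\<lambda>l. cmod (g l)"])
    show "AE l in lborel. (\<lambda>n. g l * w (e n) l) \<longlonglongrightarrow> g l * w 0 l"
    proof (intro AE_I2)
      fix l
      have "(\<lambda>n. ?n (e n * l)) \<longlonglongrightarrow> ?n (0 * l)"
        by (rule continuous_on_tendsto_compose[OF nc tendsto_mult[OF e0 tendsto_const]]) auto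
      thus "(\<lambda>n. g l * w (e n) l) \<longlonglongrightarrow> g l * w 0 l"
        unfolding w_def by (intro tendsto_intros) auto
    qed
    show "AE l in lborel. norm (g l * w (e n) l) \<le> cmod (g l)" for n
    proof (intro AE_I2)
      fix l
      have "1 \<le> sqrt (2 * pi)" using pi_gt3 by (intro real_le_rsqrt) simp
      hence "?n (e n * l) / sqrt (2 * pi) \<le> 1 / 1"
        using std_normal_density_le_1 by (intro frac_le) auto
      hence "cmod (w (e n) l) \<le> 1"
        by (simp add: w_def norm_mult norm_divide del: of_real_mult of_real_divide)
      thus "norm (g l * w (e n) l) \<le> cmod (g l)" by (simp add: norm_mult mult_left_le)
    qed
  qed (use g in \<open>auto simp: w_def\<close>)
  moreover have "(\<lambda>n. LINT y|lborel. ?h (t + e n * y) * ?n y) \<longlonglongrightarrow> (LINT y|lborel. ?h t * ?n y)"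
  proof (rule integral_dominated_convergence[where w = "\<lambda>y. norm h * (exp 1 + \<bar>t\<bar>) * ?n y + norm h * (?n y * \<bar>y\<bar>)"])
    show "AE y in lborel. (\<lambda>n. ?h (t + e n * y) * ?n y) \<longlonglongrightarrow> ?h t * ?n y"
    proof (intro AE_I2 tendsto_mult tendsto_const)
      fix y
      have "(\<lambda>n. ?h (t + e n * y)) \<longlonglongrightarrow> ?h (t + 0 * y)"
        by (rule continuous_on_tendsto_compose[OF upath_continuous
              tendsto_add[OF tendsto_const tendsto_mult[OF e0 tendsto_const]]]) auto
      thus "(\<lambda>n. ?h (t + e n * y)) \<longlonglongrightarrow> ?h t" by simp
    qed
    show "AE y in lborel. norm (?h (t + e n * y) * ?n y) \<le>
        norm h * (exp 1 + \<bar>t\<bar>) * ?n y + norm h * (?n y * \<bar>y\<bar>)" for n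
    proof (intro AE_I2)
      fix y
      have "\<bar>e n * y\<bar> \<le> 1 * \<bar>y\<bar>" unfolding abs_mult using epos[of n] by (intro mult_right_mono) auto
      hence "\<bar>t + e n * y\<bar> \<le> \<bar>t\<bar> + \<bar>y\<bar>" by linarith
      hence "norm h * (exp 1 + \<bar>t + e n * y\<bar>) \<le> norm h * (exp 1 + \<bar>t\<bar> + \<bar>y\<bar>)"
        by (intro mult_left_mono) auto
      hence "\<bar>?h (t + e n * y)\<bar> \<le> norm h * (exp 1 + \<bar>t\<bar> + \<bar>y\<bar>)"
        using upath_linear_bound[of h "t + e n * y"] by linarith
      hence "\<bar>?h (t + e n * y)\<bar> * ?n y \<le> norm h * (exp 1 + \<bar>t\<bar> + \<bar>y\<bar>) * ?n y"
        by (rule mult_right_mono) simp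
      thus "norm (?h (t + e n * y) * ?n y) \<le> norm h * (exp 1 + \<bar>t\<bar>) * ?n y + norm h * (?n y * \<bar>y\<bar>)"
        by (simp add: abs_mult algebra_simps)
    qed
    show "integrable lborel (\<lambda>y. norm h * (exp 1 + \<bar>t\<bar>) * ?n y + norm h * (?n y * \<bar>y\<bar>))"
      using integrable_std_normal_moment_abs[of 1] integrable_std_normal_moment[of 0]
      by (intro Bochner_Integration.integrable_add integrable_mult_right) auto
  qed auto
  hence "(\<lambda>n. complex_of_real (LINT y|lborel. ?h (t + e n * y) * ?n y)) \<longlonglongrightarrow> complex_of_real (LINT y|lborel. ?h t * ?n y)"
    by (rule tendsto_of_real)
  hence "(\<lambda>n. LINT l|lborel. g l * w (e n) l) \<longlonglongrightarrow> complex_of_real (?h t)"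
    using key[OF epos(1)] integral_std_normal_moment_even[of 0] by simp
  ultimately have "complex_of_real (?h t) = (LINT l|lborel. g l * w 0 l)" using LIMSEQ_unique by blast
  also have "\<dots> = (LINT l|lborel. g l * exp (\<i> * complex_of_real (l * t)) / complex_of_real (2 * pi))"
  proof (intro Bochner_Integration.integral_cong refl)
    fix l
    have "?n (0 * l) / sqrt (2 * pi) = 1 / (2 * pi)"
      by (simp add: normal_density_def real_sqrt_mult[symmetric] flip: real_sqrt_mult)
    thus "g l * w 0 l = g l * exp (\<i> * complex_of_real (l * t)) / complex_of_real (2 * pi)"
      unfolding w_def by simp
  qed
  also have "\<dots> = (LINT l|lborel. g l * exp (\<i> * complex_of_real (l * t))) / complex_of_real (2 * pi)"
    by (rule integral_divide_zero)
  finally show ?thesis .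
qed

lemma exp_half_line_integral:
  fixes z :: complex
  assumes "0 < Re z"
  shows "has_bochner_integral lborel (\<lambda>x. indicator {0..} x *\<^sub>R exp (- z * complex_of_real x)) (1 / z)"
proof -
  have z: "z \<noteq> 0" using assms by auto
  have I: "integrable lborel (\<lambda>x. indicator {0..} x *\<^sub>R exp (- z * complex_of_real x))"
    by (rule Bochner_Integration.integrable_bound[OF integrable_exp_abs[OF assms, of 0]])
       (auto simp: norm_exp_eq_Re indicator_def)
  have fin: "(LINT x|lborel. indicator {0..real n} x *\<^sub>R exp (- z * complex_of_real x)) =
     1 / z - exp (- z * complex_of_real n) / z" for n :: nat
  proof -
    have "(LINT x|lborel. indicator {0..real n} x *\<^sub>R exp (- z * complex_of_real x)) =
      (- exp (- z * complex_of_real n) / z) - (- exp (- z * complex_of_real 0) / z)"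
    proof (rule integral_FTC_atLeastAtMost)
      fix x
      have "((\<lambda>x. - exp (- z * x) / z) has_field_derivative exp (- z * complex_of_real x)) (at (complex_of_real x))"
        using z by (auto intro!: derivative_eq_intros)
      from has_vector_derivative_real_field[OF this]
      show "((\<lambda>x. - exp (- z * complex_of_real x) / z) has_vector_derivative exp (- z * complex_of_real x)) (at x within {0..real n})" .
    qed (auto intro!: continuous_intros)
    thus ?thesis by simp
  qed
  have "(\<lambda>n. LINT x|lborel. indicator {0..real n} x *\<^sub>R exp (- z * complex_of_real x)) \<longlonglongrightarrow>
     (LINT x|lborel. indicator {0..} x *\<^sub>R exp (- z * complex_of_real x))"
  proof (rule integral_dominated_convergence[where w = "\<lambda>x. norm (indicator {0..} x *\<^sub>R exp (- z * complex_of_real x))"])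
    show "AE x in lborel. (\<lambda>n. indicator {0..real n} x *\<^sub>R exp (- z * complex_of_real x)) \<longlonglongrightarrow>
       indicator {0..} x *\<^sub>R exp (- z * complex_of_real x)"
    proof (intro AE_I2 tendsto_eventually)
      fix x :: real
      obtain N :: nat where N: "x \<le> N" using real_arch_simple by blast
      show "\<forall>\<^sub>F n in sequentially. indicator {0..real n} x *\<^sub>R exp (- z * complex_of_real x) =
          indicator {0..} x *\<^sub>R exp (- z * complex_of_real x)"
        using eventually_ge_at_top[of N] by eventually_elim (use N in \<open>auto simp: indicator_def\<close>)
    qed
    show "integrable lborel (\<lambda>x. norm (indicator {0..} x *\<^sub>R exp (- z * complex_of_real x)))"
      by (rule integrable_norm[OF I])
    show "AE x in lborel. norm (indicator {0..real n} x *\<^sub>R exp (- z * complex_of_real x)) \<le>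
        norm (indicator {0..} x *\<^sub>R exp (- z * complex_of_real x))" for n
      by (intro AE_I2) (auto simp: indicator_def)
  qed measurable
  moreover have "(\<lambda>n. 1 / z - exp (- z * complex_of_real (real n)) / z) \<longlonglongrightarrow> 1 / z - 0 / z"
  proof (intro tendsto_intros z)
    have "(\<lambda>n. exp (- Re z * real n)) \<longlonglongrightarrow> 0" using assms by real_asymp
    thus "(\<lambda>n. exp (- z * complex_of_real (real n))) \<longlonglongrightarrow> 0"
      by (intro tendsto_norm_zero_cancel[of "\<lambda>n. exp (- z * complex_of_real (real n))"]) (simp add: norm_exp_eq_Re)
  qed
  ultimately have "(LINT x|lborel. indicator {0..} x *\<^sub>R exp (- z * complex_of_real x)) = 1 / z"
    unfolding fin by (auto dest: LIMSEQ_unique)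
  thus ?thesis using I by (simp add: has_bochner_integral_iff)
qed

lemma fourier_ou_kernel:
  "fourier (\<lambda>x. complex_of_real (upath_apply (ou_kernel s) x)) l =
     4 * exp (- \<i> * complex_of_real (l * s)) / complex_of_real (1 + 4 * l\<^sup>2)"
proof -
  define p where "p = 1 / 2 + \<i> * complex_of_real l"
  define q where "q = 1 / 2 - \<i> * complex_of_real l"
  have pq: "0 < Re p" "0 < Re q" by (auto simp: p_def q_def)
  define f where "f = (\<lambda>y. exp (- \<i> * complex_of_real (l * y)) * complex_of_real (exp (- \<bar>y\<bar> / 2)))"
  have "fourier (\<lambda>x. complex_of_real (upath_apply (ou_kernel s) x)) l =
    (LINT x|lborel. exp (- \<i> * complex_of_real (l * x)) * complex_of_real (exp (- \<bar>x - s\<bar> / 2)))"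
    by (simp add: fourier_def ou_kernel_apply)
  also have "\<dots> = \<bar>1\<bar> *\<^sub>R (LINT y|lborel. exp (- \<i> * complex_of_real (l * (s + 1 * y))) * complex_of_real (exp (- \<bar>s + 1 * y - s\<bar> / 2)))"
    by (intro lborel_integral_real_affine) auto
  also have "\<dots> = (LINT y|lborel. exp (- \<i> * complex_of_real (l * s)) * f y)"
    unfolding abs_one scaleR_one
    by (intro Bochner_Integration.integral_cong refl) (simp add: f_def distrib_left exp_add[symmetric] algebra_simps)
  also have "\<dots> = exp (- \<i> * complex_of_real (l * s)) * (LINT y|lborel. f y)" by simp
  also have "has_bochner_integral lborel f (1 / p + 1 / q)"
  proof -
    have 1: "has_bochner_integral lborel (\<lambda>y. indicator {0..} y *\<^sub>R exp (- p * complex_of_real y)) (1 / p)"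
      by (rule exp_half_line_integral[OF pq(1)])
    have 2: "has_bochner_integral lborel (\<lambda>y. indicator {0..} (- y) *\<^sub>R exp (- q * complex_of_real (- y))) (1 / q)"
      using lborel_has_bochner_integral_real_affine_iff[of "-1" "\<lambda>y. indicator {0..} y *\<^sub>R exp (- q * complex_of_real y)" "1 / q" 0]
        exp_half_line_integral[OF pq(2)] by simp
    have ae: "AE y in lborel. indicator {0..} y *\<^sub>R exp (- p * complex_of_real y) +
       indicator {0..} (- y) *\<^sub>R exp (- q * complex_of_real (- y)) = f y"
      using AE_lborel_singleton[of 0]
    proof eventually_elim
      case (elim y)
      show ?case
      proof (cases "0 < y")
        case True
        have "exp (- p * complex_of_real y) = f y"
          using True by (simp add: f_def p_def exp_of_real[symmetric] exp_add[symmetric] algebra_simps)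
        thus ?thesis using True by (simp add: indicator_def)
      next
        case False
        hence "exp (- q * complex_of_real (- y)) = f y"
          by (simp add: f_def q_def exp_of_real[symmetric] exp_add[symmetric] algebra_simps)
        thus ?thesis using False elim by (simp add: indicator_def)
      qed
    qed
    have "f \<in> borel_measurable lborel" unfolding f_def by measurable
    thus ?thesis using has_bochner_integral_add[OF 1 2] has_bochner_integralI_AE[OF _ _ ae] by blast
  qed
  hence "(LINT y|lborel. f y) = 1 / p + 1 / q" by (rule has_bochner_integral_integral_eq)
  also have "1 / p + 1 / q = 4 / complex_of_real (1 + 4 * l\<^sup>2)"
  proof -
    have e: "p * q = complex_of_real (1 + 4 * l\<^sup>2) / 4" "p + q = 1"
      by (simp_all add: p_def q_def algebra_simps power2_eq_square)
    have "p \<noteq> 0" "q \<noteq> 0" using pq by auto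
    hence "1 / p + 1 / q = (p + q) / (p * q)" by (simp add: field_simps)
    thus ?thesis unfolding e by simp
  qed
  finally show ?thesis by simp
qed

text \<open>
  The covariance of two values of the flow whose parameters differ by \<open>u\<close> (first minus second) and
  whose times differ by \<open>t\<close> (second minus first).
\<close>

definition ou_cov :: "real \<Rightarrow> real \<Rightarrow> complex" where
  "ou_cov u t = 2 / complex_of_real pi *
     (LINT l|lborel. exp (\<i> * complex_of_real (t * l + 2 * u * arctan (2 * l))) / complex_of_real (1 + 4 * l\<^sup>2))"

lemma one_plus_4_square_pos: "0 < 1 + 4 * (l::real)\<^sup>2"
  by (intro add_pos_nonneg) auto

lemma integrable_ou_spectrum: "integrable lborel (\<lambda>l::real. 1 / (1 + 4 * l\<^sup>2))"
proof -
  have "(\<lambda>l::real. inverse (1 + (0 + 2 * l)\<^sup>2)) = (\<lambda>l. 1 / (1 + 4 * l\<^sup>2))"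
    by (simp add: power_mult_distrib inverse_eq_divide)
  thus ?thesis
    using lborel_integrable_real_affine[OF integrable_inverse_one_plus_square, of 2 0] by simp
qed

lemma arctan_measurable [measurable]: "(\<lambda>l. arctan (2 * l)) \<in> borel_measurable borel"
  by (intro borel_measurable_continuous_onI continuous_intros)

lemma cmod_ou_spectrum:
  "cmod (exp (\<i> * complex_of_real r) / complex_of_real (1 + 4 * l\<^sup>2)) = 1 / (1 + 4 * l\<^sup>2)"
  using one_plus_4_square_pos[of l] unfolding norm_divide cmod_exp_i norm_of_real by simp

lemma ou_spectrum_integrable:
  assumes [measurable]: "r \<in> borel_measurable borel"
  shows "integrable lborel (\<lambda>l. exp (\<i> * complex_of_real (r l)) / complex_of_real (1 + 4 * l\<^sup>2))"
  by (rule Bochner_Integration.integrable_bound[OF integrable_ou_spectrum])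
     (use one_plus_4_square_pos in \<open>auto simp: cmod_ou_spectrum less_imp_le simp del: of_real_add of_real_mult\<close>)

lemma l2_fourier_ou_kernel:
  "l2_fourier (\<lambda>x. complex_of_real (upath_apply (ou_kernel s) x))
     (\<lambda>l. 4 * exp (- \<i> * complex_of_real (l * s)) / complex_of_real (1 + 4 * l\<^sup>2))"
  (is "l2_fourier ?f ?g")
proof -
  have [measurable]: "upath_apply (ou_kernel s) \<in> borel_measurable borel"
    by (rule borel_measurable_continuous_onI[OF upath_continuous])
  have i: "integrable lborel (\<lambda>x. exp (- (1/2) * \<bar>x - s\<bar>))" by (rule integrable_exp_abs) simp
  hence fi: "integrable lborel ?f" by (auto simp: ou_kernel_apply intro!: integrable_of_real)
  have fs: "square_integrable ?f"
  proof (rule square_integrable_mono[OF i])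
    fix x
    have "(exp (- \<bar>x - s\<bar> / 2))\<^sup>2 \<le> exp (- \<bar>x - s\<bar> / 2)"
      unfolding power2_eq_square by (intro mult_left_le) auto
    thus "(cmod (?f x))\<^sup>2 \<le> exp (- (1/2) * \<bar>x - s\<bar>)" by (simp add: ou_kernel_apply)
  qed measurable
  have gs: "square_integrable ?g"
  proof (rule square_integrable_mono)
    show "integrable lborel (\<lambda>l::real. 16 * (1 / (1 + 4 * l\<^sup>2)))"
      by (intro integrable_mult_right integrable_ou_spectrum)
    fix l :: real
    have p: "0 < 1 + 4 * l\<^sup>2" "1 \<le> 1 + 4 * l\<^sup>2" by (auto simp: one_plus_4_square_pos)
    have "cmod (?g l) = 4 / (1 + 4 * l\<^sup>2)"
      using p unfolding norm_divide norm_mult cmod_exp_i norm_of_real by simp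
    hence "(cmod (?g l))\<^sup>2 = 16 / (1 + 4 * l\<^sup>2)\<^sup>2" by (simp add: power_divide)
    also have "\<dots> \<le> 16 / (1 + 4 * l\<^sup>2)"
      using p by (intro divide_left_mono) (auto simp: power2_eq_square)
    finally show "(cmod (?g l))\<^sup>2 \<le> 16 * (1 / (1 + 4 * l\<^sup>2))" by simp
  qed measurable
  show ?thesis unfolding l2_fourier_def
    using fi fs gs fourier_ou_kernel[of s] by (intro conjI exI[of _ "\<lambda>_. ?f"]) auto
qed

text \<open>
  The transform of \<open>ou_kernel s\<close> is explicit, so uniqueness gives that of \<open>k\<close> by undoing the phase \<open>u\<close>, and
  that of \<open>Q v k\<close> by adding the phase \<open>v\<close>.  Both transforms are integrable, and inversion gives the
  values of the two paths.
\<close>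

theorem phase_shift_ou_kernel:
  fixes Q :: "real \<Rightarrow> upath \<Rightarrow> upath"
  assumes Q: "\<And>u h. h \<in> HU \<Longrightarrow>
           \<exists>g. l2_fourier (\<lambda>x. complex_of_real (upath_apply h x)) g \<and>
               l2_fourier (\<lambda>x. complex_of_real (upath_apply (Q u h) x))
                 (\<lambda>l. exp (- 2 * \<i> * complex_of_real (u * arctan (2 * l))) * g l)"
    and k: "k \<in> HU" "Q u k = ou_kernel s"
  shows "complex_of_real (upath_apply k t) = ou_cov u (t - s)"
    and "complex_of_real (upath_apply (Q v k) t) = ou_cov (u - v) (t - s)"
proof -
  define G where "G = (\<lambda>v l. 4 * (exp (\<i> * complex_of_real (2 * v * arctan (2 * l) - l * s)) / complex_of_real (1 + 4 * l\<^sup>2)))"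
  have Gi: "integrable lborel (G v)" for v unfolding G_def
    by (intro integrable_mult_right ou_spectrum_integrable) measurable
  have inv: "complex_of_real (upath_apply h t) = ou_cov v (t - s)"
    if "l2_fourier (\<lambda>x. complex_of_real (upath_apply h x)) g" and ae: "AE l in lborel. g l = G v l" for h g v
  proof -
    have [measurable]: "g \<in> borel_measurable borel"
      using that(1) by (auto simp: l2_fourier_def square_integrable_def)
    have [measurable]: "G v \<in> borel_measurable borel" using Gi by auto
    have "integrable lborel g" using Gi ae
      by (subst integrable_cong_AE[of g _ "G v"]) auto
    hence "complex_of_real (upath_apply h t) = (LINT l|lborel. g l * exp (\<i> * complex_of_real (l * t))) / complex_of_real (2 * pi)"
      by (rule l2_fourier_inversion[OF that(1)])
    also have "(LINT l|lborel. g l * exp (\<i> * complex_of_real (l * t))) =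
       (LINT l|lborel. 4 * (exp (\<i> * complex_of_real ((t - s) * l + 2 * v * arctan (2 * l))) / complex_of_real (1 + 4 * l\<^sup>2)))"
    proof (rule integral_cong_AE)
      show "AE l in lborel. g l * exp (\<i> * complex_of_real (l * t)) =
        4 * (exp (\<i> * complex_of_real ((t - s) * l + 2 * v * arctan (2 * l))) / complex_of_real (1 + 4 * l\<^sup>2))"
        using ae
      proof eventually_elim
        case (elim l)
        have "exp (\<i> * complex_of_real (2 * v * arctan (2 * l) - l * s)) * exp (\<i> * complex_of_real (l * t)) =
           exp (\<i> * complex_of_real ((t - s) * l + 2 * v * arctan (2 * l)))"
          by (simp add: exp_add[symmetric] algebra_simps)
        thus ?case unfolding elim G_def by (simp del: of_real_mult of_real_add of_real_diff)
      qed
    qed measurable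
    also have "\<dots> = 4 * (LINT l|lborel. exp (\<i> * complex_of_real ((t - s) * l + 2 * v * arctan (2 * l))) / complex_of_real (1 + 4 * l\<^sup>2))"
      by (rule integral_mult_right_zero)
    finally show ?thesis by (simp add: ou_cov_def)
  qed
  obtain g where g: "l2_fourier (\<lambda>x. complex_of_real (upath_apply k x)) g"
    "l2_fourier (\<lambda>x. complex_of_real (upath_apply (ou_kernel s) x))
                 (\<lambda>l. exp (- 2 * \<i> * complex_of_real (u * arctan (2 * l))) * g l)"
    using Q[OF k(1), of u] unfolding k(2) by blast
  have gG: "AE l in lborel. g l = G u l"
    using l2_fourier_unique[OF g(2) l2_fourier_ou_kernel[of s]]
  proof eventually_elim
    case (elim l)
    let ?a = "exp (\<i> * complex_of_real (2 * u * arctan (2 * l)))"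
    have "?a * exp (- 2 * \<i> * complex_of_real (u * arctan (2 * l))) = 1"
      by (simp add: exp_add[symmetric])
    hence "g l = ?a * (exp (- 2 * \<i> * complex_of_real (u * arctan (2 * l))) * g l)"
      by (metis mult.assoc mult_1)
    also have "\<dots> = ?a * (4 * exp (- \<i> * complex_of_real (l * s)) / complex_of_real (1 + 4 * l\<^sup>2))"
      by (simp only: elim)
    also have "\<dots> = 4 * ((?a * exp (- \<i> * complex_of_real (l * s))) / complex_of_real (1 + 4 * l\<^sup>2))"
      by simp
    also have "?a * exp (- \<i> * complex_of_real (l * s)) = exp (\<i> * complex_of_real (2 * u * arctan (2 * l) - l * s))"
      by (simp add: exp_add[symmetric] algebra_simps)
    finally show ?case by (simp only: G_def)
  qed
  show "complex_of_real (upath_apply k t) = ou_cov u (t - s)" by (rule inv[OF g(1) gG])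
  obtain g' where g': "l2_fourier (\<lambda>x. complex_of_real (upath_apply k x)) g'"
    "l2_fourier (\<lambda>x. complex_of_real (upath_apply (Q v k) x))
                 (\<lambda>l. exp (- 2 * \<i> * complex_of_real (v * arctan (2 * l))) * g' l)"
    using Q[OF k(1), of v] by blast
  show "complex_of_real (upath_apply (Q v k) t) = ou_cov (u - v) (t - s)"
  proof (rule inv[OF g'(2)])
    show "AE l in lborel. exp (- 2 * \<i> * complex_of_real (v * arctan (2 * l))) * g' l = G (u - v) l"
      using l2_fourier_unique[OF g'(1) g(1)] gG
    proof eventually_elim
      case (elim l)
      have "exp (- 2 * \<i> * complex_of_real (v * arctan (2 * l))) * exp (\<i> * complex_of_real (2 * u * arctan (2 * l) - l * s))
        = exp (\<i> * complex_of_real (2 * (u - v) * arctan (2 * l) - l * s))"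
        by (simp add: exp_add[symmetric] algebra_simps)
      thus ?case unfolding elim G_def by (simp add: mult.left_commute[of _ 4] del: of_real_mult of_real_add of_real_diff)
    qed
  qed
qed

section \<open>The Kolmogorov continuity criterion in the plane\<close>

definition dyadic_floor :: "nat \<Rightarrow> real \<Rightarrow> real" where
  "dyadic_floor n x = of_int \<lfloor>x * 2 ^ n\<rfloor> / 2 ^ n"

definition grid_point :: "nat \<Rightarrow> int \<Rightarrow> int \<Rightarrow> real \<times> real" where
  "grid_point n i j = (of_int i / 2 ^ n, of_int j / 2 ^ n)"

lemma dyadic_floor_bounds: "dyadic_floor n x \<le> x" "x < dyadic_floor n x + 1 / 2 ^ n"
proof -
  have "of_int \<lfloor>x * 2 ^ n\<rfloor> \<le> x * 2 ^ n" "x * 2 ^ n < of_int \<lfloor>x * 2 ^ n\<rfloor> + 1" by linarith+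
  thus "dyadic_floor n x \<le> x" "x < dyadic_floor n x + 1 / 2 ^ n"
    unfolding dyadic_floor_def by (simp_all add: field_simps)
qed

lemma floor_double_cases: "\<lfloor>2 * x\<rfloor> = 2 * \<lfloor>x\<rfloor> \<or> \<lfloor>2 * x\<rfloor> = 2 * \<lfloor>x :: real\<rfloor> + 1"
  by linarith

lemma floor_close:
  assumes "\<bar>x - y\<bar> < (1::real)"
  shows "\<bar>\<lfloor>x\<rfloor> - \<lfloor>y\<rfloor>\<bar> \<le> 1"
  using assms by linarith

text \<open>
  Chaining: successive dyadic approximations of a point are at most one grid step apart in each
  coordinate, so geometric control of the grid increments makes them converge locally uniformly.
\<close>

lemma dyadic_chaining:
  fixes x :: "real \<times> real \<Rightarrow> real"
  assumes r: "0 < r" "r < 1"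
    and inc: "\<And>N::nat. \<exists>K. \<forall>n. \<forall>i j :: int. \<bar>i\<bar> \<le> int N * 2 ^ n \<longrightarrow> \<bar>j\<bar> \<le> int N * 2 ^ n \<longrightarrow>
      \<bar>x (grid_point n i j) - x (grid_point n (i + 1) j)\<bar> \<le> K * r ^ n \<and>
      \<bar>x (grid_point n i j) - x (grid_point n i (j + 1))\<bar> \<le> K * r ^ n"
  shows "\<exists>z. continuous_on UNIV z \<and>
    (\<forall>p. (\<lambda>n. x (dyadic_floor n (fst p), dyadic_floor n (snd p))) \<longlonglongrightarrow> z p)"
proof -
  define g where "g = (\<lambda>n (i::int) (j::int). x (grid_point n i j))"
  define X where "X = (\<lambda>n p. x (dyadic_floor n (fst p), dyadic_floor n (snd p)))"
  have Xg: "X n (u, t) = g n \<lfloor>u * 2 ^ n\<rfloor> \<lfloor>t * 2 ^ n\<rfloor>" for n u t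
    by (simp add: X_def g_def dyadic_floor_def grid_point_def)
  have g_double: "g n i j = g (Suc n) (2 * i) (2 * j)" for n i j
    by (simp add: g_def grid_point_def field_simps)
  have grid: "\<exists>K\<ge>0. \<forall>n. \<forall>i j i' j' :: int. \<bar>i\<bar> \<le> int N * 2 ^ n \<longrightarrow> \<bar>j\<bar> \<le> int N * 2 ^ n \<longrightarrow> \<bar>i'\<bar> \<le> int N * 2 ^ n \<longrightarrow>
     \<bar>j'\<bar> \<le> int N * 2 ^ n \<longrightarrow> \<bar>i - i'\<bar> \<le> 1 \<longrightarrow> \<bar>j - j'\<bar> \<le> 1 \<longrightarrow> \<bar>g n i j - g n i' j'\<bar> \<le> K * r ^ n" for N :: nat
  proof -
    obtain K where K: "\<And>n i j. \<bar>i\<bar> \<le> int N * 2 ^ n \<Longrightarrow> \<bar>j\<bar> \<le> int N * 2 ^ n \<Longrightarrow>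
      \<bar>g n i j - g n (i + 1) j\<bar> \<le> K * r ^ n \<and> \<bar>g n i j - g n i (j + 1)\<bar> \<le> K * r ^ n"
      using inc[of N] unfolding g_def by blast
    have "0 \<le> K" using K[of 0 0 0] by (auto intro: order_trans[OF abs_ge_zero])
    have h: "\<bar>g n i j - g n i' j\<bar> \<le> K * r ^ n"
      if A: "\<bar>i\<bar> \<le> int N * 2 ^ n" "\<bar>i'\<bar> \<le> int N * 2 ^ n" "\<bar>j\<bar> \<le> int N * 2 ^ n" "\<bar>i - i'\<bar> \<le> 1" for n i i' j
    proof -
      consider "i' = i" | "i' = i + 1" | "i = i' + 1" using A(4) by linarith
      thus ?thesis
      proof cases
        case 1 thus ?thesis using \<open>0 \<le> K\<close> r by simp
      next
        case 2 thus ?thesis using K[OF A(1,3)] by simp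
      next
        case 3 thus ?thesis using K[OF A(2,3)] by (simp add: abs_minus_commute)
      qed
    qed
    have v: "\<bar>g n i j - g n i j'\<bar> \<le> K * r ^ n"
      if A: "\<bar>i\<bar> \<le> int N * 2 ^ n" "\<bar>j\<bar> \<le> int N * 2 ^ n" "\<bar>j'\<bar> \<le> int N * 2 ^ n" "\<bar>j - j'\<bar> \<le> 1" for n i j j'
    proof -
      consider "j' = j" | "j' = j + 1" | "j = j' + 1" using A(4) by linarith
      thus ?thesis
      proof cases
        case 1 thus ?thesis using \<open>0 \<le> K\<close> r by simp
      next
        case 2 thus ?thesis using K[OF A(1,2)] by simp
      next
        case 3 thus ?thesis using K[OF A(1,3)] by (simp add: abs_minus_commute)
      qed
    qed
    show ?thesis
    proof (intro exI[of _ "2 * K"] conjI allI impI)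
      show "0 \<le> 2 * K" using \<open>0 \<le> K\<close> by simp
      fix n :: nat and i j i' j' :: int
      assume A: "\<bar>i\<bar> \<le> int N * 2 ^ n" "\<bar>j\<bar> \<le> int N * 2 ^ n" "\<bar>i'\<bar> \<le> int N * 2 ^ n"
        "\<bar>j'\<bar> \<le> int N * 2 ^ n" "\<bar>i - i'\<bar> \<le> 1" "\<bar>j - j'\<bar> \<le> 1"
      have "\<bar>g n i j - g n i' j'\<bar> \<le> \<bar>g n i j - g n i' j\<bar> + \<bar>g n i' j - g n i' j'\<bar>" by linarith
      thus "\<bar>g n i j - g n i' j'\<bar> \<le> 2 * K * r ^ n"
        using h[OF A(1,3,2,5)] v[OF A(3,2,4,6)] by linarith
    qed
  qed
  have fl: "\<bar>\<lfloor>a * 2 ^ n\<rfloor>\<bar> \<le> int (Suc N) * 2 ^ n" if "\<bar>a\<bar> \<le> real N" for a and N n :: nat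
  proof -
    have "\<bar>a * 2 ^ n\<bar> \<le> real N * 2 ^ n" using that by (simp add: abs_mult)
    hence "\<bar>of_int \<lfloor>a * 2 ^ n\<rfloor>\<bar> \<le> real N * 2 ^ n + 1" by linarith
    also have "\<dots> \<le> real (Suc N) * 2 ^ n" by (simp add: distrib_right)
    finally have "real_of_int \<bar>\<lfloor>a * 2 ^ n\<rfloor>\<bar> \<le> real_of_int (int (Suc N) * 2 ^ n)" by simp
    thus ?thesis by (simp only: of_int_le_iff)
  qed
  have bound: "\<exists>K\<ge>0. (\<forall>n u t. \<bar>u\<bar> \<le> real N \<longrightarrow> \<bar>t\<bar> \<le> real N \<longrightarrow> \<bar>X (Suc n) (u, t) - X n (u, t)\<bar> \<le> K * r ^ n) \<and>
     (\<forall>n u t u' t'. \<bar>u\<bar> \<le> real N \<longrightarrow> \<bar>t\<bar> \<le> real N \<longrightarrow> \<bar>u'\<bar> \<le> real N \<longrightarrow> \<bar>t'\<bar> \<le> real N \<longrightarrow>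
       \<bar>u - u'\<bar> < 1 / 2 ^ n \<longrightarrow> \<bar>t - t'\<bar> < 1 / 2 ^ n \<longrightarrow> \<bar>X n (u, t) - X n (u', t')\<bar> \<le> K * r ^ n)" for N :: nat
  proof -
    obtain K where K0: "0 \<le> K" and K: "\<And>n i j i' j'. \<bar>i\<bar> \<le> int (Suc N) * 2 ^ n \<Longrightarrow> \<bar>j\<bar> \<le> int (Suc N) * 2 ^ n \<Longrightarrow> \<bar>i'\<bar> \<le> int (Suc N) * 2 ^ n \<Longrightarrow>
     \<bar>j'\<bar> \<le> int (Suc N) * 2 ^ n \<Longrightarrow> \<bar>i - i'\<bar> \<le> 1 \<Longrightarrow> \<bar>j - j'\<bar> \<le> 1 \<Longrightarrow> \<bar>g n i j - g n i' j'\<bar> \<le> K * r ^ n"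
      using grid[of "Suc N"] by blast
    show ?thesis
    proof (intro exI[of _ K] conjI allI impI K0)
      fix n u t assume ut: "\<bar>u\<bar> \<le> real N" "\<bar>t\<bar> \<le> real N"
      have d: "\<bar>\<lfloor>a * 2 ^ Suc n\<rfloor> - 2 * \<lfloor>a * 2 ^ n\<rfloor>\<bar> \<le> 1" for a :: real
        using floor_double_cases[of "a * 2 ^ n"] by (auto simp: ac_simps)
      have e: "\<bar>2 * \<lfloor>a * 2 ^ n\<rfloor>\<bar> \<le> int (Suc N) * 2 ^ Suc n" if "\<bar>a\<bar> \<le> real N" for a
        using fl[OF that, of n] by (simp add: abs_mult)
      have "\<bar>X (Suc n) (u, t) - X n (u, t)\<bar> \<le> K * r ^ Suc n"
        unfolding Xg g_double[of n] by (intro K fl e d ut)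
      also have "\<dots> \<le> K * r ^ n" using K0 r by (intro mult_left_mono power_decreasing) auto
      finally show "\<bar>X (Suc n) (u, t) - X n (u, t)\<bar> \<le> K * r ^ n" .
    next
      fix n u t u' t' assume ut: "\<bar>u\<bar> \<le> real N" "\<bar>t\<bar> \<le> real N" "\<bar>u'\<bar> \<le> real N" "\<bar>t'\<bar> \<le> real N"
       "\<bar>u - u'\<bar> < 1 / 2 ^ n" "\<bar>t - t'\<bar> < 1 / 2 ^ n"
      have "\<bar>a * 2 ^ n - b * 2 ^ n\<bar> < 1" if "\<bar>a - b\<bar> < 1 / 2 ^ n" for a b :: real
      proof -
        have "\<bar>a * 2 ^ n - b * 2 ^ n\<bar> = \<bar>a - b\<bar> * 2 ^ n"
          by (simp add: left_diff_distrib[symmetric] abs_mult)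
        also have "\<dots> < 1" using that by (simp add: pos_less_divide_eq)
        finally show ?thesis .
      qed
      thus "\<bar>X n (u, t) - X n (u', t')\<bar> \<le> K * r ^ n"
        unfolding Xg using ut by (intro K fl floor_close) auto
    qed
  qed
  have tail: "\<bar>a (n + k) - a n\<bar> \<le> K * r ^ n / (1 - r)"
    if "0 \<le> K" "\<And>n. \<bar>a (Suc n) - a n\<bar> \<le> K * r ^ n" for a :: "nat \<Rightarrow> real" and K n k
  proof -
    have "\<bar>a (n + k) - a n\<bar> \<le> K * r ^ n * (1 - r ^ k) / (1 - r)"
    proof (induction k)
      case (Suc k)
      have "\<bar>a (n + Suc k) - a n\<bar> \<le> \<bar>a (Suc (n + k)) - a (n + k)\<bar> + \<bar>a (n + k) - a n\<bar>" by simp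
      also have "\<dots> \<le> K * r ^ (n + k) + K * r ^ n * (1 - r ^ k) / (1 - r)"
        using that(2)[of "n + k"] Suc by linarith
      also have "\<dots> = K * r ^ n * (1 - r ^ Suc k) / (1 - r)"
        using r by (simp add: power_add divide_simps) (simp add: algebra_simps)
      finally show ?case .
    qed simp
    also have "\<dots> \<le> K * r ^ n / (1 - r)"
      using r that(1) by (intro divide_right_mono) (auto intro!: mult_left_le)
    finally show ?thesis .
  qed
  have conv: "convergent (\<lambda>n. X n p)" for p
  proof -
    obtain u t where p: "p = (u, t)" by fastforce
    obtain N :: nat where N: "\<bar>u\<bar> + \<bar>t\<bar> \<le> real N" using real_arch_simple by blast
    obtain K where K: "0 \<le> K" "\<And>n. \<bar>X (Suc n) p - X n p\<bar> \<le> K * r ^ n"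
    proof -
      have "\<bar>u\<bar> \<le> real N" "\<bar>t\<bar> \<le> real N" using N by linarith+
      thus thesis using bound[of N] that unfolding p by blast
    qed
    have "Cauchy (\<lambda>n. X n p)"
    proof (rule metric_CauchyI)
      fix e :: real assume e: "0 < e"
      have "(\<lambda>n. K / (1 - r) * r ^ n) \<longlonglongrightarrow> K / (1 - r) * 0"
        using r by (intro tendsto_mult tendsto_const LIMSEQ_power_zero) auto
      hence "\<forall>\<^sub>F n in sequentially. K / (1 - r) * r ^ n < e / 2"
        using e by (intro order_tendstoD(2)[of _ 0]) auto
      then obtain n where n: "K / (1 - r) * r ^ n < e / 2" unfolding eventually_sequentially by blast
      have b: "\<bar>X m p - X n p\<bar> < e / 2" if "n \<le> m" for m
      proof -
        have "\<bar>X (n + (m - n)) p - X n p\<bar> \<le> K * r ^ n / (1 - r)" by (rule tail[OF K])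
        also have "\<dots> = K / (1 - r) * r ^ n" by simp
        also have "\<dots> < e / 2" by (rule n)
        finally show ?thesis using that by simp
      qed
      show "\<exists>M. \<forall>m\<ge>M. \<forall>n\<ge>M. dist (X m p) (X n p) < e"
      proof (intro exI[of _ n] allI impI)
        fix m m' assume "n \<le> m" "n \<le> m'"
        thus "dist (X m p) (X m' p) < e" using b[of m] b[of m'] unfolding dist_real_def by linarith
      qed
    qed
    thus ?thesis by (simp add: Cauchy_convergent_iff)
  qed
  define z where "z = (\<lambda>p. lim (\<lambda>n. X n p))"
  have z: "(\<lambda>n. X n p) \<longlonglongrightarrow> z p" for p using conv unfolding z_def by (simp add: convergent_LIMSEQ_iff)
  have "continuous_on UNIV z"
    unfolding continuous_on_iff
  proof (intro ballI allI impI)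
    fix p :: "real \<times> real" and e :: real assume e: "0 < e"
    obtain u t where p: "p = (u, t)" by fastforce
    obtain N :: nat where N: "\<bar>u\<bar> + \<bar>t\<bar> + 1 \<le> real N" using real_arch_simple by blast
    obtain K where K0: "0 \<le> K" and K1: "\<And>n u t. \<bar>u\<bar> \<le> real N \<Longrightarrow> \<bar>t\<bar> \<le> real N \<Longrightarrow> \<bar>X (Suc n) (u, t) - X n (u, t)\<bar> \<le> K * r ^ n"
      and K2: "\<And>n u t u' t'. \<bar>u\<bar> \<le> real N \<Longrightarrow> \<bar>t\<bar> \<le> real N \<Longrightarrow> \<bar>u'\<bar> \<le> real N \<Longrightarrow> \<bar>t'\<bar> \<le> real N \<Longrightarrow>
       \<bar>u - u'\<bar> < 1 / 2 ^ n \<Longrightarrow> \<bar>t - t'\<bar> < 1 / 2 ^ n \<Longrightarrow> \<bar>X n (u, t) - X n (u', t')\<bar> \<le> K * r ^ n"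
      using bound[of N] by blast
    have lim: "\<bar>z (u, t) - X n (u, t)\<bar> \<le> K * r ^ n / (1 - r)" if "\<bar>u\<bar> \<le> real N" "\<bar>t\<bar> \<le> real N" for n u t
    proof (rule tendsto_upperbound)
      show "(\<lambda>k. \<bar>X (n + k) (u, t) - X n (u, t)\<bar>) \<longlonglongrightarrow> \<bar>z (u, t) - X n (u, t)\<bar>"
        using LIMSEQ_ignore_initial_segment[OF z[of "(u, t)"], of n]
        by (intro tendsto_intros) (simp add: add.commute)
      show "\<forall>\<^sub>F k in sequentially. \<bar>X (n + k) (u, t) - X n (u, t)\<bar> \<le> K * r ^ n / (1 - r)"
        using tail[of K "\<lambda>n. X n (u, t)" n] K0 K1[OF that] by (intro always_eventually allI) auto
    qed simp
    define L where "L = K * (2 / (1 - r) + 1)"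
    have "(\<lambda>n. L * r ^ n) \<longlonglongrightarrow> L * 0"
      using r by (intro tendsto_mult tendsto_const LIMSEQ_power_zero) auto
    hence "\<forall>\<^sub>F n in sequentially. L * r ^ n < e"
      using e by (intro order_tendstoD(2)[of _ 0]) auto
    then obtain n where n: "L * r ^ n < e" unfolding eventually_sequentially by blast
    show "\<exists>d>0. \<forall>q\<in>UNIV. dist q p < d \<longrightarrow> dist (z q) (z p) < e"
    proof (intro exI[of _ "1 / 2 ^ n"] conjI ballI impI)
      fix q assume q: "dist q p < 1 / 2 ^ n"
      obtain u' t' where q': "q = (u', t')" by fastforce
      have "dist u' u \<le> dist q p" "dist t' t \<le> dist q p"
        using dist_fst_le[of q p] dist_snd_le[of q p] by (simp_all add: p q')
      hence c: "\<bar>u' - u\<bar> < 1 / 2 ^ n" "\<bar>t' - t\<bar> < 1 / 2 ^ n" using q by (simp_all add: dist_real_def)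
      have "1 / 2 ^ n \<le> (1 :: real)" by simp
      hence b: "\<bar>u'\<bar> \<le> real N" "\<bar>t'\<bar> \<le> real N" "\<bar>u\<bar> \<le> real N" "\<bar>t\<bar> \<le> real N" using c N by linarith+
      have "\<bar>z q - z p\<bar> \<le> \<bar>z q - X n q\<bar> + \<bar>X n q - X n p\<bar> + \<bar>z p - X n p\<bar>" by linarith
      also have "\<dots> \<le> K * r ^ n / (1 - r) + K * r ^ n + K * r ^ n / (1 - r)"
        unfolding p q' by (intro add_mono lim K2 b c)
      also have "\<dots> = L * r ^ n" unfolding L_def by (simp add: algebra_simps)
      finally show "dist (z q) (z p) < e" using n by (simp add: dist_real_def)
    qed simp
  qed
  thus ?thesis using z unfolding X_def by blast
qed

text \<open>
  The sixth moments of the increments over grid steps of size \<open>1 / 2 ^ n\<close> are of order \<open>1 / 8 ^ n\<close>, and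
  there are of order \<open>4 ^ n\<close> steps in a bounded region.  Hence their weighted sum over all levels has
  finite expectation, and where it is finite the increments decay geometrically.  The limit agrees
  with \<open>X\<close> because the approximations of a fixed point converge in \<open>L\<^sup>6\<close> at a summable rate.
\<close>

lemma (in prob_space) kolmogorov_continuous_modification:
  fixes X :: "real \<times> real \<Rightarrow> 'a \<Rightarrow> real"
  assumes [measurable]: "\<And>p. X p \<in> borel_measurable M"
    and int: "\<And>p q. integrable M (\<lambda>\<omega>. (X p \<omega> - X q \<omega>) ^ 6)"
    and mom: "\<And>u t v s. \<bar>u - v\<bar> \<le> 1 \<Longrightarrow> \<bar>t - s\<bar> \<le> 1 \<Longrightarrow>
      expectation (\<lambda>\<omega>. (X (u, t) \<omega> - X (v, s) \<omega>) ^ 6) \<le> C * (\<bar>u - v\<bar> + \<bar>t - s\<bar>) ^ 3"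
  shows "\<exists>Z :: real \<times> real \<Rightarrow> 'a \<Rightarrow> real. (\<forall>p. Z p \<in> borel_measurable M) \<and>
     (\<forall>p. AE \<omega> in M. Z p \<omega> = X p \<omega>) \<and> (\<forall>\<omega>\<in>space M. continuous_on UNIV (\<lambda>p. Z p \<omega>))"
proof -
  have p6: "0 \<le> (a :: real) ^ 6" for a by (rule zero_le_even_power) simp
  have "0 \<le> expectation (\<lambda>\<omega>. (X (0, 0) \<omega> - X (1, 0) \<omega>) ^ 6)"
    by (rule Bochner_Integration.integral_nonneg) (rule p6)
  also have "\<dots> \<le> C" using mom[of 0 1 0 0] by simp
  finally have C0: "0 \<le> C" .
  have nn: "(\<integral>\<^sup>+ \<omega>. ennreal ((X p \<omega> - X q \<omega>) ^ 6) \<partial>M) = ennreal (expectation (\<lambda>\<omega>. (X p \<omega> - X q \<omega>) ^ 6))" for p q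
    using int p6 by (intro nn_integral_eq_integral) auto
  define J where "J = (\<lambda>n N. {i::int. \<bar>i\<bar> \<le> int N * 2 ^ n} \<times> {j::int. \<bar>j\<bar> \<le> int N * 2 ^ n})"
  have Jint: "{i::int. \<bar>i\<bar> \<le> int N * 2 ^ n} = {- (int N * 2 ^ n)..int N * 2 ^ n}" for n N by auto
  have finJ: "finite (J n N)" for n N unfolding J_def Jint by auto
  have cardJ: "real (card (J n N)) \<le> (2 * real N + 1)\<^sup>2 * 4 ^ n" for n N
  proof -
    have "real (card {- (int N * 2 ^ n)..int N * 2 ^ n}) = 2 * (real N * 2 ^ n) + 1"
      by (simp add: nat_add_distrib nat_mult_distrib nat_power_eq)
    also have "\<dots> \<le> (2 * real N + 1) * 2 ^ n" by (simp add: distrib_right)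
    finally have "real (card {- (int N * 2 ^ n)..int N * 2 ^ n}) \<le> (2 * real N + 1) * 2 ^ n" .
    hence "(real (card {- (int N * 2 ^ n)..int N * 2 ^ n}))\<^sup>2 \<le> ((2 * real N + 1) * 2 ^ n)\<^sup>2"
      by (intro power_mono) auto
    also have "\<dots> = (2 * real N + 1)\<^sup>2 * 4 ^ n"
      by (simp add: power_mult_distrib power2_eq_square flip: power_mult_distrib)
    finally show ?thesis unfolding J_def Jint by (simp add: card_cartesian_product power2_eq_square)
  qed
  define h where "h = (\<lambda>n (i::int, j::int) \<omega>.
      (X (grid_point n i j) \<omega> - X (grid_point n (i + 1) j) \<omega>) ^ 6 +
      (X (grid_point n i j) \<omega> - X (grid_point n i (j + 1)) \<omega>) ^ 6)"
  have [measurable]: "h n k \<in> borel_measurable M" for n k unfolding h_def by (cases k) simp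
  have h0: "0 \<le> h n k \<omega>" for n k \<omega> unfolding h_def using p6 by (cases k) simp
  have Eh: "(\<integral>\<^sup>+ \<omega>. ennreal (h n k \<omega>) \<partial>M) \<le> ennreal (2 * C / 8 ^ n)" for n k
  proof -
    obtain i j where k: "k = (i, j)" by fastforce
    have c: "(1 / 2 ^ n) ^ 3 = 1 / (8::real) ^ n"
      by (simp add: power_divide power_mult[symmetric] mult.commute[of n]) (simp add: power_mult)
    have s: "\<bar>real_of_int i / 2 ^ n - real_of_int (i + 1) / 2 ^ n\<bar> = 1 / 2 ^ n" for i
      by (simp add: diff_divide_distrib[symmetric])
    have s1: "1 / 2 ^ n \<le> (1::real)" by simp
    have e1: "expectation (\<lambda>\<omega>. (X (grid_point n i j) \<omega> - X (grid_point n (i + 1) j) \<omega>) ^ 6) \<le> C / 8 ^ n"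
      unfolding grid_point_def using mom[of "of_int i / 2 ^ n" "of_int (i + 1) / 2 ^ n" "of_int j / 2 ^ n" "of_int j / 2 ^ n", unfolded s, OF s1]
      by (simp only: diff_self abs_zero zero_le_one add_0_right c) simp
    have e2: "expectation (\<lambda>\<omega>. (X (grid_point n i j) \<omega> - X (grid_point n i (j + 1)) \<omega>) ^ 6) \<le> C / 8 ^ n"
      unfolding grid_point_def using mom[of "of_int i / 2 ^ n" "of_int i / 2 ^ n" "of_int j / 2 ^ n" "of_int (j + 1) / 2 ^ n", unfolded s, OF _ s1]
      by (simp only: diff_self abs_zero zero_le_one add_0_left c) simp
    have "(\<integral>\<^sup>+ \<omega>. ennreal (h n k \<omega>) \<partial>M) = (\<integral>\<^sup>+ \<omega>. ennreal ((X (grid_point n i j) \<omega> - X (grid_point n (i + 1) j) \<omega>) ^ 6) +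
       ennreal ((X (grid_point n i j) \<omega> - X (grid_point n i (j + 1)) \<omega>) ^ 6) \<partial>M)"
      unfolding h_def k prod.case using p6 by (simp only: ennreal_plus)
    also have "\<dots> = (\<integral>\<^sup>+ \<omega>. ennreal ((X (grid_point n i j) \<omega> - X (grid_point n (i + 1) j) \<omega>) ^ 6) \<partial>M) +
       (\<integral>\<^sup>+ \<omega>. ennreal ((X (grid_point n i j) \<omega> - X (grid_point n i (j + 1)) \<omega>) ^ 6) \<partial>M)"
      by (intro nn_integral_add) measurable
    also have "\<dots> \<le> ennreal (C / 8 ^ n) + ennreal (C / 8 ^ n)"
      unfolding nn by (intro add_mono ennreal_leI e1 e2)
    also have "\<dots> = ennreal (2 * C / 8 ^ n)"
      using C0 by (simp add: ennreal_plus[symmetric] del: ennreal_plus)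
    finally show ?thesis .
  qed
  \<comment> \<open>any weight strictly between \<open>1\<close> and \<open>8 / 4 = 2\<close> will do\<close>
  define S where "S = (\<lambda>N \<omega>. \<Sum>n. ennreal ((3/2) ^ n * (\<Sum>k\<in>J n N. h n k \<omega>)))"
  have [measurable]: "S N \<in> borel_measurable M" for N unfolding S_def by measurable
  have "AE \<omega> in M. S N \<omega> \<noteq> \<infinity>" for N
  proof (rule nn_integral_noteq_infinite)
    define D where "D = (2 * real N + 1)\<^sup>2 * (2 * C)"
    have D0: "0 \<le> D" unfolding D_def using C0 by simp
    have Tn: "(\<integral>\<^sup>+ \<omega>. ennreal ((3/2) ^ n * (\<Sum>k\<in>J n N. h n k \<omega>)) \<partial>M) \<le> ennreal (D * (3/4) ^ n)" for n
    proof -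
      have "(\<integral>\<^sup>+ \<omega>. ennreal ((3/2) ^ n * (\<Sum>k\<in>J n N. h n k \<omega>)) \<partial>M) =
         (\<integral>\<^sup>+ \<omega>. ennreal ((3/2) ^ n) * (\<Sum>k\<in>J n N. ennreal (h n k \<omega>)) \<partial>M)"
        using h0 by (intro nn_integral_cong) (simp add: ennreal_mult sum_nonneg)
      also have "\<dots> = ennreal ((3/2) ^ n) * (\<Sum>k\<in>J n N. \<integral>\<^sup>+ \<omega>. ennreal (h n k \<omega>) \<partial>M)"
        by (simp add: nn_integral_cmult nn_integral_sum)
      also have "\<dots> \<le> ennreal ((3/2) ^ n) * (\<Sum>k\<in>J n N. ennreal (2 * C / 8 ^ n))"
        by (intro mult_left_mono sum_mono Eh) auto
      also have "(\<Sum>k\<in>J n N. ennreal (2 * C / 8 ^ n)) = ennreal (real (card (J n N)) * (2 * C / 8 ^ n))"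
        using C0 by (simp add: ennreal_mult[symmetric] ennreal_of_nat_eq_real_of_nat)
      also have "\<dots> \<le> ennreal ((2 * real N + 1)\<^sup>2 * 4 ^ n * (2 * C / 8 ^ n))"
        using C0 by (intro ennreal_leI mult_right_mono cardJ) auto
      also have "(2 * real N + 1)\<^sup>2 * 4 ^ n * (2 * C / 8 ^ n) = D * (1/2) ^ n"
      proof -
        have "(8::real) ^ n = 4 ^ n * 2 ^ n" by (simp flip: power_mult_distrib)
        thus ?thesis by (simp add: D_def power_divide)
      qed
      also have "ennreal ((3/2) ^ n) * ennreal (D * (1/2) ^ n) = ennreal (D * (3/4) ^ n)"
      proof -
        have "(3/2) ^ n * (D * (1/2) ^ n) = D * ((3/2) * (1/2)) ^ n" unfolding power_mult_distrib by simp
        thus ?thesis using D0 by (simp add: ennreal_mult[symmetric])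
      qed
      finally show ?thesis by (simp add: mult_left_mono)
    qed
    have "(\<integral>\<^sup>+ \<omega>. S N \<omega> \<partial>M) = (\<Sum>n. \<integral>\<^sup>+ \<omega>. ennreal ((3/2) ^ n * (\<Sum>k\<in>J n N. h n k \<omega>)) \<partial>M)"
      unfolding S_def by (intro nn_integral_suminf) measurable
    also have "\<dots> \<le> (\<Sum>n. ennreal (D * (3/4) ^ n))" by (intro suminf_le Tn) auto
    also have "\<dots> = ennreal (\<Sum>n. D * (3/4) ^ n)"
      using D0 by (intro suminf_ennreal2) (auto intro!: summable_mult summable_geometric)
    finally show "(\<integral>\<^sup>+ \<omega>. S N \<omega> \<partial>M) \<noteq> \<infinity>" by (auto simp: top_unique)
  qed measurable
  hence good: "AE \<omega> in M. \<forall>N. S N \<omega> \<noteq> \<infinity>" by (simp add: AE_all_countable)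
  define r where "r = root 6 (2/3)"
  have r: "0 < r" "r < 1" by (simp_all add: r_def)
  have chain: "\<exists>z. continuous_on UNIV z \<and>
    (\<forall>p. (\<lambda>n. X (dyadic_floor n (fst p), dyadic_floor n (snd p)) \<omega>) \<longlonglongrightarrow> z p)"
    if G: "\<forall>N. S N \<omega> \<noteq> \<infinity>" for \<omega>
  proof (rule dyadic_chaining[OF r])
    fix N :: nat
    obtain s where s: "0 \<le> s" "S N \<omega> = ennreal s" using G[rule_format, of N] by (cases "S N \<omega>") auto
    have r6: "root 6 (a ^ 6) = \<bar>a\<bar>" for a :: real
      using real_root_power_cancel[of 6 "\<bar>a\<bar>"] by (simp add: power_even_abs)
    have root6: "\<bar>a\<bar> \<le> root 6 s * r ^ n" if "a ^ 6 \<le> s * (2/3) ^ n" for a n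
    proof -
      have "\<bar>a\<bar> = root 6 (a ^ 6)" by (simp only: r6)
      also have "\<dots> \<le> root 6 (s * (2/3) ^ n)" using that by (simp only: real_root_le_iff[of 6] zero_less_numeral)
      also have "\<dots> = root 6 s * r ^ n" by (simp add: real_root_mult real_root_power r_def)
      finally show ?thesis .
    qed
    have hb: "h n k \<omega> \<le> s * (2/3) ^ n" if "k \<in> J n N" for n k
    proof -
      have "ennreal ((3/2) ^ n * (\<Sum>k\<in>J n N. h n k \<omega>)) = (\<Sum>n\<in>{n}. ennreal ((3/2) ^ n * (\<Sum>k\<in>J n N. h n k \<omega>)))" by simp
      also have "\<dots> \<le> S N \<omega>" unfolding S_def by (rule sum_le_suminf) auto
      finally have "(3/2) ^ n * (\<Sum>k\<in>J n N. h n k \<omega>) \<le> s" unfolding s(2) using s(1) by simp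
      moreover have "h n k \<omega> \<le> (\<Sum>k\<in>J n N. h n k \<omega>)" using that finJ h0 by (intro member_le_sum) auto
      hence "(3/2) ^ n * h n k \<omega> \<le> (3/2) ^ n * (\<Sum>k\<in>J n N. h n k \<omega>)" by (intro mult_left_mono) auto
      ultimately have "(3/2) ^ n * h n k \<omega> \<le> s" by linarith
      hence "(2/3) ^ n * ((3/2) ^ n * h n k \<omega>) \<le> (2/3) ^ n * s" by (intro mult_left_mono) auto
      moreover have "(2/3) ^ n * (3/2) ^ n = (1::real)" by (simp flip: power_mult_distrib)
      hence "(2/3) ^ n * ((3/2) ^ n * h n k \<omega>) = h n k \<omega>"
        by (simp only: mult.assoc[symmetric] mult_1)
      ultimately show ?thesis by (simp only: mult.commute[of s])
    qed
    show "\<exists>K. \<forall>n. \<forall>i j :: int. \<bar>i\<bar> \<le> int N * 2 ^ n \<longrightarrow> \<bar>j\<bar> \<le> int N * 2 ^ n \<longrightarrow>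
      \<bar>X (grid_point n i j) \<omega> - X (grid_point n (i + 1) j) \<omega>\<bar> \<le> K * r ^ n \<and>
      \<bar>X (grid_point n i j) \<omega> - X (grid_point n i (j + 1)) \<omega>\<bar> \<le> K * r ^ n"
    proof (intro exI[of _ "root 6 s"] allI impI)
      fix n :: nat and i j :: int assume "\<bar>i\<bar> \<le> int N * 2 ^ n" "\<bar>j\<bar> \<le> int N * 2 ^ n"
      hence "h n (i, j) \<omega> \<le> s * (2/3) ^ n" by (intro hb) (simp add: J_def)
      thus "\<bar>X (grid_point n i j) \<omega> - X (grid_point n (i + 1) j) \<omega>\<bar> \<le> root 6 s * r ^ n \<and>
      \<bar>X (grid_point n i j) \<omega> - X (grid_point n i (j + 1)) \<omega>\<bar> \<le> root 6 s * r ^ n"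
        unfolding h_def prod.case
        using p6[of "X (grid_point n i j) \<omega> - X (grid_point n (i + 1) j) \<omega>"]
          p6[of "X (grid_point n i j) \<omega> - X (grid_point n i (j + 1)) \<omega>"]
        by (intro conjI root6) linarith+
    qed
  qed
  define Z where "Z = (\<lambda>p \<omega>. if \<forall>N. S N \<omega> \<noteq> \<infinity> then
     lim (\<lambda>n. X (dyadic_floor n (fst p), dyadic_floor n (snd p)) \<omega>) else 0)"
  have [measurable]: "Z p \<in> borel_measurable M" for p
    unfolding Z_def by (intro measurable_If borel_measurable_lim_metric) measurable
  have "continuous_on UNIV (\<lambda>p. Z p \<omega>)" for \<omega>
  proof (cases "\<forall>N. S N \<omega> \<noteq> \<infinity>")
    case True
    then obtain z where z: "continuous_on UNIV z"
      "\<And>p. (\<lambda>n. X (dyadic_floor n (fst p), dyadic_floor n (snd p)) \<omega>) \<longlonglongrightarrow> z p" using chain by blast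
    have "(\<lambda>p. Z p \<omega>) = z" using True limI[OF z(2)] by (simp add: Z_def fun_eq_iff)
    with z(1) show ?thesis by (simp only:)
  next
    case False
    hence "(\<lambda>p. Z p \<omega>) = (\<lambda>p. 0)" unfolding Z_def by (intro ext if_not_P)
    thus ?thesis by (simp only: continuous_on_const)
  qed
  moreover have "AE \<omega> in M. Z p \<omega> = X p \<omega>" for p
  proof -
    define q where "q = (\<lambda>n. (dyadic_floor n (fst p), dyadic_floor n (snd p)))"
    have Eq: "(\<integral>\<^sup>+ \<omega>. ennreal ((X (q n) \<omega> - X p \<omega>) ^ 6) \<partial>M) \<le> ennreal (8 * C * (1/8) ^ n)" for n
    proof -
      have d: "\<bar>dyadic_floor n a - a\<bar> \<le> 1 / 2 ^ n" for a using dyadic_floor_bounds(1)[of n a] dyadic_floor_bounds(2)[of a n] by linarith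
      have "1 / 2 ^ n \<le> (1::real)" by simp
      hence d1: "\<bar>dyadic_floor n a - a\<bar> \<le> 1" for a using d[of a] by linarith
      have "expectation (\<lambda>\<omega>. (X (q n) \<omega> - X p \<omega>) ^ 6) \<le>
          C * (\<bar>dyadic_floor n (fst p) - fst p\<bar> + \<bar>dyadic_floor n (snd p) - snd p\<bar>) ^ 3"
        using mom[OF d1 d1, of "fst p" "snd p"] by (simp add: q_def)
      also have "\<dots> \<le> C * (1 / 2 ^ n + 1 / 2 ^ n) ^ 3"
        using C0 by (intro mult_left_mono power_mono add_mono d) auto
      also have "(1 / 2 ^ n + 1 / 2 ^ n :: real) ^ 3 = 8 * (1/8) ^ n"
      proof -
        have "(1 / 2 ^ n + 1 / 2 ^ n :: real) ^ 3 = (2 * (1/2) ^ n) ^ 3" by (simp add: power_divide)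
        also have "\<dots> = 8 * (1/2) ^ (n * 3)" by (simp add: power_mult_distrib power_mult)
        also have "(1/2 :: real) ^ (n * 3) = (1/8) ^ n" unfolding mult.commute[of n] power_mult by (simp add: power_divide)
        finally show ?thesis .
      qed
      finally show ?thesis unfolding nn by (intro ennreal_leI) simp
    qed
    have "AE \<omega> in M. (\<Sum>n. ennreal ((X (q n) \<omega> - X p \<omega>) ^ 6)) \<noteq> \<infinity>"
    proof (rule nn_integral_noteq_infinite)
      have "(\<integral>\<^sup>+ \<omega>. (\<Sum>n. ennreal ((X (q n) \<omega> - X p \<omega>) ^ 6)) \<partial>M) = (\<Sum>n. \<integral>\<^sup>+ \<omega>. ennreal ((X (q n) \<omega> - X p \<omega>) ^ 6) \<partial>M)"
        by (intro nn_integral_suminf) measurable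
      also have "\<dots> \<le> (\<Sum>n. ennreal (8 * C * (1/8) ^ n))" by (intro suminf_le Eq) auto
      also have "\<dots> = ennreal (\<Sum>n. 8 * C * (1/8) ^ n)"
        using C0 by (intro suminf_ennreal2) (auto intro!: summable_mult summable_geometric)
      finally show "(\<integral>\<^sup>+ \<omega>. (\<Sum>n. ennreal ((X (q n) \<omega> - X p \<omega>) ^ 6)) \<partial>M) \<noteq> \<infinity>" by (auto simp: top_unique)
    qed measurable
    with good show ?thesis
    proof eventually_elim
      case (elim \<omega>)
      have "summable (\<lambda>n. (X (q n) \<omega> - X p \<omega>) ^ 6)"
        by (rule summable_suminf_not_top[OF p6]) (use elim(2) in \<open>simp only: infinity_ennreal_def not_False_eq_True\<close>)
      hence "(\<lambda>n. (X (q n) \<omega> - X p \<omega>) ^ 6) \<longlonglongrightarrow> 0" by (rule summable_LIMSEQ_zero)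
      hence "(\<lambda>n. root 6 ((X (q n) \<omega> - X p \<omega>) ^ 6)) \<longlonglongrightarrow> root 6 0" by (rule tendsto_real_root)
      moreover have "root 6 (a ^ 6) = \<bar>a\<bar>" for a :: real
        using real_root_power_cancel[of 6 "\<bar>a\<bar>"] by (simp add: power_even_abs)
      ultimately have "(\<lambda>n. \<bar>X (q n) \<omega> - X p \<omega>\<bar>) \<longlonglongrightarrow> 0" by simp
      hence "(\<lambda>n. X (q n) \<omega> - X p \<omega>) \<longlonglongrightarrow> 0" by (rule tendsto_rabs_zero_cancel)
      hence "(\<lambda>n. X (q n) \<omega>) \<longlonglongrightarrow> X p \<omega>" by (rule LIM_zero_cancel)
      hence "lim (\<lambda>n. X (q n) \<omega>) = X p \<omega>" by (rule limI)
      thus ?case using elim(1) by (simp add: Z_def q_def)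
    qed
  qed
  ultimately show ?thesis by (intro exI[of _ Z]) auto
qed

section \<open>The Borel sets of the path space\<close>

lemma upath_norm_leI:
  assumes "\<And>t. \<bar>upath_apply x t\<bar> \<le> C * logw t"
  shows "norm x \<le> C"
  unfolding norm_upath_def
proof (rule cSUP_least)
  fix t
  show "\<bar>upath_apply x t\<bar> / ln (exp 1 + \<bar>t\<bar>) \<le> C"
    using assms[of t] logw_pos[of t] by (simp add: pos_divide_le_eq)
qed simp

lemma upath_eval_bounded_linear: "bounded_linear (\<lambda>x. upath_apply x t)"
proof (rule bounded_linear_intro)
  show "norm (upath_apply x t) \<le> norm x * logw t" for x
    using upath_log_bound[of x t] by simp
qed (simp_all add: upath_rep_simps)

lemma upath_eval_measurable [measurable]: "(\<lambda>x. upath_apply x t) \<in> borel_measurable borel"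
  by (intro borel_measurable_continuous_onI linear_continuous_on upath_eval_bounded_linear)

text \<open>
  A path is determined up to \<open>3 * e\<close> by finitely many integers: a cutoff, a mesh, and its values on
  the mesh rounded to multiples of \<open>e\<close>. Since there are countably many such codes, the space is separable.
\<close>

lemma upath_codes:
  assumes e: "0 < (e::real)"
  shows "\<exists>code :: upath \<Rightarrow> nat \<times> nat \<times> int list. \<forall>x y. code x = code y \<longrightarrow> norm (x - y) \<le> 3 * e"
proof -
  have "\<exists>M n :: nat. 0 < n \<and> (\<forall>t. real M \<le> \<bar>t\<bar> \<longrightarrow> \<bar>upath_apply x t\<bar> \<le> e * logw t) \<and>
     (\<forall>s t. s \<in> {- real M..real M} \<longrightarrow> t \<in> {- real M..real M} \<longrightarrow> \<bar>s - t\<bar> \<le> 1 / real n \<longrightarrow>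
        \<bar>upath_apply x s - upath_apply x t\<bar> \<le> e)" for x
  proof -
    have "((\<lambda>t. upath_apply x t / logw t) \<longlongrightarrow> 0) at_infinity"
      using upath_apply[of x] by (simp add: lim_logw_iff)
    hence "\<forall>\<^sub>F t in at_infinity. norm (upath_apply x t / logw t) < e"
      using tendstoD[OF _ e] by fastforce
    then obtain b where b: "\<And>t. b \<le> norm t \<Longrightarrow> norm (upath_apply x t / logw t) < e"
      unfolding eventually_at_infinity by auto
    obtain M :: nat where M: "b \<le> real M" using real_arch_simple by blast
    have "\<bar>upath_apply x t\<bar> \<le> e * logw t" if "real M \<le> \<bar>t\<bar>" for t
    proof -
      have "norm (upath_apply x t / logw t) < e" using that M by (intro b) auto
      hence "\<bar>upath_apply x t\<bar> / logw t < e" using logw_pos[of t] by (simp add: abs_divide)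
      thus ?thesis using logw_pos[of t] by (simp add: pos_divide_less_eq less_imp_le)
    qed
    moreover have "uniformly_continuous_on {- real M..real M} (upath_apply x)"
      by (intro compact_uniformly_continuous continuous_on_subset[OF upath_continuous]) auto
    then obtain d where d: "0 < d" "\<And>s t. s \<in> {- real M..real M} \<Longrightarrow> t \<in> {- real M..real M} \<Longrightarrow> dist t s < d \<Longrightarrow>
        dist (upath_apply x t) (upath_apply x s) < e"
      unfolding uniformly_continuous_on_def using e by meson
    obtain n :: nat where n: "0 < n" "inverse (real n) < d" using ex_inverse_of_nat_less[OF d(1)] by blast
    have "\<bar>upath_apply x s - upath_apply x t\<bar> \<le> e"
      if "s \<in> {- real M..real M}" "t \<in> {- real M..real M}" "\<bar>s - t\<bar> \<le> 1 / real n" for s t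
    proof -
      have "dist s t < d" using that(3) n(2) by (simp add: dist_real_def inverse_eq_divide)
      thus ?thesis using d(2)[OF that(2,1)] by (simp add: dist_real_def)
    qed
    ultimately show ?thesis using n(1) by blast
  qed
  then obtain M n where n: "\<And>x. 0 < (n x :: nat)"
    and out: "\<And>x t. real (M x) \<le> \<bar>t\<bar> \<Longrightarrow> \<bar>upath_apply x t\<bar> \<le> e * logw t"
    and uc: "\<And>x s t. s \<in> {- real (M x)..real (M x)} \<Longrightarrow> t \<in> {- real (M x)..real (M x)} \<Longrightarrow> \<bar>s - t\<bar> \<le> 1 / real (n x) \<Longrightarrow>
        \<bar>upath_apply x s - upath_apply x t\<bar> \<le> e"
    by metis
  define code where "code = (\<lambda>x. (M x, n x,
    map (\<lambda>i. \<lfloor>upath_apply x (of_int i / real (n x)) / e\<rfloor>) [- int (M x * n x)..int (M x * n x)]))"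
  have "norm (x - y) \<le> 3 * e" if c: "code x = code y" for x y
  proof (rule upath_norm_leI)
    fix t
    have eq: "M y = M x" "n y = n x" using c by (auto simp: code_def)
    show "\<bar>upath_apply (x - y) t\<bar> \<le> 3 * e * logw t"
    proof (cases "real (M x) \<le> \<bar>t\<bar>")
      case True
      have "\<bar>upath_apply x t\<bar> \<le> e * logw t" "\<bar>upath_apply y t\<bar> \<le> e * logw t"
        using out[of x t] out[of y t] True eq by auto
      moreover have "0 \<le> e * logw t" using e logw_pos[of t] by simp
      ultimately show ?thesis by (simp add: upath_rep_simps)
    next
      case False
      define i where "i = \<lfloor>t * real (n x)\<rfloor>"
      define s where "s = of_int i / real (n x)"
      have np: "0 < real (n x)" using n[of x] by simp
      have i: "of_int i \<le> t * real (n x)" "t * real (n x) < of_int i + 1" unfolding i_def by linarith+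
      have st: "s \<le> t" "t - s \<le> 1 / real (n x)"
      proof -
        show "s \<le> t" using i(1) np unfolding s_def by (simp add: pos_divide_le_eq)
        have "t - s = (t * real (n x) - of_int i) / real (n x)"
          using np unfolding s_def by (simp add: diff_divide_distrib)
        also have "\<dots> \<le> 1 / real (n x)" using i(2) np by (intro divide_right_mono) auto
        finally show "t - s \<le> 1 / real (n x)" .
      qed
      have "- (real (M x) * real (n x)) \<le> t * real (n x)" "t * real (n x) \<le> real (M x) * real (n x)"
        using False mult_right_mono[of "- real (M x)" t "real (n x)"] mult_right_mono[of t "real (M x)" "real (n x)"] np
        by auto
      hence im: "- int (M x * n x) \<le> i" "i \<le> int (M x * n x)"
        unfolding i_def by (simp_all add: le_floor_iff floor_le_iff)
      have sM: "s \<in> {- real (M x)..real (M x)}"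
      proof -
        have "real_of_int (- int (M x * n x)) \<le> of_int i" "real_of_int i \<le> of_int (int (M x * n x))"
          using im by (simp_all only: of_int_le_iff)
        thus ?thesis using np unfolding s_def by (simp add: field_simps)
      qed
      have tM: "t \<in> {- real (M x)..real (M x)}" using False by auto
      have "map (\<lambda>i. \<lfloor>upath_apply x (of_int i / real (n x)) / e\<rfloor>) [- int (M x * n x)..int (M x * n x)] =
         map (\<lambda>i. \<lfloor>upath_apply y (of_int i / real (n x)) / e\<rfloor>) [- int (M x * n x)..int (M x * n x)]"
        using c eq by (simp add: code_def)
      hence "\<lfloor>upath_apply x s / e\<rfloor> = \<lfloor>upath_apply y s / e\<rfloor>"
        using im unfolding map_eq_conv s_def by auto
      hence "\<bar>upath_apply x s / e - upath_apply y s / e\<bar> < 1" by linarith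
      hence "\<bar>upath_apply x s - upath_apply y s\<bar> < e"
        using e by (simp add: diff_divide_distrib[symmetric] abs_divide)
      moreover have "\<bar>upath_apply x t - upath_apply x s\<bar> \<le> e" using st by (intro uc tM sM) auto
      moreover have "\<bar>upath_apply y t - upath_apply y s\<bar> \<le> e" 
        using st tM sM eq by (intro uc) auto
      ultimately have "\<bar>upath_apply x t - upath_apply y t\<bar> \<le> 3 * e" by linarith
      also have "\<dots> \<le> 3 * e * logw t" using e logw_ge_1[of t] by simp
      finally show ?thesis by (simp add: upath_rep_simps)
    qed
  qed
  thus ?thesis by blast
qed

lemma upath_separable: "\<exists>D :: upath set. countable D \<and> (\<forall>x. \<forall>e>0. \<exists>d\<in>D. dist d x < e)"
proof -
  have "\<exists>code :: upath \<Rightarrow> nat \<times> nat \<times> int list. \<forall>x y. code x = code y \<longrightarrow> norm (x - y) \<le> 3 * inverse (real (Suc m))" for m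
    by (rule upath_codes) simp
  then obtain code :: "nat \<Rightarrow> upath \<Rightarrow> nat \<times> nat \<times> int list"
    where code: "\<And>m x y. code m x = code m y \<Longrightarrow> norm (x - y) \<le> 3 * inverse (real (Suc m))" by metis
  define D where "D = (\<Union>m. (\<lambda>c. SOME x. code m x = c) ` UNIV)"
  have "countable D" unfolding D_def by (intro countable_UN countable_image) auto
  moreover have "\<exists>d\<in>D. dist d x < e" if e: "0 < e" for x e
  proof -
    obtain m where m: "inverse (real (Suc m)) < e / 3" using reals_Archimedean[of "e / 3"] e by auto
    define d where "d = (SOME y. code m y = code m x)"
    have "code m d = code m x" unfolding d_def by (rule someI[of _ x]) simp
    hence "dist d x < e" using code[of m d x] m by (simp add: dist_norm)
    moreover have "d \<in> D" unfolding D_def d_def by blast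
    ultimately show ?thesis by blast
  qed
  ultimately show ?thesis by blast
qed

lemma upath_cball_eval: "cball x r = (\<Inter>t\<in>\<rat>. {y. \<bar>upath_apply x t - upath_apply y t\<bar> \<le> r * logw t})"
proof (intro set_eqI iffI)
  fix y assume "y \<in> cball x r"
  hence "norm (x - y) \<le> r" by (simp add: dist_norm)
  hence "\<bar>upath_apply (x - y) t\<bar> \<le> r * logw t" for t
    using upath_log_bound[of "x - y" t] logw_pos[of t] by (meson less_imp_le mult_right_mono order_trans)
  thus "y \<in> (\<Inter>t\<in>\<rat>. {y. \<bar>upath_apply x t - upath_apply y t\<bar> \<le> r * logw t})"
    by (simp add: upath_rep_simps)
next
  fix y assume y: "y \<in> (\<Inter>t\<in>\<rat>. {y. \<bar>upath_apply x t - upath_apply y t\<bar> \<le> r * logw t})"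
  have "norm (x - y) \<le> r"
  proof (rule upath_norm_leI)
    fix t
    define F where "F = {t. \<bar>upath_apply (x - y) t\<bar> \<le> r * logw t}"
    have "closed F" unfolding F_def
      by (intro closed_Collect_le continuous_on_rabs upath_continuous continuous_on_mult
          continuous_on_const continuous_on_logw)
    moreover have "\<rat> \<subseteq> F" using y by (auto simp: F_def upath_rep_simps)
    ultimately have "closure \<rat> \<subseteq> F" by (simp add: closure_minimal)
    thus "\<bar>upath_apply (x - y) t\<bar> \<le> r * logw t" by (auto simp: Rats_closure_real F_def)
  qed
  thus "y \<in> cball x r" by (simp add: dist_norm)
qed

text \<open>
  Closed balls are cut out by countably many evaluations, and by separability every open set is a
  countable union of closed balls.
\<close>

lemma borel_upath_eval:
  "sets (borel :: upath measure) \<subseteq> sets (vimage_algebra UNIV upath_apply (PiM UNIV (\<lambda>_. borel)))"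
proof -
  let ?V = "vimage_algebra UNIV upath_apply (PiM UNIV (\<lambda>_. borel)) :: upath measure"
  have ev [measurable]: "(\<lambda>y. upath_apply y t) \<in> measurable ?V borel" for t
  proof -
    have "upath_apply \<in> measurable ?V (PiM UNIV (\<lambda>_. borel))"
      by (rule measurable_vimage_algebra1) (auto simp: space_PiM)
    from measurable_compose[OF this measurable_component_singleton[of t]] show ?thesis by simp
  qed
  have cb: "cball x r \<in> sets ?V" for x r
  proof -
    have "{y \<in> space ?V. \<bar>upath_apply x t - upath_apply y t\<bar> \<le> r * logw t} \<in> sets ?V" for t by measurable
    thus ?thesis unfolding upath_cball_eval using sets.top[of ?V]
      by (intro sets.countable_INT'') (auto simp: countable_rat)
  qed
  obtain D :: "upath set" where D: "countable D" "\<And>x e. 0 < e \<Longrightarrow> \<exists>d\<in>D. dist d x < e"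
    using upath_separable by blast
  have "S \<in> sets ?V" if S: "open S" for S :: "upath set"
  proof -
    define I where "I = {(d, m :: nat). d \<in> D \<and> cball d (inverse (real (Suc m))) \<subseteq> S}"
    have "I \<subseteq> D \<times> UNIV" by (auto simp: I_def)
    hence "countable I" using D(1) by (meson countable_SIGMA countable_subset countableI_type)
    have "S = (\<Union>(d, m)\<in>I. cball d (inverse (real (Suc m))))"
    proof (intro equalityI subsetI)
      fix x assume "x \<in> S"
      then obtain e where e: "0 < e" "ball x e \<subseteq> S" using S open_contains_ball by blast
      obtain m where m: "inverse (real (Suc m)) < e / 2" using reals_Archimedean[of "e / 2"] e by auto
      obtain d where d: "d \<in> D" "dist d x < inverse (real (Suc m))" using D(2)[of "inverse (real (Suc m))"] by auto
      have "cball d (inverse (real (Suc m))) \<subseteq> ball x e"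
      proof
        fix y assume "y \<in> cball d (inverse (real (Suc m)))"
        thus "y \<in> ball x e" using d(2) m dist_triangle[of x y d] by (simp add: dist_commute)
      qed
      hence "(d, m) \<in> I" using d e by (auto simp: I_def)
      moreover have "x \<in> cball d (inverse (real (Suc m)))" using d(2) by simp
      ultimately show "x \<in> (\<Union>(d, m)\<in>I. cball d (inverse (real (Suc m))))" by blast
    qed (auto simp: I_def)
    moreover have "(\<Union>(d, m)\<in>I. cball d (inverse (real (Suc m)))) \<in> sets ?V"
      using cb by (intro sets.countable_UN'[OF \<open>countable I\<close>]) auto
    ultimately show ?thesis by simp
  qed
  hence "sigma_sets UNIV {S :: upath set. open S} \<subseteq> sets ?V"
    using sets.top[of ?V] by (intro sets.sigma_sets_subset') auto
  thus ?thesis by (simp only: sets_borel)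
qed

lemma upath_apply_PiM_measurable [measurable]:
  "upath_apply \<in> measurable borel (PiM UNIV (\<lambda>_. borel))"
  by (rule measurable_PiM_single') auto

theorem upath_measure_eqI:
  assumes M: "sets M = sets (borel :: upath measure)" and N: "sets N = sets (borel :: upath measure)"
    and eq: "distr M (PiM UNIV (\<lambda>_. borel)) upath_apply = distr N (PiM UNIV (\<lambda>_. borel)) upath_apply"
  shows "M = N"
proof (rule measure_eqI)
  show "sets M = sets N" using M N by simp
  have meas: "upath_apply \<in> measurable K (PiM UNIV (\<lambda>_. borel))" if "sets K = sets (borel :: upath measure)" for K
    using upath_apply_PiM_measurable measurable_cong_sets[OF that refl] by blast
  fix A assume "A \<in> sets M"
  hence "A \<in> sets (vimage_algebra UNIV upath_apply (PiM UNIV (\<lambda>_. borel)))"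
    using borel_upath_eval M by blast
  then obtain B where B: "B \<in> sets (PiM UNIV (\<lambda>_. borel))" "A = upath_apply -` B"
    by (subst (asm) sets_vimage_algebra2) (auto simp: space_PiM)
  have "emeasure K A = emeasure (distr K (PiM UNIV (\<lambda>_. borel)) upath_apply) B"
    if K: "sets K = sets (borel :: upath measure)" for K
    using emeasure_distr[OF meas[OF K] B(1)] sets_eq_imp_space_eq[OF K] by (simp add: B(2))
  thus "emeasure M A = emeasure N A" using M N eq by simp
qed

section \<open>Density of trigonometric polynomials\<close>

inductive trig_polynomial :: "(real \<Rightarrow> complex) \<Rightarrow> bool" where
  trig_exp: "trig_polynomial (\<lambda>l. c * exp (\<i> * complex_of_real (l * s)))"
| trig_add: "trig_polynomial p \<Longrightarrow> trig_polynomial q \<Longrightarrow> trig_polynomial (\<lambda>l. p l + q l)"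

lemma trig_const: "trig_polynomial (\<lambda>l. c)"
  using trig_exp[of c 0] by simp

lemma trig_mult:
  assumes "trig_polynomial p" "trig_polynomial q"
  shows "trig_polynomial (\<lambda>l. p l * q l)"
  using assms(1)
proof induction
  case (trig_exp c s)
  from assms(2) show ?case
  proof induction
    case (trig_exp d t)
    have "(\<lambda>l. c * exp (\<i> * complex_of_real (l * s)) * (d * exp (\<i> * complex_of_real (l * t)))) =
        (\<lambda>l. (c * d) * exp (\<i> * complex_of_real (l * (s + t))))"
    proof
      fix l
      have "exp (\<i> * complex_of_real (l * (s + t))) = exp (\<i> * complex_of_real (l * s)) * exp (\<i> * complex_of_real (l * t))"
        by (simp add: exp_add[symmetric] algebra_simps)
      thus "c * exp (\<i> * complex_of_real (l * s)) * (d * exp (\<i> * complex_of_real (l * t))) =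
        (c * d) * exp (\<i> * complex_of_real (l * (s + t)))" by (simp only: ac_simps)
    qed
    thus ?case using trig_polynomial.trig_exp[of "c * d" "s + t"] by (simp only:)
  next
    case (trig_add p q)
    from trig_polynomial.trig_add[OF trig_add.IH] show ?case by (simp only: distrib_left)
  qed
next
  case (trig_add p' q')
  from trig_polynomial.trig_add[OF trig_add.IH] show ?case by (simp only: distrib_right)
qed

lemma trig_power: "trig_polynomial p \<Longrightarrow> trig_polynomial (\<lambda>l. p l ^ n)"
  by (induction n) (auto intro: trig_const trig_mult)

lemma trig_sum: "(\<And>i. i \<in> A \<Longrightarrow> trig_polynomial (p i)) \<Longrightarrow> trig_polynomial (\<lambda>l. \<Sum>i\<in>A. p i l)"
  by (induction A rule: infinite_finite_induct) (auto intro: trig_const trig_add)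

lemma trig_sin: "trig_polynomial (\<lambda>l. complex_of_real (sin (b * l)))"
proof -
  have "(\<lambda>l. complex_of_real (sin (b * l))) = (\<lambda>l. (1 / (2 * \<i>)) * exp (\<i> * complex_of_real (l * b)) +
      (- 1 / (2 * \<i>)) * exp (\<i> * complex_of_real (l * - b)))"
  proof
    fix l
    have "complex_of_real (sin (b * l)) = sin (complex_of_real (b * l))" by (simp only: sin_of_real)
    also have "\<dots> = (1 / (2 * \<i>)) * exp (\<i> * complex_of_real (l * b)) +
      (- 1 / (2 * \<i>)) * exp (\<i> * complex_of_real (l * - b))"
      unfolding sin_exp_eq by (simp add: diff_divide_distrib right_diff_distrib mult.commute[of b])
    finally show "complex_of_real (sin (b * l)) = (1 / (2 * \<i>)) * exp (\<i> * complex_of_real (l * b)) +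
      (- 1 / (2 * \<i>)) * exp (\<i> * complex_of_real (l * - b))" .
  qed
  thus ?thesis using trig_add[OF trig_exp[of "1 / (2 * \<i>)" b] trig_exp[of "- 1 / (2 * \<i>)" "- b"]] by (simp only:)
qed

lemma trig_polynomial_sum_form:
  assumes "trig_polynomial p"
  shows "\<exists>F c. finite F \<and> p = (\<lambda>l. \<Sum>s\<in>F. c s * exp (\<i> * complex_of_real (l * s)))"
  using assms
proof induction
  case (trig_exp c s)
  show ?case by (intro exI[of _ "{s}"] exI[of _ "\<lambda>_. c"]) simp
next
  case (trig_add p q)
  then obtain F c G d where F: "finite F" "p = (\<lambda>l. \<Sum>s\<in>F. c s * exp (\<i> * complex_of_real (l * s)))"
    and G: "finite G" "q = (\<lambda>l. \<Sum>s\<in>G. d s * exp (\<i> * complex_of_real (l * s)))" by blast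
  define a where "a = (\<lambda>s. (if s \<in> F then c s else 0) + (if s \<in> G then d s else 0))"
  have "(\<Sum>s\<in>F \<union> G. a s * z s) = (\<Sum>s\<in>F. c s * z s) + (\<Sum>s\<in>G. d s * z s)" for z
  proof -
    have "(\<Sum>s\<in>F \<union> G. a s * z s) = (\<Sum>s\<in>F \<union> G. if s \<in> F then c s * z s else 0) + (\<Sum>s\<in>F \<union> G. if s \<in> G then d s * z s else 0)"
      unfolding sum.distrib[symmetric] by (intro sum.cong refl) (auto simp: a_def distrib_right)
    also have "(\<Sum>s\<in>F \<union> G. if s \<in> F then c s * z s else 0) = (\<Sum>s\<in>F. c s * z s)"
      using F(1) G(1) by (simp add: sum.If_cases Int_absorb1)
    also have "(\<Sum>s\<in>F \<union> G. if s \<in> G then d s * z s else 0) = (\<Sum>s\<in>G. d s * z s)"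
      using F(1) G(1) by (simp add: sum.If_cases Int_absorb1)
    finally show ?thesis .
  qed
  thus ?case using F G by (intro exI[of _ "F \<union> G"] exI[of _ a]) auto
qed

text \<open>
  On \<open>[-L, L]\<close> the substitution \<open>y = sin (pi l / (2 L))\<close> is invertible, so a polynomial in \<open>y\<close> close to
  \<open>\<phi>\<close> there is a trigonometric polynomial; as \<open>y\<close> stays in \<open>[-1, 1]\<close>, it is bounded on the whole line.
\<close>

theorem trig_polynomials_dense:
  fixes \<phi> :: "real \<Rightarrow> complex"
  assumes \<mu>: "finite_measure \<mu>" and [measurable_cong]: "sets \<mu> = sets borel"
    and cont: "continuous_on UNIV \<phi>" and bd: "\<And>l. cmod (\<phi> l) \<le> C" and e: "0 < e"
  shows "\<exists>F c. finite F \<and> (LINT l|\<mu>. (cmod (\<phi> l - (\<Sum>s\<in>F. c s * exp (\<i> * complex_of_real (l * s)))))\<^sup>2) < e"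
proof -
  interpret finite_measure \<mu> by fact
  have C0: "0 \<le> C" using bd[of 0] norm_ge_zero order_trans by blast
  have [measurable]: "\<phi> \<in> borel_measurable borel" by (rule borel_measurable_continuous_onI[OF cont])
  define m where "m = measure \<mu> UNIV"
  have m0: "0 \<le> m" by (simp add: m_def)
  define D where "D = (2 * C + 1)\<^sup>2"
  have D0: "0 < D" unfolding D_def using C0 by simp
  have "(\<lambda>n. measure \<mu> {l. real n < \<bar>l\<bar>}) \<longlonglongrightarrow> measure \<mu> (\<Inter>n. {l. real n < \<bar>l\<bar>})"
    by (rule finite_Lim_measure_decseq) (auto simp: decseq_def)
  also have "(\<Inter>n. {l. real n < \<bar>l\<bar>}) = {}"
  proof -
    have "\<exists>n. \<not> real n < \<bar>l\<bar>" for l using real_arch_simple[of "\<bar>l\<bar>"] by (simp add: not_less)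
    thus ?thesis by auto
  qed
  finally have "(\<lambda>n. measure \<mu> {l. real n < \<bar>l\<bar>}) \<longlonglongrightarrow> 0" by simp
  hence "\<forall>\<^sub>F n in sequentially. measure \<mu> {l. real n < \<bar>l\<bar>} < e / (2 * D)"
    using e D0 by (intro order_tendstoD(2)) auto
  hence "\<forall>\<^sub>F n in sequentially. measure \<mu> {l. real n < \<bar>l\<bar>} < e / (2 * D) \<and> 0 < n"
    using eventually_gt_at_top[of 0] by eventually_elim auto
  then obtain n where n: "measure \<mu> {l. real n < \<bar>l\<bar>} < e / (2 * D)" "0 < n"
    unfolding eventually_sequentially by blast
  define L where "L = real n"
  have L: "0 < L" "measure \<mu> {l. L < \<bar>l\<bar>} < e / (2 * D)" using n by (auto simp: L_def)
  define b where "b = pi / (2 * L)"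
  define \<psi> where "\<psi> = (\<lambda>y. \<phi> (arcsin y / b))"
  have b: "0 < b" using L by (simp add: b_def)
  have cp: "continuous_on {-1..1} \<psi>" unfolding \<psi>_def
    using b by (intro continuous_on_compose2[OF cont] continuous_intros) auto
  define d where "d = min (1/2) (e / (8 * (m + 1)))"
  have d: "0 < d" "d \<le> 1/2" "d \<le> e / (8 * (m + 1))"
  proof -
    show "0 < d" using e m0 by (simp add: d_def)
    show "d \<le> 1/2" "d \<le> e / (8 * (m + 1))" unfolding d_def by (rule min.cobounded1 min.cobounded2)+
  qed
  have approx: "\<exists>a k. \<forall>y\<in>{-1..1}. \<bar>f y - (\<Sum>i\<le>k. a i * y ^ i)\<bar> < d" if cf: "continuous_on {-1..1} f" for f :: "real \<Rightarrow> real"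
  proof -
    obtain g where g: "real_polynomial_function g" "\<And>x. x \<in> {-1..1} \<Longrightarrow> \<bar>f x - g x\<bar> < d"
      using Stone_Weierstrass_real_polynomial_function[OF compact_Icc cf d(1)] by blast
    then obtain a k where "g = (\<lambda>x. \<Sum>i\<le>k. a i * x ^ i)" using real_polynomial_function_iff_sum by blast
    thus ?thesis using g(2) by (intro exI[of _ a] exI[of _ k]) simp
  qed
  obtain a k where a: "\<And>y. y \<in> {-1..1} \<Longrightarrow> \<bar>Re (\<psi> y) - (\<Sum>i\<le>k. a i * y ^ i)\<bar> < d"
    using approx[OF continuous_on_Re[OF cp]] by blast
  obtain a' k' where a': "\<And>y. y \<in> {-1..1} \<Longrightarrow> \<bar>Im (\<psi> y) - (\<Sum>i\<le>k'. a' i * y ^ i)\<bar> < d"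
    using approx[OF continuous_on_Im[OF cp]] by blast
  define P where "P = (\<lambda>y. complex_of_real (\<Sum>i\<le>k. a i * y ^ i) + \<i> * complex_of_real (\<Sum>i\<le>k'. a' i * y ^ i))"
  have P: "cmod (\<psi> y - P y) \<le> 2 * d" if "y \<in> {-1..1}" for y
  proof -
    have "cmod (\<psi> y - P y) \<le> \<bar>Re (\<psi> y - P y)\<bar> + \<bar>Im (\<psi> y - P y)\<bar>" by (rule cmod_le)
    also have "\<dots> \<le> d + d" using a[OF that] a'[OF that] by (intro add_mono) (auto simp: P_def less_imp_le)
    finally show ?thesis by simp
  qed
  define p where "p = (\<lambda>l. P (sin (b * l)))"
  have "trig_polynomial (\<lambda>l. (\<Sum>i\<le>k. complex_of_real (a i) * complex_of_real (sin (b * l)) ^ i) +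
      \<i> * (\<Sum>i\<le>k'. complex_of_real (a' i) * complex_of_real (sin (b * l)) ^ i))"
    by (intro trig_add trig_mult trig_const trig_sum trig_power trig_sin)
  hence "trig_polynomial p" by (simp add: p_def P_def)
  then obtain F c where F: "finite F" "p = (\<lambda>l. \<Sum>s\<in>F. c s * exp (\<i> * complex_of_real (l * s)))"
    using trig_polynomial_sum_form by blast
  have [measurable]: "p \<in> borel_measurable borel"
    unfolding p_def P_def by (intro borel_measurable_continuous_onI continuous_intros)
  have yb: "sin (b * l) \<in> {-1..1}" for l by simp
  have inside: "cmod (\<phi> l - p l) \<le> 2 * d" if "\<bar>l\<bar> \<le> L" for l
  proof -
    have "\<bar>b * l\<bar> \<le> b * L" using b that by (simp add: abs_mult)
    also have "b * L = pi / 2" using L by (simp add: b_def)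
    finally have "arcsin (sin (b * l)) = b * l" by (intro arcsin_sin) auto
    hence "\<psi> (sin (b * l)) = \<phi> l" using b by (simp add: \<psi>_def)
    thus ?thesis using P[OF yb[of l]] by (simp add: p_def)
  qed
  have all: "cmod (\<phi> l - p l) \<le> 2 * C + 1" for l
  proof -
    have "cmod (\<phi> l - p l) \<le> cmod (\<phi> l) + cmod (\<psi> (sin (b * l)) - p l) + cmod (\<psi> (sin (b * l)))"
      using norm_triangle_ineq4[of "\<phi> l" "p l"] norm_triangle_sub[of "p l" "\<psi> (sin (b * l))"]
      by (simp add: norm_minus_commute)
    also have "\<dots> \<le> C + 2 * d + C"
      using bd P[OF yb[of l]] by (intro add_mono) (auto simp: \<psi>_def p_def)
    finally show ?thesis using d(2) by simp
  qed
  have "(LINT l|\<mu>. (cmod (\<phi> l - p l))\<^sup>2) \<le> (LINT l|\<mu>. 2 * d + D * indicator {l. L < \<bar>l\<bar>} l)"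
  proof (rule integral_mono)
    show "integrable \<mu> (\<lambda>l. (cmod (\<phi> l - p l))\<^sup>2)"
    proof (rule integrable_const_bound[of _ D])
      show "AE l in \<mu>. norm ((cmod (\<phi> l - p l))\<^sup>2) \<le> D"
        using all by (auto simp: D_def intro!: power_mono)
    qed measurable
    show "integrable \<mu> (\<lambda>l. 2 * d + D * indicator {l. L < \<bar>l\<bar>} l)"
      by (intro Bochner_Integration.integrable_add integrable_mult_right integrable_const integrable_real_indicator)
         (auto simp: less_top[symmetric])
    fix l
    show "(cmod (\<phi> l - p l))\<^sup>2 \<le> 2 * d + D * indicator {l. L < \<bar>l\<bar>} l"
    proof (cases "\<bar>l\<bar> \<le> L")
      case True
      have "(cmod (\<phi> l - p l))\<^sup>2 \<le> (2 * d)\<^sup>2" using inside[OF True] by (intro power_mono) auto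
      also have "(2 * d)\<^sup>2 \<le> 2 * d" using d by (simp add: power2_eq_square)
      finally show ?thesis using True by simp
    next
      case False
      have "(cmod (\<phi> l - p l))\<^sup>2 \<le> D" unfolding D_def using all by (intro power_mono) auto
      thus ?thesis using False d by simp
    qed
  qed
  also have "\<dots> = 2 * d * m + D * measure \<mu> {l. L < \<bar>l\<bar>}"
  proof -
    have "space \<mu> = UNIV" using sets_eq_imp_space_eq[OF assms(2)] by simp
    thus ?thesis
      by (subst Bochner_Integration.integral_add)
         (auto simp: m_def less_top[symmetric] intro!: integrable_mult_right integrable_real_indicator)
  qed
  also have "2 * d * m \<le> e / 4"
  proof -
    have "2 * d * m \<le> 2 * (e / (8 * (m + 1))) * (m + 1)"
      using d m0 e by (intro mult_mono) auto
    also have "\<dots> = e / 4"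
    proof -
      have "m + 1 \<noteq> 0" using m0 by simp
      thus ?thesis by (simp add: divide_simps)
    qed
    finally show ?thesis .
  qed
  also have "D * measure \<mu> {l. L < \<bar>l\<bar>} < e / 2"
    using L(2) D0 by (simp add: field_simps)
  finally have "(LINT l|\<mu>. (cmod (\<phi> l - p l))\<^sup>2) < e" using e by simp
  thus ?thesis using F by blast
qed

section \<open>Values of the Ornstein--Uhlenbeck path and the spectral representation\<close>

lemma abel_summation:
  fixes a b :: "nat \<Rightarrow> real"
  shows "(\<Sum>k<n. a k * b (Suc k)) = (\<Sum>i<n. (\<Sum>k=i..<n. a k) * (b (Suc i) - b i)) + (\<Sum>k<n. a k) * b 0"
proof (induction n)
  case (Suc n)
  have "(\<Sum>i<Suc n. (\<Sum>k=i..<Suc n. a k) * (b (Suc i) - b i)) =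
     (\<Sum>i<Suc n. (\<Sum>k=i..<n. a k) * (b (Suc i) - b i) + a n * (b (Suc i) - b i))"
    by (intro sum.cong refl) (simp add: distrib_right)
  also have "\<dots> = (\<Sum>i<Suc n. (\<Sum>k=i..<n. a k) * (b (Suc i) - b i)) + a n * (b (Suc n) - b 0)"
    by (simp only: sum.distrib sum_distrib_left[symmetric] sum_lessThan_telescope)
  also have "(\<Sum>i<Suc n. (\<Sum>k=i..<n. a k) * (b (Suc i) - b i)) = (\<Sum>i<n. (\<Sum>k=i..<n. a k) * (b (Suc i) - b i))"
    by simp
  finally show ?case using Suc by (simp add: algebra_simps)
qed simp

text \<open>
  Summation by parts rewrites the combination in terms of the independent increments between
  consecutive times, the first of which starts from \<open>B 0 = 0\<close>.
\<close>

lemma brownian_combination_gauss: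
  assumes BM: "standard_brownian_motion P B" and T: "finite T" "\<And>\<tau>. \<tau> \<in> T \<Longrightarrow> 0 < \<tau>"
  shows "\<exists>v. prob_space.gauss P (\<lambda>\<omega>. \<Sum>\<tau>\<in>T. d \<tau> * B \<tau> \<omega>) v"
proof -
  interpret prob_space P using BM by (simp add: standard_brownian_motion_def)
  have meas: "B t \<in> borel_measurable P" if "0 \<le> t" for t
    using BM that by (simp add: standard_brownian_motion_def)
  have B0: "AE \<omega> in P. B 0 \<omega> = 0" using BM by (simp add: standard_brownian_motion_def)
  define xs where "xs = sorted_list_of_set T"
  define n where "n = length xs"
  have xs: "sorted_wrt (<) xs" "set xs = T" "distinct xs"
    using T(1) by (simp_all add: xs_def)
  define \<tau> where "\<tau> = (\<lambda>i. case i of 0 \<Rightarrow> 0 | Suc k \<Rightarrow> xs ! k)"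
  have \<tau>0: "\<tau> 0 = 0" and \<tau>S: "\<And>k. \<tau> (Suc k) = xs ! k" by (simp_all add: \<tau>_def)
  have pos: "0 < xs ! k" if "k < n" for k using that T(2) xs(2) by (auto simp: n_def)
  have inc: "\<tau> i < \<tau> (Suc i)" if "i < n" for i
    using that pos[of 0] sorted_wrt_nth_less[OF xs(1), of "i - 1" i]
    by (cases i) (auto simp: \<tau>0 \<tau>S n_def)
  have \<tau>nn: "0 \<le> \<tau> i" if "i \<le> n" for i
    using that pos[of "i - 1"] by (cases i) (auto simp: \<tau>0 \<tau>S less_imp_le)
  define e where "e = (\<lambda>i. \<Sum>k=i..<n. d (xs ! k))"
  have "indep_vars (\<lambda>_. borel) (\<lambda>i \<omega>. B (\<tau> (Suc i)) \<omega> - B (\<tau> i) \<omega>) {..<n}"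
    using BM inc unfolding standard_brownian_motion_def by (simp add: \<tau>0)
  hence ind: "indep_vars (\<lambda>_. borel) (\<lambda>i \<omega>. e i * (B (\<tau> (Suc i)) \<omega> - B (\<tau> i) \<omega>)) {..<n}"
    by (rule indep_vars_compose2[where Y = "\<lambda>i x. e i * x"]) simp
  have g: "gauss (\<lambda>\<omega>. e i * (B (\<tau> (Suc i)) \<omega> - B (\<tau> i) \<omega>)) ((e i)\<^sup>2 * (\<tau> (Suc i) - \<tau> i))" if "i < n" for i
  proof (rule gauss_cmult)
    have "distributed P lborel (\<lambda>\<omega>. B (\<tau> (Suc i)) \<omega> - B (\<tau> i) \<omega>) (normal_density 0 (sqrt (\<tau> (Suc i) - \<tau> i)))"
      using BM inc[OF that] \<tau>nn[of i] that unfolding standard_brownian_motion_def by simp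
    thus "gauss (\<lambda>\<omega>. B (\<tau> (Suc i)) \<omega> - B (\<tau> i) \<omega>) (\<tau> (Suc i) - \<tau> i)"
      using inc[OF that] by (subst gauss_positive_iff_distributed) auto
  qed
  have G: "gauss (\<lambda>\<omega>. \<Sum>i<n. e i * (B (\<tau> (Suc i)) \<omega> - B (\<tau> i) \<omega>)) (\<Sum>i<n. (e i)\<^sup>2 * (\<tau> (Suc i) - \<tau> i))"
    by (rule gauss_indep_sum[OF ind]) (use g in auto)
  have ae: "AE \<omega> in P. (\<Sum>i<n. e i * (B (\<tau> (Suc i)) \<omega> - B (\<tau> i) \<omega>)) = (\<Sum>\<tau>\<in>T. d \<tau> * B \<tau> \<omega>)"
    using B0
  proof eventually_elim
    case (elim \<omega>)
    have "(\<Sum>\<tau>\<in>T. d \<tau> * B \<tau> \<omega>) = (\<Sum>k<n. d (xs ! k) * B (xs ! k) \<omega>)"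
      by (rule sum.reindex_bij_betw[symmetric, OF bij_betw_nth]) (use xs in \<open>auto simp: n_def\<close>)
    also have "\<dots> = (\<Sum>k<n. d (xs ! k) * B (\<tau> (Suc k)) \<omega>)" by (simp add: \<tau>S)
    also have "\<dots> = (\<Sum>i<n. e i * (B (\<tau> (Suc i)) \<omega> - B (\<tau> i) \<omega>))"
      using abel_summation[of "\<lambda>k. d (xs ! k)" "\<lambda>k. B (\<tau> k) \<omega>" n] elim by (simp add: e_def \<tau>0)
    finally show ?case ..
  qed
  have m: "(\<lambda>\<omega>. \<Sum>\<tau>\<in>T. d \<tau> * B \<tau> \<omega>) \<in> borel_measurable P"
    using T(2) by (intro borel_measurable_sum borel_measurable_times meas) (auto simp: less_imp_le)
  show ?thesis by (rule exI, rule gauss_cong_AE[OF G ae m])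
qed

lemma ou_law:
  assumes BM: "standard_brownian_motion P B"
    and W: "path_law P (\<lambda>t \<omega>. exp (- t / 2) * B (exp t) \<omega>) W"
  shows "prob_space W" "sets W = sets borel"
    "finite F \<Longrightarrow> \<exists>v. prob_space.gauss W (\<lambda>\<omega>. \<Sum>s\<in>F. c s * upath_apply \<omega> s) v"
proof -
  interpret P: prob_space P using BM by (simp add: standard_brownian_motion_def)
  obtain Y where Y[measurable]: "Y \<in> measurable P borel"
    and YB: "AE \<omega> in P. \<forall>t. upath_apply (Y \<omega>) t = exp (- t / 2) * B (exp t) \<omega>"
    and WY: "W = distr P borel Y"
    using W unfolding path_law_def by blast
  show pW: "prob_space W" unfolding WY by (rule P.prob_space_distr[OF Y])
  show "sets W = sets borel" by (simp add: WY)
  interpret W: prob_space W by (rule pW)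
  assume F: "finite F"
  define X where "X = (\<lambda>\<omega>. \<Sum>s\<in>F. c s * upath_apply \<omega> s)"
  have [measurable]: "X \<in> borel_measurable borel" unfolding X_def by measurable
  have "\<exists>v. P.gauss (\<lambda>\<omega>. \<Sum>\<tau>\<in>exp ` F. (c (ln \<tau>) * exp (- ln \<tau> / 2)) * B \<tau> \<omega>) v"
    by (rule brownian_combination_gauss[OF BM finite_imageI[OF F]]) auto
  then obtain v where v: "P.gauss (\<lambda>\<omega>. \<Sum>\<tau>\<in>exp ` F. (c (ln \<tau>) * exp (- ln \<tau> / 2)) * B \<tau> \<omega>) v" ..
  have "P.gauss (\<lambda>\<omega>. X (Y \<omega>)) v"
  proof (rule P.gauss_cong_AE[OF v])
    show "AE \<omega> in P. (\<Sum>\<tau>\<in>exp ` F. (c (ln \<tau>) * exp (- ln \<tau> / 2)) * B \<tau> \<omega>) = X (Y \<omega>)"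
      using YB
    proof eventually_elim
      case (elim \<omega>)
      show ?case unfolding X_def
        by (subst sum.reindex) (auto simp: elim mult.assoc inj_on_def)
    qed
  qed measurable
  hence "W.gauss X v"
    unfolding P.gauss_def W.gauss_def by (auto simp: WY integral_distr)
  thus "\<exists>v. W.gauss (\<lambda>\<omega>. \<Sum>s\<in>F. c s * upath_apply \<omega> s) v" unfolding X_def by blast
qed

lemma transpose_on_HU:
  assumes Q: "orthogonal_transformation_on HU HU_inner Q" and h: "h \<in> HU"
  shows "transpose_on HU HU_inner Q h \<in> HU" "Q (transpose_on HU HU_inner Q h) = h"
proof -
  have "h \<in> Q ` HU" using Q h by (simp add: orthogonal_transformation_on_def)
  then obtain k where k: "k \<in> HU" "Q k = h" by (auto elim: imageE)
  have ip: "HU_inner (Q x) h = HU_inner x k" if "x \<in> HU" for x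
    using Q that k unfolding orthogonal_transformation_on_def by blast
  have "transpose_on HU HU_inner Q h = k"
    unfolding transpose_on_def
  proof (rule the_equality)
    fix k' assume "k' \<in> HU \<and> (\<forall>x\<in>HU. HU_inner (Q x) h = HU_inner x k')"
    thus "k' = k" using ip k(1) by (intro HU_eqI) auto
  qed (use k ip in auto)
  thus "transpose_on HU HU_inner Q h \<in> HU" "Q (transpose_on HU HU_inner Q h) = h" using k by simp_all
qed

lemma square_integrable_combination:
  fixes X :: "'i \<Rightarrow> 'a \<Rightarrow> real"
  assumes "finite A" "\<And>i. i \<in> A \<Longrightarrow> X i \<in> borel_measurable M" "\<And>i. i \<in> A \<Longrightarrow> integrable M (\<lambda>\<omega>. (X i \<omega>)\<^sup>2)"
  shows "integrable M (\<lambda>\<omega>. (\<Sum>i\<in>A. c i * X i \<omega>)\<^sup>2)"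
    and "(\<integral>\<omega>. (\<Sum>i\<in>A. c i * X i \<omega>)\<^sup>2 \<partial>M) = (\<Sum>i\<in>A. \<Sum>j\<in>A. c i * c j * (\<integral>\<omega>. X i \<omega> * X j \<omega> \<partial>M))"
proof -
  have e: "(\<Sum>i\<in>A. c i * X i \<omega>)\<^sup>2 = (\<Sum>i\<in>A. \<Sum>j\<in>A. c i * c j * (X i \<omega> * X j \<omega>))" for \<omega>
    unfolding power2_eq_square sum_product by (intro sum.cong refl) simp
  have i: "integrable M (\<lambda>\<omega>. X i \<omega> * X j \<omega>)" if "i \<in> A" "j \<in> A" for i j
    using that assms by (intro integrable_mult_of_squares) auto
  show "integrable M (\<lambda>\<omega>. (\<Sum>i\<in>A. c i * X i \<omega>)\<^sup>2)"
    unfolding e using i by (intro Bochner_Integration.integrable_sum integrable_mult_right) auto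
  show "(\<integral>\<omega>. (\<Sum>i\<in>A. c i * X i \<omega>)\<^sup>2 \<partial>M) = (\<Sum>i\<in>A. \<Sum>j\<in>A. c i * c j * (\<integral>\<omega>. X i \<omega> * X j \<omega> \<partial>M))"
    unfolding e using i
    by (subst Bochner_Integration.integral_sum; (intro Bochner_Integration.integrable_sum integrable_mult_right)?; auto)
qed

text \<open>
  The spectral measure of the Ornstein--Uhlenbeck process: a Cauchy distribution, with Fourier
  transform \<open>ou_cov 0\<close>.
\<close>

definition ou_spectral_measure :: "real measure" where
  "ou_spectral_measure = density lborel (\<lambda>l. ennreal (2 / pi * (1 / (1 + 4 * l\<^sup>2))))"

lemma sets_ou_spectral_measure [measurable_cong]: "sets ou_spectral_measure = sets borel"
  by (simp add: ou_spectral_measure_def)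

lemma ou_spectral_density_nonneg: "0 \<le> 2 / pi * (1 / (1 + 4 * (l::real)\<^sup>2))"
  using one_plus_4_square_pos[of l] by simp

lemma finite_ou_spectral_measure: "finite_measure ou_spectral_measure"
proof
  have "emeasure ou_spectral_measure (space ou_spectral_measure) = (\<integral>\<^sup>+ l. ennreal (2 / pi * (1 / (1 + 4 * l\<^sup>2))) \<partial>lborel)"
    unfolding ou_spectral_measure_def by (simp add: emeasure_density)
  also have "\<dots> = ennreal (LINT l|lborel. 2 / pi * (1 / (1 + 4 * l\<^sup>2)))"
    using ou_spectral_density_nonneg
    by (intro nn_integral_eq_integral integrable_mult_right integrable_ou_spectrum) auto
  finally show "emeasure ou_spectral_measure (space ou_spectral_measure) \<noteq> \<infinity>" by simp
qed

text \<open>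
  The function on the spectral side that represents the value of the flow with parameter \<open>fst p\<close> at
  time \<open>snd p\<close>: inner products of these functions are the covariances.
\<close>

definition ou_phase :: "real \<times> real \<Rightarrow> real \<Rightarrow> complex" where
  "ou_phase p l = exp (\<i> * complex_of_real (2 * fst p * arctan (2 * l) - l * snd p))"

lemma cmod_ou_phase: "cmod (ou_phase p l) = 1"
  unfolding ou_phase_def by (rule cmod_exp_i)

lemma continuous_on_ou_phase: "continuous_on A (ou_phase p)"
  unfolding ou_phase_def by (intro continuous_intros)

lemma ou_phase_measurable [measurable]: "ou_phase p \<in> borel_measurable borel"
  by (intro borel_measurable_continuous_onI continuous_on_ou_phase)

lemma cnj_ou_phase_measurable [measurable]: "(\<lambda>l. cnj (ou_phase p l)) \<in> borel_measurable borel"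
  by (intro borel_measurable_continuous_onI continuous_on_cnj continuous_on_ou_phase)

lemma integrable_ou_phase: "integrable ou_spectral_measure (\<lambda>l. ou_phase p l * cnj (ou_phase q l))"
proof -
  interpret finite_measure ou_spectral_measure by (rule finite_ou_spectral_measure)
  show ?thesis by (rule integrable_const_bound[of _ 1]) (auto simp: norm_mult cmod_ou_phase)
qed

lemma ou_cov_eq_phase_inner:
  "(CLINT l|ou_spectral_measure. ou_phase (u, s) l * cnj (ou_phase (v, t) l)) = ou_cov (u - v) (t - s)"
proof -
  have "(CLINT l|ou_spectral_measure. ou_phase (u, s) l * cnj (ou_phase (v, t) l)) =
     (CLINT l|lborel. (2 / pi * (1 / (1 + 4 * l\<^sup>2))) *\<^sub>R (ou_phase (u, s) l * cnj (ou_phase (v, t) l)))"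
    unfolding ou_spectral_measure_def
    using ou_spectral_density_nonneg by (intro integral_density) auto
  also have "\<dots> = (CLINT l|lborel. 2 / complex_of_real pi *
     (exp (\<i> * complex_of_real ((t - s) * l + 2 * (u - v) * arctan (2 * l))) / complex_of_real (1 + 4 * l\<^sup>2)))"
  proof (intro Bochner_Integration.integral_cong refl)
    fix l
    have "ou_phase (u, s) l * cnj (ou_phase (v, t) l) = exp (\<i> * complex_of_real ((t - s) * l + 2 * (u - v) * arctan (2 * l)))"
      by (simp add: ou_phase_def exp_cnj exp_add[symmetric] algebra_simps)
    thus "(2 / pi * (1 / (1 + 4 * l\<^sup>2))) *\<^sub>R (ou_phase (u, s) l * cnj (ou_phase (v, t) l)) =
      2 / complex_of_real pi * (exp (\<i> * complex_of_real ((t - s) * l + 2 * (u - v) * arctan (2 * l))) / complex_of_real (1 + 4 * l\<^sup>2))"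
      by (simp add: scaleR_conv_of_real)
  qed
  also have "\<dots> = ou_cov (u - v) (t - s)" unfolding ou_cov_def by (rule integral_mult_right_zero)
  finally show ?thesis .
qed

text \<open>
  The correspondence between the real variables \<open>X i\<close> and the functions \<open>f i\<close> preserves inner products,
  hence norms of complex combinations; taking real parts of the coefficients on the left can only
  decrease the norm.
\<close>

lemma real_part_combination_le:
  fixes X :: "'i \<Rightarrow> 'a \<Rightarrow> real" and f :: "'i \<Rightarrow> 'b \<Rightarrow> complex"
  assumes A: "finite A" and X: "\<And>i. i \<in> A \<Longrightarrow> X i \<in> borel_measurable M" "\<And>i. i \<in> A \<Longrightarrow> integrable M (\<lambda>\<omega>. (X i \<omega>)\<^sup>2)"
    and f: "\<And>i j. i \<in> A \<Longrightarrow> j \<in> A \<Longrightarrow> integrable N (\<lambda>l. f i l * cnj (f j l))"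
    and iso: "\<And>i j. i \<in> A \<Longrightarrow> j \<in> A \<Longrightarrow> complex_of_real (LINT \<omega>|M. X i \<omega> * X j \<omega>) = (CLINT l|N. f i l * cnj (f j l))"
  shows "(LINT \<omega>|M. (\<Sum>i\<in>A. Re (c i) * X i \<omega>)\<^sup>2) \<le> (LINT l|N. (cmod (\<Sum>i\<in>A. c i * f i l))\<^sup>2)"
proof -
  define R where "R = (\<lambda>\<omega>. \<Sum>i\<in>A. Re (c i) * X i \<omega>)"
  define J where "J = (\<lambda>\<omega>. \<Sum>i\<in>A. Im (c i) * X i \<omega>)"
  have iR: "integrable M (\<lambda>\<omega>. (R \<omega>)\<^sup>2)" and iJ: "integrable M (\<lambda>\<omega>. (J \<omega>)\<^sup>2)"
    unfolding R_def J_def by (intro square_integrable_combination A X; assumption)+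
  have iX: "integrable M (\<lambda>\<omega>. X i \<omega> * X j \<omega>)" if "i \<in> A" "j \<in> A" for i j
    using that X by (intro integrable_mult_of_squares) auto
  have "complex_of_real (LINT \<omega>|M. (R \<omega>)\<^sup>2 + (J \<omega>)\<^sup>2) = (CLINT \<omega>|M. \<Sum>i\<in>A. \<Sum>j\<in>A. c i * cnj (c j) * complex_of_real (X i \<omega> * X j \<omega>))"
    unfolding integral_complex_of_real[symmetric]
  proof (intro Bochner_Integration.integral_cong refl)
    fix \<omega>
    define Z where "Z = (\<Sum>i\<in>A. c i * complex_of_real (X i \<omega>))"
    have "Re Z = R \<omega>" "Im Z = J \<omega>" by (simp_all add: Z_def R_def J_def)
    hence "complex_of_real ((R \<omega>)\<^sup>2 + (J \<omega>)\<^sup>2) = Z * cnj Z"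
      by (simp only: complex_mult_cnj) 
    also have "\<dots> = (\<Sum>i\<in>A. \<Sum>j\<in>A. c i * cnj (c j) * complex_of_real (X i \<omega> * X j \<omega>))"
      unfolding Z_def cnj_sum sum_product by (intro sum.cong refl) (simp add: ac_simps)
    finally show "complex_of_real ((R \<omega>)\<^sup>2 + (J \<omega>)\<^sup>2) =
        (\<Sum>i\<in>A. \<Sum>j\<in>A. c i * cnj (c j) * complex_of_real (X i \<omega> * X j \<omega>))" .
  qed
  also have "\<dots> = (\<Sum>i\<in>A. \<Sum>j\<in>A. c i * cnj (c j) * (CLINT \<omega>|M. complex_of_real (X i \<omega> * X j \<omega>)))"
  proof -
    have i: "integrable M (\<lambda>\<omega>. c i * cnj (c j) * complex_of_real (X i \<omega> * X j \<omega>))" if "i \<in> A" "j \<in> A" for i j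
      using iX[OF that] by (intro integrable_mult_right integrable_of_real)
    show ?thesis
      by (subst Bochner_Integration.integral_sum, intro Bochner_Integration.integrable_sum i, assumption, assumption,
          intro sum.cong refl, subst Bochner_Integration.integral_sum, intro i, assumption, assumption,
          intro sum.cong refl integral_mult_right_zero)
  qed
  also have "\<dots> = (\<Sum>i\<in>A. \<Sum>j\<in>A. c i * cnj (c j) * (CLINT l|N. f i l * cnj (f j l)))"
    using iso by (intro sum.cong refl) (simp only: integral_complex_of_real)
  also have "\<dots> = (CLINT l|N. \<Sum>i\<in>A. \<Sum>j\<in>A. c i * cnj (c j) * (f i l * cnj (f j l)))"
  proof -
    have i: "integrable N (\<lambda>l. c i * cnj (c j) * (f i l * cnj (f j l)))" if "i \<in> A" "j \<in> A" for i j
      using f[OF that] by (intro integrable_mult_right)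
    show ?thesis
      by (subst Bochner_Integration.integral_sum, intro Bochner_Integration.integrable_sum i, assumption, assumption,
          intro sum.cong refl, subst Bochner_Integration.integral_sum, intro i, assumption, assumption,
          intro sum.cong refl integral_mult_right_zero[symmetric])
  qed
  also have "\<dots> = (CLINT l|N. complex_of_real ((cmod (\<Sum>i\<in>A. c i * f i l))\<^sup>2))"
  proof (intro Bochner_Integration.integral_cong refl)
    fix l
    have "complex_of_real ((cmod (\<Sum>i\<in>A. c i * f i l))\<^sup>2) = (\<Sum>i\<in>A. c i * f i l) * cnj (\<Sum>i\<in>A. c i * f i l)"
      by (rule complex_norm_square)
    also have "\<dots> = (\<Sum>i\<in>A. \<Sum>j\<in>A. c i * cnj (c j) * (f i l * cnj (f j l)))"
      unfolding cnj_sum sum_product by (intro sum.cong refl) (simp add: ac_simps)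
    finally show "(\<Sum>i\<in>A. \<Sum>j\<in>A. c i * cnj (c j) * (f i l * cnj (f j l))) = complex_of_real ((cmod (\<Sum>i\<in>A. c i * f i l))\<^sup>2)" ..
  qed
  also have "\<dots> = complex_of_real (LINT l|N. (cmod (\<Sum>i\<in>A. c i * f i l))\<^sup>2)" by (rule integral_complex_of_real)
  finally have "(LINT \<omega>|M. (R \<omega>)\<^sup>2 + (J \<omega>)\<^sup>2) = (LINT l|N. (cmod (\<Sum>i\<in>A. c i * f i l))\<^sup>2)"
    by (simp only: of_real_eq_iff)
  moreover have "(LINT \<omega>|M. (R \<omega>)\<^sup>2) \<le> (LINT \<omega>|M. (R \<omega>)\<^sup>2 + (J \<omega>)\<^sup>2)"
    using iR iJ by (intro integral_mono) auto
  ultimately show ?thesis by (simp add: R_def)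
qed

section \<open>The flow\<close>

lemma (in prob_space) gauss_cf_1: "gauss X v \<Longrightarrow> (CLINT x|M. iexp (X x)) = complex_of_real (exp (- v / 2))"
  using spec[of "\<lambda>c. (CLINT x|M. iexp (c * X x)) = complex_of_real (exp (- (c\<^sup>2 * v) / 2))" 1]
  by (simp add: gauss_def)

locale ou_flow =
  fixes P :: "'w measure" and B :: "real \<Rightarrow> 'w \<Rightarrow> real"
    and W :: "upath measure"
    and I :: "upath \<Rightarrow> upath \<Rightarrow> real"
    and Q :: "real \<Rightarrow> upath \<Rightarrow> upath"
    and S :: "real \<Rightarrow> upath \<Rightarrow> upath"
  assumes brownian: "standard_brownian_motion P B"
    and law: "path_law P (\<lambda>t \<omega>. exp (- t / 2) * B (exp t) \<omega>) W"
    and paley_wiener: "paley_wiener_map HU HU_inner W I"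
    and orthogonal: "\<And>u. orthogonal_transformation_on HU HU_inner (Q u)"
    and phase: "\<And>u h. h \<in> HU \<Longrightarrow>
           \<exists>g. l2_fourier (\<lambda>x. complex_of_real (upath_apply h x)) g \<and>
               l2_fourier (\<lambda>x. complex_of_real (upath_apply (Q u h) x))
                 (\<lambda>l. exp (- 2 * \<i> * complex_of_real (u * arctan (2 * l))) * g l)"
    and transformation: "\<And>u. wiener_transformation HU HU_inner W I (Q u) (S u)"
begin

sublocale prob_space W by (rule ou_law(1)[OF brownian law])

lemma sets_W [measurable_cong]: "sets W = sets borel" by (rule ou_law(2)[OF brownian law])

definition kernel :: "real \<times> real \<Rightarrow> upath" where
  "kernel p = transpose_on HU HU_inner (Q (fst p)) (ou_kernel (snd p))"

text \<open>
  Almost surely for each fixed \<open>(u, t)\<close>, \<open>\<xi> (u, t)\<close> is the value of \<open>S u\<close> at \<open>t\<close>, and \<open>\<xi> (0, t)\<close> is the value of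
  the path itself.  As the image of a vector of \<open>H\<^sup>U\<close> under the isometry \<open>I\<close> it is accessible to Hilbert
  space computations.
\<close>

definition \<xi> :: "real \<times> real \<Rightarrow> upath \<Rightarrow> real" where
  "\<xi> p = I (kernel p)"

lemma kernel_HU: "kernel p \<in> HU" and Q_kernel: "Q (fst p) (kernel p) = ou_kernel (snd p)"
  unfolding kernel_def by (rule transpose_on_HU[OF orthogonal ou_kernel_HU])+

lemma Q_HU: "h \<in> HU \<Longrightarrow> Q u h \<in> HU"
  using orthogonal[of u] unfolding orthogonal_transformation_on_def by blast

lemma ou_cov_0: "ou_cov 0 (s - t) = complex_of_real (exp (- \<bar>s - t\<bar> / 2))"
proof -
  have e: "Q 0 (kernel (0, t)) = ou_kernel t" using Q_kernel[of "(0, t)"] by simp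
  have "complex_of_real (upath_apply (Q 0 (kernel (0, t))) s) = ou_cov (0 - 0) (s - t)"
    by (rule phase_shift_ou_kernel(2)[OF phase kernel_HU e])
  thus ?thesis by (simp add: e ou_kernel_apply)
qed

lemma kernel_0: "kernel (0, t) = ou_kernel t"
proof (rule upath_eqI)
  fix s
  have "complex_of_real (upath_apply (kernel (0, t)) s) = ou_cov 0 (s - t)"
    using phase_shift_ou_kernel(1)[OF phase kernel_HU Q_kernel, of "(0, t)" s] by simp
  thus "upath_apply (kernel (0, t)) s = upath_apply (ou_kernel t) s"
    unfolding ou_cov_0 by (simp add: ou_kernel_apply)
qed

lemma I_L2: "h \<in> HU \<Longrightarrow> I h \<in> borel_measurable W" "h \<in> HU \<Longrightarrow> integrable W (\<lambda>\<omega>. (I h \<omega>)\<^sup>2)"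
  "h \<in> HU \<Longrightarrow> expectation (\<lambda>\<omega>. (I h \<omega>)\<^sup>2) = HU_inner h h"
  using paley_wiener by (simp_all add: paley_wiener_map_def)

lemma \<xi>_measurable [measurable]: "\<xi> p \<in> borel_measurable W"
  unfolding \<xi>_def by (rule I_L2(1)[OF kernel_HU])

lemma \<xi>_square_integrable: "integrable W (\<lambda>\<omega>. (\<xi> p \<omega>)\<^sup>2)"
  unfolding \<xi>_def by (rule I_L2(2)[OF kernel_HU])

lemma I_inner:
  assumes h: "h \<in> HU" and k: "k \<in> HU"
  shows "expectation (\<lambda>\<omega>. I h \<omega> * I k \<omega>) = HU_inner h k"
proof -
  let ?s = "1 *\<^sub>R h + 1 *\<^sub>R k"
  have s: "?s \<in> HU" by (rule HU_combination[OF h k])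
  have "\<forall>h\<in>HU. \<forall>k\<in>HU. \<forall>a b. AE \<omega> in W. I (a *\<^sub>R h + b *\<^sub>R k) \<omega> = a * I h \<omega> + b * I k \<omega>"
    using paley_wiener unfolding paley_wiener_map_def by (elim conjE)
  from bspec[OF bspec[OF this h] k]
  have ae: "AE \<omega> in W. I ?s \<omega> = 1 * I h \<omega> + 1 * I k \<omega>"
    by (elim allE[where x = 1])
  note [measurable] = I_L2(1)[OF h] I_L2(1)[OF k] I_L2(1)[OF s]
  have i: "integrable W (\<lambda>\<omega>. I h \<omega> * I k \<omega>)"
    by (intro integrable_mult_of_squares I_L2 h k)
  have "HU_inner ?s ?s = expectation (\<lambda>\<omega>. (I ?s \<omega>)\<^sup>2)" using I_L2(3)[OF s] by simp
  also have "\<dots> = expectation (\<lambda>\<omega>. (I h \<omega>)\<^sup>2 + (I k \<omega>)\<^sup>2 + 2 * (I h \<omega> * I k \<omega>))"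
  proof (rule integral_cong_AE)
    show "AE \<omega> in W. (I ?s \<omega>)\<^sup>2 = (I h \<omega>)\<^sup>2 + (I k \<omega>)\<^sup>2 + 2 * (I h \<omega> * I k \<omega>)"
      using ae by eventually_elim (simp add: power2_eq_square algebra_simps)
  qed measurable
  also have "\<dots> = HU_inner h h + HU_inner k k + 2 * expectation (\<lambda>\<omega>. I h \<omega> * I k \<omega>)"
    using i I_L2[OF h] I_L2[OF k] by simp
  also have "HU_inner ?s ?s = HU_inner h ?s + HU_inner k ?s"
    using HU_inner_combination[OF h k s, of 1 1] by simp
  also have "HU_inner h ?s = HU_inner h h + HU_inner h k"
    using HU_inner_combination[OF h k h, of 1 1]
    unfolding HU_inner_commute[of h ?s] HU_inner_commute[of k h] by simp
  also have "HU_inner k ?s = HU_inner h k + HU_inner k k"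
    using HU_inner_combination[OF h k k, of 1 1] unfolding HU_inner_commute[of k ?s] by simp
  finally show ?thesis by simp
qed

text \<open>
  Applying the isometry \<open>Q (fst q)\<close> to both vectors turns the second into the reproducing kernel, so the
  inner product becomes a value of the path \<open>Q (fst q) (kernel p)\<close>, which Fourier inversion computes.
\<close>

lemma \<xi>_cov:
  "complex_of_real (expectation (\<lambda>\<omega>. \<xi> p \<omega> * \<xi> q \<omega>)) = ou_cov (fst p - fst q) (snd q - snd p)"
proof -
  have "expectation (\<lambda>\<omega>. \<xi> p \<omega> * \<xi> q \<omega>) = HU_inner (kernel p) (kernel q)"
    unfolding \<xi>_def by (rule I_inner[OF kernel_HU kernel_HU])
  also have "\<dots> = HU_inner (Q (fst q) (kernel p)) (Q (fst q) (kernel q))"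
    using orthogonal[of "fst q"] kernel_HU unfolding orthogonal_transformation_on_def by simp
  also have "\<dots> = upath_apply (Q (fst q) (kernel p)) (snd q)"
    unfolding Q_kernel by (intro HU_inner_ou_kernel Q_HU kernel_HU)
  also have "complex_of_real \<dots> = ou_cov (fst p - fst q) (snd q - snd p)"
    by (rule phase_shift_ou_kernel(2)[OF phase kernel_HU Q_kernel])
  finally show ?thesis .
qed

lemma eval_eq_I_AE: "AE \<omega> in W. upath_apply \<omega> t = I (ou_kernel t) \<omega>"
proof -
  have "\<forall>x. bounded_linear x \<longrightarrow> (\<forall>k\<in>HU. (\<forall>h\<in>HU. HU_inner h k = x h) \<longrightarrow> (AE \<omega> in W. I k \<omega> = x \<omega>))"
    using paley_wiener unfolding paley_wiener_map_def by (elim conjE)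
  from bspec[OF mp[OF spec[OF this] upath_eval_bounded_linear[of t]] ou_kernel_HU[of t]]
  have "AE \<omega> in W. I (ou_kernel t) \<omega> = upath_apply \<omega> t"
    using HU_inner_ou_kernel[of _ t] by simp
  thus ?thesis by eventually_elim simp
qed

lemma eval_eq_\<xi>_AE: "AE \<omega> in W. upath_apply \<omega> t = \<xi> (0, t) \<omega>"
  using eval_eq_I_AE unfolding \<xi>_def kernel_0 .

lemma S_measurable [measurable]: "S u \<in> measurable W borel"
  using transformation[of u] by (simp add: wiener_transformation_def)

lemma S_eq_\<xi>_AE: "AE \<omega> in W. upath_apply (S u \<omega>) t = \<xi> (u, t) \<omega>"
proof -
  have m: "(\<lambda>\<omega>. upath_apply \<omega> t) \<in> borel_measurable W" by measurable
  have "\<forall>h\<in>HU. \<forall>X\<in>borel_measurable W. (AE \<omega> in W. X \<omega> = I h \<omega>) \<longrightarrow>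
       (AE \<omega> in W. X (S u \<omega>) = I (transpose_on HU HU_inner (Q u) h) \<omega>)"
    using transformation[of u] unfolding wiener_transformation_def by (elim conjE)
  from bspec[OF bspec[OF this ou_kernel_HU[of t]] m] eval_eq_I_AE[of t]
  show ?thesis by (simp add: \<xi>_def kernel_def)
qed

text \<open>
  The sign of the time comes from \<open>ou_phase (0, - s) l = exp (\<i> l s)\<close>.
\<close>

lemma trig_sum_as_path_combination:
  assumes "finite F"
  shows "\<exists>X v. gauss X v \<and> (AE \<omega> in W. X \<omega> = (\<Sum>s\<in>F. c s * \<xi> (0, - s) \<omega>))"
proof -
  obtain v where v: "gauss (\<lambda>\<omega>. \<Sum>r\<in>uminus ` F. c (- r) * upath_apply \<omega> r) v"
    using ou_law(3)[OF brownian law finite_imageI[OF assms, of uminus], of "\<lambda>r. c (- r)"] by blast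
  have "AE \<omega> in W. \<forall>s\<in>F. upath_apply \<omega> (- s) = \<xi> (0, - s) \<omega>"
    using assms by (intro AE_finite_allI eval_eq_\<xi>_AE)
  hence "AE \<omega> in W. (\<Sum>r\<in>uminus ` F. c (- r) * upath_apply \<omega> r) = (\<Sum>s\<in>F. c s * \<xi> (0, - s) \<omega>)"
  proof eventually_elim
    case (elim \<omega>)
    thus ?case by (subst sum.reindex) (auto intro!: sum.cong)
  qed
  with v show ?thesis by blast
qed

text \<open>
  A combination of the \<open>\<xi> p\<close> need not be a combination of values of the path, but its spectral
  representative is a bounded continuous function, hence an \<open>L\<^sup>2\<close> limit of trigonometric polynomials,
  and these represent combinations of values of the path, which are Gaussian.
\<close>

theorem \<xi>_combination_gauss:
  fixes g :: "'j \<Rightarrow> real \<times> real"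
  assumes A: "finite A"
  shows "gauss (\<lambda>\<omega>. \<Sum>j\<in>A. c j * \<xi> (g j) \<omega>)
    (\<Sum>j\<in>A. \<Sum>j'\<in>A. c j * c j' * Re (ou_cov (fst (g j) - fst (g j')) (snd (g j') - snd (g j))))"
proof -
  define Y where "Y = (\<lambda>\<omega>. \<Sum>j\<in>A. c j * \<xi> (g j) \<omega>)"
  have [measurable]: "Y \<in> borel_measurable W" unfolding Y_def by measurable
  have "gauss Y (expectation (\<lambda>\<omega>. (Y \<omega>)\<^sup>2))"
  proof (rule gauss_L2_limit)
    show "integrable W (\<lambda>\<omega>. (Y \<omega>)\<^sup>2)"
      unfolding Y_def by (intro square_integrable_combination A \<xi>_measurable \<xi>_square_integrable)
    fix e :: real assume e: "0 < e"
    define \<phi> where "\<phi> = (\<lambda>l. \<Sum>j\<in>A. complex_of_real (c j) * ou_phase (g j) l)"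
    have cont: "continuous_on UNIV \<phi>"
      unfolding \<phi>_def by (intro continuous_intros continuous_on_ou_phase)
    have bd: "cmod (\<phi> l) \<le> (\<Sum>j\<in>A. \<bar>c j\<bar>)" for l
      unfolding \<phi>_def by (rule order_trans[OF norm_sum]) (simp add: norm_mult cmod_ou_phase)
    obtain F d where F: "finite F" and
      d: "(LINT l|ou_spectral_measure. (cmod (\<phi> l - (\<Sum>s\<in>F. d s * exp (\<i> * complex_of_real (l * s)))))\<^sup>2) < e"
      using trig_polynomials_dense[OF finite_ou_spectral_measure sets_ou_spectral_measure cont bd e] by blast
    obtain X v where X: "gauss X v" "AE \<omega> in W. X \<omega> = (\<Sum>s\<in>F. Re (d s) * \<xi> (0, - s) \<omega>)"
      using trig_sum_as_path_combination[OF F, of "\<lambda>s. Re (d s)"] by blast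
    have [measurable]: "X \<in> borel_measurable W" using X(1) by (simp add: gauss_def)
    define pt where "pt = case_sum g (\<lambda>s. (0, - s))"
    define a where "a = case_sum (\<lambda>j. complex_of_real (c j)) (\<lambda>s. - d s)"
    have "expectation (\<lambda>\<omega>. (X \<omega> - Y \<omega>)\<^sup>2) = expectation (\<lambda>\<omega>. (\<Sum>i\<in>A <+> F. Re (a i) * \<xi> (pt i) \<omega>)\<^sup>2)"
    proof (rule integral_cong_AE)
      show "AE \<omega> in W. (X \<omega> - Y \<omega>)\<^sup>2 = (\<Sum>i\<in>A <+> F. Re (a i) * \<xi> (pt i) \<omega>)\<^sup>2"
        using X(2)
      proof eventually_elim
        case (elim \<omega>)
        have "(\<Sum>i\<in>A <+> F. Re (a i) * \<xi> (pt i) \<omega>) = Y \<omega> - X \<omega>"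
          unfolding elim Y_def using A F by (simp add: sum.Plus a_def pt_def sum_negf)
        thus ?case by (simp add: power2_commute)
      qed
    qed measurable
    also have "\<dots> \<le> (LINT l|ou_spectral_measure. (cmod (\<Sum>i\<in>A <+> F. a i * ou_phase (pt i) l))\<^sup>2)"
    proof (rule real_part_combination_le)
      show "complex_of_real (LINT \<omega>|W. \<xi> (pt i) \<omega> * \<xi> (pt j) \<omega>) =
          (CLINT l|ou_spectral_measure. ou_phase (pt i) l * cnj (ou_phase (pt j) l))" for i j
        using ou_cov_eq_phase_inner[of "fst (pt i)" "snd (pt i)" "fst (pt j)" "snd (pt j)"]
        by (simp add: \<xi>_cov)
    qed (use A F \<xi>_measurable \<xi>_square_integrable integrable_ou_phase in auto)
    also have "\<dots> = (LINT l|ou_spectral_measure. (cmod (\<phi> l - (\<Sum>s\<in>F. d s * exp (\<i> * complex_of_real (l * s)))))\<^sup>2)"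
    proof (intro Bochner_Integration.integral_cong refl arg_cong[of _ _ "\<lambda>z. (cmod z)\<^sup>2"])
      fix l
      show "(\<Sum>i\<in>A <+> F. a i * ou_phase (pt i) l) = \<phi> l - (\<Sum>s\<in>F. d s * exp (\<i> * complex_of_real (l * s)))"
        using A F by (simp add: sum.Plus a_def pt_def sum_negf \<phi>_def ou_phase_def)
    qed
    finally show "\<exists>X v. gauss X v \<and> expectation (\<lambda>\<omega>. (X \<omega> - Y \<omega>)\<^sup>2) < e" using d X(1) by force
  qed measurable
  also have "expectation (\<lambda>\<omega>. (Y \<omega>)\<^sup>2) = (\<Sum>j\<in>A. \<Sum>j'\<in>A. c j * c j' * expectation (\<lambda>\<omega>. \<xi> (g j) \<omega> * \<xi> (g j') \<omega>))"
    unfolding Y_def by (intro square_integrable_combination A \<xi>_measurable \<xi>_square_integrable)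
  also have "\<dots> = (\<Sum>j\<in>A. \<Sum>j'\<in>A. c j * c j' * Re (ou_cov (fst (g j) - fst (g j')) (snd (g j') - snd (g j))))"
    by (simp add: \<xi>_cov[symmetric])
  finally show ?thesis unfolding Y_def .
qed

lemma version_combination_gauss:
  fixes g :: "'j \<Rightarrow> real \<times> real"
  assumes A: "finite A" and Y: "\<And>j. AE \<omega> in W. Y j \<omega> = \<xi> (g j) \<omega>" "\<And>j. Y j \<in> borel_measurable W"
  shows "gauss (\<lambda>\<omega>. \<Sum>j\<in>A. c j * Y j \<omega>)
    (\<Sum>j\<in>A. \<Sum>j'\<in>A. c j * c j' * Re (ou_cov (fst (g j) - fst (g j')) (snd (g j') - snd (g j))))"
proof (rule gauss_cong_AE[OF \<xi>_combination_gauss[OF A]])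
  have "AE \<omega> in W. \<forall>j\<in>A. Y j \<omega> = \<xi> (g j) \<omega>" using A Y(1) by (intro AE_finite_allI)
  thus "AE \<omega> in W. (\<Sum>j\<in>A. c j * \<xi> (g j) \<omega>) = (\<Sum>j\<in>A. c j * Y j \<omega>)"
    by eventually_elim (auto intro!: sum.cong)
  show "(\<lambda>\<omega>. \<Sum>j\<in>A. c j * Y j \<omega>) \<in> borel_measurable W" using Y(2) by measurable
qed

text \<open>
  Both families are centred Gaussian, and their covariances involve only differences of index points.
\<close>

lemma versions_same_law:
  fixes g g' :: "'j \<Rightarrow> real \<times> real"
  assumes Y: "\<And>j. AE \<omega> in W. Y j \<omega> = \<xi> (g j) \<omega>" "\<And>j. Y j \<in> borel_measurable W"
    and Y': "\<And>j. AE \<omega> in W. Y' j \<omega> = \<xi> (g' j) \<omega>" "\<And>j. Y' j \<in> borel_measurable W"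
    and shift: "\<And>i j. fst (g i) - fst (g j) = fst (g' i) - fst (g' j)"
      "\<And>i j. snd (g i) - snd (g j) = snd (g' i) - snd (g' j)"
  shows "distr W (PiM UNIV (\<lambda>_. borel)) (\<lambda>\<omega> j. Y j \<omega>) = distr W (PiM UNIV (\<lambda>_. borel)) (\<lambda>\<omega> j. Y' j \<omega>)"
proof (rule joint_cf_determines_law[OF prob_space_axioms prob_space_axioms Y(2) Y'(2)])
  fix F :: "'j set" and c :: "'j \<Rightarrow> real" assume "finite F"
  from gauss_cf_1[OF version_combination_gauss[OF this Y]] gauss_cf_1[OF version_combination_gauss[OF this Y']]
  show "(CLINT x|W. iexp (\<Sum>i\<in>F. c i * Y i x)) = (CLINT x|W. iexp (\<Sum>i\<in>F. c i * Y' i x))"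
    unfolding shift by simp
qed

lemma eval_S_measurable [measurable]: "(\<lambda>\<omega>. upath_apply (S u \<omega>) t) \<in> borel_measurable W"
  by measurable

text \<open>
  The values of \<open>S u\<close> and of the path are versions of \<open>\<xi>\<close> at points that differ by the shift \<open>(u, 0)\<close>.
\<close>

theorem S_preserves_law: "distr W borel (S u) = W"
proof (rule upath_measure_eqI)
  have "distr W (PiM UNIV (\<lambda>_. borel)) (\<lambda>\<omega> t. upath_apply (S u \<omega>) t) =
     distr W (PiM UNIV (\<lambda>_. borel)) (\<lambda>\<omega> t. upath_apply \<omega> t)"
    by (rule versions_same_law[OF S_eq_\<xi>_AE eval_S_measurable eval_eq_\<xi>_AE]) auto
  moreover have "distr (distr W borel (S u)) (PiM UNIV (\<lambda>_. borel)) upath_apply =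
      distr W (PiM UNIV (\<lambda>_. borel)) (upath_apply \<circ> S u)"
    by (rule distr_distr) measurable
  ultimately show "distr (distr W borel (S u)) (PiM UNIV (\<lambda>_. borel)) upath_apply =
      distr W (PiM UNIV (\<lambda>_. borel)) upath_apply"
    by (simp add: comp_def)
qed (simp_all add: sets_W)

lemma \<xi>_gauss_difference:
  "gauss (\<lambda>\<omega>. \<xi> p \<omega> - \<xi> q \<omega>) (expectation (\<lambda>\<omega>. (\<xi> p \<omega> - \<xi> q \<omega>)\<^sup>2))"
proof -
  have "\<exists>v. gauss (\<lambda>\<omega>. \<Sum>j\<in>UNIV. (if j then 1 else - 1) * \<xi> (if j then p else q) \<omega>) v"
    by (rule exI, rule \<xi>_combination_gauss) simp
  then obtain v where "gauss (\<lambda>\<omega>. \<Sum>j\<in>UNIV. (if j then 1 else - 1) * \<xi> (if j then p else q) \<omega>) v" ..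
  hence "gauss (\<lambda>\<omega>. \<xi> p \<omega> - \<xi> q \<omega>) v" by (simp add: UNIV_bool add.commute)
  with gauss_moments(3)[OF this] show ?thesis by simp
qed

lemma \<xi>_increment_time: "expectation (\<lambda>\<omega>. (\<xi> (u, t) \<omega> - \<xi> (u, s) \<omega>)\<^sup>2) \<le> \<bar>t - s\<bar>"
proof -
  have i: "integrable W (\<lambda>\<omega>. \<xi> (u, t) \<omega> * \<xi> (u, s) \<omega>)"
    by (intro integrable_mult_of_squares \<xi>_measurable \<xi>_square_integrable)
  have v: "expectation (\<lambda>\<omega>. \<xi> (u, t) \<omega> * \<xi> (u, s) \<omega>) = exp (- \<bar>s - t\<bar> / 2)" for s t
    using \<xi>_cov[of "(u, t)" "(u, s)"] by (simp add: ou_cov_0)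
  have "expectation (\<lambda>\<omega>. (\<xi> (u, t) \<omega> - \<xi> (u, s) \<omega>)\<^sup>2) =
     expectation (\<lambda>\<omega>. (\<xi> (u, t) \<omega>)\<^sup>2 + (\<xi> (u, s) \<omega>)\<^sup>2 - 2 * (\<xi> (u, t) \<omega> * \<xi> (u, s) \<omega>))"
    by (intro Bochner_Integration.integral_cong refl) (simp add: power2_eq_square algebra_simps)
  also have "\<dots> = 2 - 2 * exp (- \<bar>s - t\<bar> / 2)"
    using i \<xi>_square_integrable[of "(u, t)"] \<xi>_square_integrable[of "(u, s)"] v[of t t] v[of s s] v[of t s]
    by (simp add: power2_eq_square)
  also have "\<dots> \<le> \<bar>t - s\<bar>"
  proof -
    define x where "x = - \<bar>s - t\<bar> / 2"
    have "\<bar>t - s\<bar> = - 2 * x" by (simp add: x_def abs_minus_commute)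
    moreover have "1 + x \<le> exp x" by (rule exp_ge_add_one_self)
    ultimately show ?thesis unfolding x_def[symmetric] by linarith
  qed
  finally show ?thesis .
qed

text \<open>
  The phase depends on the parameter through \<open>2 * arctan (2 * l)\<close>, which is bounded by \<open>pi\<close>, so the flow is
  even Lipschitz in \<open>L\<^sup>2\<close>; in the time direction only \<open>L\<^sup>2\<close> Hoelder continuity of order \<open>1 / 2\<close> holds.
\<close>

lemma \<xi>_increment_parameter:
  "expectation (\<lambda>\<omega>. (\<xi> (u, t) \<omega> - \<xi> (v, t) \<omega>)\<^sup>2) \<le> pi\<^sup>2 * (u - v)\<^sup>2 * measure ou_spectral_measure UNIV"
proof -
  interpret \<mu>: finite_measure ou_spectral_measure by (rule finite_ou_spectral_measure)
  define p where "p = (\<lambda>j. if j then (u, t) else (v, t))"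
  define a where "a = (\<lambda>j. if j then 1 else - 1 :: complex)"
  have "expectation (\<lambda>\<omega>. (\<Sum>j\<in>UNIV. Re (a j) * \<xi> (p j) \<omega>)\<^sup>2) \<le>
     (LINT l|ou_spectral_measure. (cmod (\<Sum>j\<in>UNIV. a j * ou_phase (p j) l))\<^sup>2)"
  proof (rule real_part_combination_le)
    show "complex_of_real (LINT \<omega>|W. \<xi> (p i) \<omega> * \<xi> (p j) \<omega>) =
          (CLINT l|ou_spectral_measure. ou_phase (p i) l * cnj (ou_phase (p j) l))" for i j
      using ou_cov_eq_phase_inner[of "fst (p i)" "snd (p i)" "fst (p j)" "snd (p j)"]
      by (simp add: \<xi>_cov)
  qed (use \<xi>_measurable \<xi>_square_integrable integrable_ou_phase in auto)
  also have "\<dots> \<le> (LINT l|ou_spectral_measure. pi\<^sup>2 * (u - v)\<^sup>2)"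
  proof (rule integral_mono)
    have s: "(\<Sum>j\<in>UNIV. a j * ou_phase (p j) l) = ou_phase (u, t) l - ou_phase (v, t) l" for l
      by (simp add: UNIV_bool a_def p_def)
    have b: "(cmod (\<Sum>j\<in>UNIV. a j * ou_phase (p j) l))\<^sup>2 \<le> pi\<^sup>2 * (u - v)\<^sup>2" for l
    proof -
      have "cmod (\<Sum>j\<in>UNIV. a j * ou_phase (p j) l) \<le> \<bar>(2 * u * arctan (2 * l) - l * t) - (2 * v * arctan (2 * l) - l * t)\<bar>"
        unfolding s unfolding ou_phase_def fst_conv snd_conv by (rule cmod_iexp_diff_le)
      also have "\<dots> = \<bar>2 * arctan (2 * l)\<bar> * \<bar>u - v\<bar>" by (simp add: abs_mult[symmetric] algebra_simps)
      also have "\<dots> \<le> pi * \<bar>u - v\<bar>"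
        using arctan_bounded[of "2 * l"] by (intro mult_right_mono) auto
      finally have "(cmod (\<Sum>j\<in>UNIV. a j * ou_phase (p j) l))\<^sup>2 \<le> (pi * \<bar>u - v\<bar>)\<^sup>2"
        by (intro power_mono) auto
      thus ?thesis by (simp add: power_mult_distrib)
    qed
    show "integrable ou_spectral_measure (\<lambda>l. (cmod (\<Sum>j\<in>UNIV. a j * ou_phase (p j) l))\<^sup>2)"
      by (rule \<mu>.integrable_const_bound[of _ "pi\<^sup>2 * (u - v)\<^sup>2"]) (use b in auto)
    show "(cmod (\<Sum>j\<in>UNIV. a j * ou_phase (p j) l))\<^sup>2 \<le> pi\<^sup>2 * (u - v)\<^sup>2" for l by (rule b)
  qed simp
  also have "\<dots> = pi\<^sup>2 * (u - v)\<^sup>2 * measure ou_spectral_measure UNIV"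
    using sets_eq_imp_space_eq[OF sets_ou_spectral_measure] by simp
  finally show ?thesis by (simp add: UNIV_bool a_def p_def add.commute)
qed

text \<open>
  Sixth moments, because for a Gaussian variable they are proportional to the cube of the variance,
  and a continuity criterion in the plane needs an exponent above \<open>2\<close>.
\<close>

lemma \<xi>_increment_moment:
  "\<exists>C. \<forall>u t v s. \<bar>u - v\<bar> \<le> 1 \<longrightarrow> \<bar>t - s\<bar> \<le> 1 \<longrightarrow>
     expectation (\<lambda>\<omega>. (\<xi> (u, t) \<omega> - \<xi> (v, s) \<omega>) ^ 6) \<le> C * (\<bar>u - v\<bar> + \<bar>t - s\<bar>) ^ 3"
proof -
  define D where "D = 2 * (pi\<^sup>2 * measure ou_spectral_measure UNIV) + 2"
  show ?thesis
  proof (intro exI[of _ "15 * D ^ 3"] allI impI)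
    fix u t v s :: real assume uv: "\<bar>u - v\<bar> \<le> 1"
    define V where "V = expectation (\<lambda>\<omega>. (\<xi> (u, t) \<omega> - \<xi> (v, s) \<omega>)\<^sup>2)"
    have sq: "integrable W (\<lambda>\<omega>. (\<xi> p \<omega> - \<xi> q \<omega>)\<^sup>2)" for p q
      by (rule gauss_moments(2)[OF \<xi>_gauss_difference])
    have "V \<le> expectation (\<lambda>\<omega>. 2 * (\<xi> (u, t) \<omega> - \<xi> (v, t) \<omega>)\<^sup>2 + 2 * (\<xi> (v, t) \<omega> - \<xi> (v, s) \<omega>)\<^sup>2)"
      unfolding V_def
    proof (rule integral_mono)
      have *: "(x - z)\<^sup>2 \<le> 2 * (x - y)\<^sup>2 + 2 * (y - z)\<^sup>2" for x y z :: real
        using zero_le_power2[of "(x - y) - (y - z)"] by (simp add: power2_eq_square algebra_simps)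
      show "(\<xi> (u, t) \<omega> - \<xi> (v, s) \<omega>)\<^sup>2 \<le> 2 * (\<xi> (u, t) \<omega> - \<xi> (v, t) \<omega>)\<^sup>2 + 2 * (\<xi> (v, t) \<omega> - \<xi> (v, s) \<omega>)\<^sup>2" for \<omega>
        by (rule *)
    qed (use sq in auto)
    also have "\<dots> \<le> 2 * (pi\<^sup>2 * (u - v)\<^sup>2 * measure ou_spectral_measure UNIV) + 2 * \<bar>t - s\<bar>"
      using \<xi>_increment_parameter[of u t v] \<xi>_increment_time[of v t s] sq by simp
    also have "\<dots> \<le> D * (\<bar>u - v\<bar> + \<bar>t - s\<bar>)"
    proof -
      have "(u - v)\<^sup>2 \<le> \<bar>u - v\<bar>"
        using uv mult_right_mono[of "\<bar>u - v\<bar>" 1 "\<bar>u - v\<bar>"] by (simp add: power2_eq_square abs_mult[symmetric])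
      hence "(2 * (pi\<^sup>2 * measure ou_spectral_measure UNIV)) * (u - v)\<^sup>2 \<le> (2 * (pi\<^sup>2 * measure ou_spectral_measure UNIV)) * \<bar>u - v\<bar>"
        by (intro mult_left_mono) auto
      moreover have "0 \<le> (2 * (pi\<^sup>2 * measure ou_spectral_measure UNIV)) * \<bar>t - s\<bar>" by simp
      moreover have "0 \<le> 2 * \<bar>u - v\<bar>" by simp
      ultimately have "(2 * (pi\<^sup>2 * measure ou_spectral_measure UNIV)) * (u - v)\<^sup>2 + 2 * \<bar>t - s\<bar> \<le>
         (2 * (pi\<^sup>2 * measure ou_spectral_measure UNIV)) * \<bar>u - v\<bar> + 2 * \<bar>t - s\<bar> +
         (2 * (pi\<^sup>2 * measure ou_spectral_measure UNIV)) * \<bar>t - s\<bar> + 2 * \<bar>u - v\<bar>" by linarith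
      also have "\<dots> = D * (\<bar>u - v\<bar> + \<bar>t - s\<bar>)" by (simp add: D_def algebra_simps)
      finally show ?thesis by (simp add: ac_simps)
    qed
    finally have V: "V \<le> D * (\<bar>u - v\<bar> + \<bar>t - s\<bar>)" .
    have "expectation (\<lambda>\<omega>. (\<xi> (u, t) \<omega> - \<xi> (v, s) \<omega>) ^ 6) = 15 * V ^ 3"
      unfolding V_def by (rule gauss_moments(5)[OF \<xi>_gauss_difference])
    also have "\<dots> \<le> 15 * (D * (\<bar>u - v\<bar> + \<bar>t - s\<bar>)) ^ 3"
      using V by (intro mult_left_mono power_mono) (auto simp: V_def)
    finally show "expectation (\<lambda>\<omega>. (\<xi> (u, t) \<omega> - \<xi> (v, s) \<omega>) ^ 6) \<le> 15 * D ^ 3 * (\<bar>u - v\<bar> + \<bar>t - s\<bar>) ^ 3"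
      by (simp add: power_mult_distrib)
  qed
qed

theorem continuous_modification:
  "\<exists>X :: real \<times> real \<Rightarrow> upath \<Rightarrow> real. (\<forall>p. X p \<in> borel_measurable W) \<and>
     (\<forall>u t. AE \<omega> in W. X (u, t) \<omega> = upath_apply (S u \<omega>) t) \<and>
     (\<forall>\<omega>\<in>space W. continuous_on UNIV (\<lambda>p. X p \<omega>))"
proof -
  obtain C where C: "\<And>u t v s. \<bar>u - v\<bar> \<le> 1 \<Longrightarrow> \<bar>t - s\<bar> \<le> 1 \<Longrightarrow>
     expectation (\<lambda>\<omega>. (\<xi> (u, t) \<omega> - \<xi> (v, s) \<omega>) ^ 6) \<le> C * (\<bar>u - v\<bar> + \<bar>t - s\<bar>) ^ 3"
    using \<xi>_increment_moment by blast
  obtain Z where Z: "\<And>p. Z p \<in> borel_measurable W" "\<And>p. AE \<omega> in W. Z p \<omega> = \<xi> p \<omega>"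
     "\<And>\<omega>. \<omega> \<in> space W \<Longrightarrow> continuous_on UNIV (\<lambda>p. Z p \<omega>)"
    using kolmogorov_continuous_modification[OF \<xi>_measurable gauss_moments(4)[OF \<xi>_gauss_difference] C] by blast
  have "AE \<omega> in W. Z (u, t) \<omega> = upath_apply (S u \<omega>) t" for u t
    using Z(2)[of "(u, t)"] S_eq_\<xi>_AE[of u t] by eventually_elim simp
  with Z show ?thesis by blast
qed

end

theorem mainTheorem2:
  fixes P :: "'w measure" and B :: "real \<Rightarrow> 'w \<Rightarrow> real"
    and W :: "upath measure"
    and I :: "upath \<Rightarrow> upath \<Rightarrow> real"
    and Q :: "real \<Rightarrow> upath \<Rightarrow> upath"
    and S :: "real \<Rightarrow> upath \<Rightarrow> upath"
  assumes "standard_brownian_motion P B"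
    and "path_law P (\<lambda>t \<omega>. exp (- t / 2) * B (exp t) \<omega>) W"
    and "paley_wiener_map HU HU_inner W I"
    and "\<And>u. orthogonal_transformation_on HU HU_inner (Q u)"
    and "\<And>u h. h \<in> HU \<Longrightarrow>
           \<exists>g. l2_fourier (\<lambda>x. complex_of_real (upath_apply h x)) g \<and>
               l2_fourier (\<lambda>x. complex_of_real (upath_apply (Q u h) x))
                 (\<lambda>l. exp (- 2 * \<i> * complex_of_real (u * arctan (2 * l))) * g l)"
    and "\<And>u. wiener_transformation HU HU_inner W I (Q u) (S u)"
  shows
    "(\<forall>u t. (\<lambda>\<omega>. upath_apply (S u \<omega>) t) \<in> borel_measurable W \<and>
            integrable W (\<lambda>\<omega>. (upath_apply (S u \<omega>) t)\<^sup>2) \<and>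
            (LINT \<omega>|W. upath_apply (S u \<omega>) t) = 0) \<and>
     gaussian_family W (\<lambda>(u, t) \<omega>. upath_apply (S u \<omega>) t) \<and>
     (\<forall>u v s t. complex_of_real (LINT \<omega>|W. upath_apply (S u \<omega>) s * upath_apply (S v \<omega>) t) =
        2 / complex_of_real pi *
          (LINT l|lborel.
             exp (\<i> * complex_of_real ((t - s) * l + 2 * (u - v) * arctan (2 * l))) /
             complex_of_real (1 + 4 * l\<^sup>2))) \<and>
     (\<forall>a b. distr W (PiM UNIV (\<lambda>_. borel)) (\<lambda>\<omega> (u, t). upath_apply (S (u + a) \<omega>) (t + b)) =
            distr W (PiM UNIV (\<lambda>_. borel)) (\<lambda>\<omega> (u, t). upath_apply (S u \<omega>) t)) \<and>
     (\<exists>X :: real \<times> real \<Rightarrow> upath \<Rightarrow> real.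
        (\<forall>p. X p \<in> borel_measurable W) \<and>
        (\<forall>u t. AE \<omega> in W. X (u, t) \<omega> = upath_apply (S u \<omega>) t) \<and>
        (\<forall>\<omega>\<in>space W. continuous_on UNIV (\<lambda>p. X p \<omega>))) \<and>
     (\<forall>u. distr W borel (S u) = W)"
proof -
  interpret ou_flow P B W I Q S
    by unfold_locales (use assms in blast)+
  have eval_gauss: "\<exists>v. gauss (\<lambda>\<omega>. upath_apply (S u \<omega>) t) v" for u t
    using version_combination_gauss[of "{()}" "\<lambda>_ \<omega>. upath_apply (S u \<omega>) t" "\<lambda>_. (u, t)" "\<lambda>_. 1",
        OF _ S_eq_\<xi>_AE eval_S_measurable] by auto
  show ?thesis
  proof (intro conjI allI)
    fix u t
    obtain v where v: "gauss (\<lambda>\<omega>. upath_apply (S u \<omega>) t) v" using eval_gauss by blast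
    show "(\<lambda>\<omega>. upath_apply (S u \<omega>) t) \<in> borel_measurable W" by measurable
    show "integrable W (\<lambda>\<omega>. (upath_apply (S u \<omega>) t)\<^sup>2)" by (rule gauss_moments(2)[OF v])
    show "(LINT \<omega>|W. upath_apply (S u \<omega>) t) = 0" by (rule gauss_moments(1)[OF v])
  next
    show "gaussian_family W (\<lambda>(u, t) \<omega>. upath_apply (S u \<omega>) t)"
      unfolding gaussian_family_def
    proof (intro allI impI)
      fix F :: "(real \<times> real) set" and c assume F: "finite F"
      have "gauss (\<lambda>\<omega>. \<Sum>i\<in>F. c i * (case i of (u, t) \<Rightarrow> \<lambda>\<omega>. upath_apply (S u \<omega>) t) \<omega>)
        (\<Sum>j\<in>F. \<Sum>j'\<in>F. c j * c j' * Re (ou_cov (fst j - fst j') (snd j' - snd j)))"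
        by (rule version_combination_gauss[OF F, where g = "\<lambda>j. j"])
           (auto split: prod.splits simp: S_eq_\<xi>_AE)
      from gauss_rv[OF this]
      show "gaussian_rv W (\<lambda>\<omega>. \<Sum>i\<in>F. c i * (case i of (u, t) \<Rightarrow> \<lambda>\<omega>. upath_apply (S u \<omega>) t) \<omega>)"
        unfolding gaussian_rv_def .
    qed
  next
    fix u v s t
    have "(LINT \<omega>|W. upath_apply (S u \<omega>) s * upath_apply (S v \<omega>) t) = expectation (\<lambda>\<omega>. \<xi> (u, s) \<omega> * \<xi> (v, t) \<omega>)"
    proof (rule integral_cong_AE)
      show "AE \<omega> in W. upath_apply (S u \<omega>) s * upath_apply (S v \<omega>) t = \<xi> (u, s) \<omega> * \<xi> (v, t) \<omega>"
        using S_eq_\<xi>_AE[of u s] S_eq_\<xi>_AE[of v t] by eventually_elim simp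
    qed measurable
    thus "complex_of_real (LINT \<omega>|W. upath_apply (S u \<omega>) s * upath_apply (S v \<omega>) t) =
        2 / complex_of_real pi *
          (LINT l|lborel.
             exp (\<i> * complex_of_real ((t - s) * l + 2 * (u - v) * arctan (2 * l))) /
             complex_of_real (1 + 4 * l\<^sup>2))"
      using \<xi>_cov[of "(u, s)" "(v, t)"] by (simp only: fst_conv snd_conv ou_cov_def)
  next
    fix a b :: real
    have "distr W (PiM UNIV (\<lambda>_. borel)) (\<lambda>\<omega> j. (\<lambda>(u, t) \<omega>. upath_apply (S (u + a) \<omega>) (t + b)) j \<omega>) =
          distr W (PiM UNIV (\<lambda>_. borel)) (\<lambda>\<omega> j. (\<lambda>(u, t) \<omega>. upath_apply (S u \<omega>) t) j \<omega>)"
      by (rule versions_same_law[where g = "\<lambda>j. (fst j + a, snd j + b)" and g' = "\<lambda>j. j"])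
         (auto split: prod.splits simp: S_eq_\<xi>_AE)
    thus "distr W (PiM UNIV (\<lambda>_. borel)) (\<lambda>\<omega> (u, t). upath_apply (S (u + a) \<omega>) (t + b)) =
          distr W (PiM UNIV (\<lambda>_. borel)) (\<lambda>\<omega> (u, t). upath_apply (S u \<omega>) t)"
      by (simp add: case_prod_unfold)
  next
    show "\<exists>X :: real \<times> real \<Rightarrow> upath \<Rightarrow> real.
        (\<forall>p. X p \<in> borel_measurable W) \<and>
        (\<forall>u t. AE \<omega> in W. X (u, t) \<omega> = upath_apply (S u \<omega>) t) \<and>
        (\<forall>\<omega>\<in>space W. continuous_on UNIV (\<lambda>p. X p \<omega>))" by (rule continuous_modification)
  next
    show "distr W borel (S u) = W" for u by (rule S_preserves_law)
  qed
qed

end
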